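(* Each desingularised vector field $X_\eta$, $\eta\in\{\alpha,\beta,\gamma,\delta\}$, restricted to the collision manifold $\mathcal C$, is integrable with first integrals given by the images of $\kappa_1,\kappa_2,h_1,h_2,\Gamma_1,\Gamma_2,x,y$ in each chart.
   Context: **Setting.** The planar 4-body problem near a simultaneous binary collision of the pairs $\{1,2\}$ and $\{3,4\}$ is written in coordinates $(\zeta_1,\zeta_2,h_1,h_2,\Gamma_1,\Gamma_2,x,y)\in\mathbb{C}^2\times\mathcal M$, $\mathcal M=\mathbb{R}^2\times\hat{\mathbb{C}}^2\times\mathbb{C}^2$, $\hat{\mathbb C}=\{|z|=1\}$, where (for masses $m_i>0$, $Q_1,Q_2$ the relative position vectors of the two binaries with conjugate momenta $P_1,P_2$, $x\ne0$ the vector between their centres of mass with conjugate momentum $y$) one sets $M_1=\frac{m_1m_2}{m_1+m_2}$, $M_2=\frac{m_3m_4}{m_3+m_4}$, $k_1=m_1m_2$, $k_2=m_3m_4$, $a_j=16k_j^2M_j$, $4k_jM_jQ_j=\frac12\tilde z_j^2$, $(4k_jM_j)^{-1}P_j=u_j/\bar{\tilde z}_j$, and $\zeta_j=a_j^{-1/3}\bar u_j\tilde z_j$, $h_j=a_j^{2/3}|\tilde z_j|^{-2}(|u_j|^2-1)$, $\Gamma_j=u_j/|u_j|$. $X=|\zeta_1|^2|\zeta_2|^2X_H$ is the time-rescaled Hamiltonian vector field of the 4-body problem in these coordinates; it vanishes on the simultaneous binary collision set $\mathscr C=\{\zeta_1=\zeta_2=0\}$. At leading order at $\mathscr C$ it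 reads $\zeta_1'=|\zeta_2|^2$, $\zeta_2'=|\zeta_1|^2$, all other components being of higher order. **Blow-up.** With $\zeta_1=\zeta_{11}+i\zeta_{12}$, $\zeta_2=\zeta_{21}+i\zeta_{22}$, $\pmb\zeta=(\zeta_{11},\zeta_{12},\zeta_{21},\zeta_{22})$, let $\mathcal B=\{(\pmb\zeta,[\alpha,\beta,\gamma,\delta])\in\mathbb{R}^4\times\mathbb{RP}^3:\exists r\in\mathbb R,\ \pmb\zeta=r(\alpha,\beta,\gamma,\delta)\}$. The collision manifold is $\mathcal C=\{\pmb\zeta=0\}\cong\mathbb{RP}^3\times\mathcal M$ in $\mathcal B\times\mathcal M$ (dimension 11). In the chart $\{\eta\neq0\}$, $\eta\in\{\alpha,\beta,\gamma,\delta\}$, use coordinates $r_\eta$ and $\xi_\eta=\xi/\eta$ ($\xi\ne\eta$), with $\pmb\zeta=r_\eta(\alpha_\eta,\beta_\eta,\gamma_\eta,\delta_\eta)$, $\eta_\eta=1$, together with those on $\mathcal M$. The desingularised vector field $X_\eta$ is $r_\eta^{-1}$ times the pull-back of $X$, extended to $r_\eta=0$, which is $\mathcal C$ in this chart. On $r_\eta=0$ the $\mathcal M$-components vanish and the rest are: - $\alpha$-chart: $\beta'=-\beta(\gamma^2+\delta^2)$, $\gamma'=1+\beta^2-\gamma(\gamma^2+\delta^2)$, $\delta'=-\delta(\gamma^2+\delta^2)$; - $\beta$-chart: $\alpha'=\gamma^2+\delta^2$, $\gamma'=1+\alpha^2$, $\delta'=0$; - $\gamma$-chart: $\alpha'=1+\delta^2-\alpha(\alpha^2+\beta^2)$,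 $\beta'=-\beta(\alpha^2+\beta^2)$, $\delta'=-\delta(\alpha^2+\beta^2)$; - $\delta$-chart: $\alpha'=1+\gamma^2$, $\beta'=0$, $\gamma'=\alpha^2+\beta^2$ (chart subscripts omitted). **Integrals.** Let $\hat\kappa_1([\alpha,\beta,\gamma,\delta])=[\beta,\delta]$ and $\hat\kappa_2([\alpha,\beta,\gamma,\delta])=[\beta^3,(\alpha^3+3\beta^2\alpha)-(\gamma^3+3\delta^2\gamma)]$, with values in $\mathbb{RP}^1$, defined where the right-hand sides are not $[0,0]$. Let $\iota:\mathbb{RP}^1\to\mathbb{R}\cup\{\infty\}$, $[a,b]\mapsto b/a$, and $\kappa_i=\iota\circ\hat\kappa_i$. "Integrable" means possessing generically functionally independent first integrals in number equal to the dimension minus one (here 10 real functions on the 11-dimensional $\mathcal C$). *)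

theory Defs
  imports "HOL-Analysis.Analysis"
begin

section \<open>The planar 4-body problem\<close>

text \<open>Phase points are \<open>((Q1, Q2, x), (P1, P2, y))\<close>. Only \<open>m 1, ..., m 4\<close> matter, and
  binary \<open>j\<close> consists of the bodies \<open>2 j - 1\<close> and \<open>2 j\<close>. The signs are fixed by
  \<open>Q1 = q1 - q2\<close>, \<open>Q2 = q3 - q4\<close>, \<open>x = c12 - c34\<close> (centres of mass of the binaries).\<close>

type_synonym config = "complex \<times> complex \<times> complex"
type_synonym phase = "config \<times> config"

definition bmass :: "(nat \<Rightarrow> real) \<Rightarrow> nat \<Rightarrow> real" where
  "bmass m j = m (2 * j - 1) + m (2 * j)"

definition redmass :: "(nat \<Rightarrow> real) \<Rightarrow> nat \<Rightarrow> real" where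
  "redmass m j = m (2 * j - 1) * m (2 * j) / bmass m j"

definition kc :: "(nat \<Rightarrow> real) \<Rightarrow> nat \<Rightarrow> real" where
  "kc m j = m (2 * j - 1) * m (2 * j)"

definition ac :: "(nat \<Rightarrow> real) \<Rightarrow> nat \<Rightarrow> real" where
  "ac m j = 16 * (kc m j)\<^sup>2 * redmass m j"

text \<open>Positions and momenta of the four bodies in the centre-of-mass frame; that
  \<open>P1, P2, y\<close> are conjugate to \<open>Q1, Q2, x\<close> is lemma \<open>conjugate_momenta\<close> below.\<close>

fun position :: "(nat \<Rightarrow> real) \<Rightarrow> config \<Rightarrow> nat \<Rightarrow> complex" where
  "position m (Q1, Q2, x) i =
     (let c12 = (bmass m 2 / (bmass m 1 + bmass m 2)) *\<^sub>R x;
          c34 = - (bmass m 1 / (bmass m 1 + bmass m 2)) *\<^sub>R x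
      in if i = 1 then c12 + (m 2 / bmass m 1) *\<^sub>R Q1
         else if i = 2 then c12 - (m 1 / bmass m 1) *\<^sub>R Q1
         else if i = 3 then c34 + (m 4 / bmass m 2) *\<^sub>R Q2
         else c34 - (m 3 / bmass m 2) *\<^sub>R Q2)"

fun momentum :: "(nat \<Rightarrow> real) \<Rightarrow> config \<Rightarrow> nat \<Rightarrow> complex" where
  "momentum m (P1, P2, y) i =
     (if i = 1 then P1 + (m 1 / bmass m 1) *\<^sub>R y
      else if i = 2 then - P1 + (m 2 / bmass m 1) *\<^sub>R y
      else if i = 3 then P2 - (m 3 / bmass m 2) *\<^sub>R y
      else - P2 - (m 4 / bmass m 2) *\<^sub>R y)"

definition hamiltonian :: "(nat \<Rightarrow> real) \<Rightarrow> phase \<Rightarrow> real" where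
  "hamiltonian m = (\<lambda>(q, p).
     (\<Sum>i\<in>{1..4}. (norm (momentum m p i))\<^sup>2 / (2 * m i))
     - (\<Sum>i\<in>{1..4}. \<Sum>j\<in>{i<..4}. m i * m j / norm (position m q i - position m q j)))"

definition grad :: "('a::real_inner \<Rightarrow> real) \<Rightarrow> 'a \<Rightarrow> 'a" where
  "grad H p = (THE D. GDERIV H p :> D)"

definition hamiltonian_vf :: "('b::real_inner \<times> 'b \<Rightarrow> real) \<Rightarrow> 'b \<times> 'b \<Rightarrow> 'b \<times> 'b" where
  "hamiltonian_vf H p = (snd (grad H p), - fst (grad H p))"


section \<open>Regularising coordinates\<close>

text \<open>\<open>mpoint\<close> is the ambient space \<open>(h1, h2, \<Gamma>1, \<Gamma>2, x, y)\<close> of \<open>\<M>\<close>. The vector \<open>x\<close>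
  between the centres of mass is nonzero throughout.\<close>

type_synonym mpoint = "real \<times> real \<times> complex \<times> complex \<times> complex \<times> complex"
type_synonym coords = "complex \<times> complex \<times> mpoint"

definition Mset :: "mpoint set" where
  "Mset = {(h1, h2, \<Gamma>1, \<Gamma>2, x, y). norm \<Gamma>1 = 1 \<and> norm \<Gamma>2 = 1 \<and> x \<noteq> 0}"

text \<open>Two maps out of the space of all \<open>((z1, z2, x), (u1, u2, y))\<close>: one to phase space
  and one to the coordinates \<open>(\<zeta>1, \<zeta>2, h1, h2, \<Gamma>1, \<Gamma>2, x, y)\<close>.\<close>

definition to_phase :: "(nat \<Rightarrow> real) \<Rightarrow> phase \<Rightarrow> phase" where
  "to_phase m = (\<lambda>((z1, z2, x), (u1, u2, y)).
     let Q = (\<lambda>j z. z\<^sup>2 / of_real (2 * (4 * kc m j * redmass m j)));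
         P = (\<lambda>j z u. of_real (4 * kc m j * redmass m j) * (u / cnj z))
     in ((Q 1 z1, Q 2 z2, x), (P 1 z1 u1, P 2 z2 u2, y)))"

definition to_coords :: "(nat \<Rightarrow> real) \<Rightarrow> phase \<Rightarrow> coords" where
  "to_coords m = (\<lambda>((z1, z2, x), (u1, u2, y)).
     let \<zeta> = (\<lambda>j z u. of_real (ac m j powr (- 1 / 3)) * (cnj u * z));
         h = (\<lambda>j z u. ac m j powr (2 / 3) * ((norm u)\<^sup>2 - 1) / (norm z)\<^sup>2);
         \<Gamma> = (\<lambda>u. u / of_real (norm u))
     in (\<zeta> 1 z1 u1, \<zeta> 2 z2 u2, h 1 z1 u1, h 2 z2 u2, \<Gamma> u1, \<Gamma> u2, x, y))"

text \<open>Binary collisions have \<open>\<bar>u\<bar> = 1\<close>. For given \<open>\<zeta>, h\<close> the value \<open>s = \<bar>u\<bar>\<^sup>2\<close> solves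
  \<open>s (s - 1) = h \<bar>\<zeta>\<bar>\<^sup>2\<close>; the branch through the collision \<open>s = 1\<close> is \<open>s > 1 / 2\<close>, and on it
  \<open>to_coords\<close> is injective.\<close>

definition regular_points :: "(nat \<Rightarrow> real) \<Rightarrow> phase set" where
  "regular_points m = {w. case w of ((z1, z2, x), (u1, u2, y)) \<Rightarrow>
     z1 \<noteq> 0 \<and> z2 \<noteq> 0 \<and> (norm u1)\<^sup>2 > 1 / 2 \<and> (norm u2)\<^sup>2 > 1 / 2 \<and> x \<noteq> 0 \<and>
     inj_on (position m (fst (to_phase m w))) {1..4}}"

definition pullback_vf ::
  "('a::real_normed_vector \<Rightarrow> 'b::real_normed_vector) \<Rightarrow> ('b \<Rightarrow> 'b) \<Rightarrow> 'a \<Rightarrow> 'a" where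
  "pullback_vf f Y p = (THE v. frechet_derivative f (at p) v = Y (f p))"

definition pushforward_vf ::
  "'a set \<Rightarrow> ('a::real_normed_vector \<Rightarrow> 'b::real_normed_vector) \<Rightarrow> ('a \<Rightarrow> 'a) \<Rightarrow> 'b \<Rightarrow> 'b" where
  "pushforward_vf U f Y q = (let p = the_inv_into U f q in frechet_derivative f (at p) (Y p))"

text \<open>\<open>X_field\<close> is only meaningful on \<open>to_coords m ` regular_points m\<close>; elsewhere (in particular
  where \<open>\<zeta>1 = 0\<close> or \<open>\<zeta>2 = 0\<close>) the vector field is its continuous extension, which is
  subsumed by the limit in \<open>desing_vf\<close> below.\<close>

definition X_field :: "(nat \<Rightarrow> real) \<Rightarrow> coords \<Rightarrow> coords" where
  "X_field m p = (case p of (\<zeta>1, \<zeta>2, _) \<Rightarrow>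
     ((norm \<zeta>1)\<^sup>2 * (norm \<zeta>2)\<^sup>2) *\<^sub>R
       pushforward_vf (regular_points m) (to_coords m)
         (pullback_vf (to_phase m) (hamiltonian_vf (hamiltonian m))) p)"


section \<open>Blow-up and desingularised vector fields\<close>

text \<open>Points of real projective spaces are lines through the origin: \<open>[v] = span {v}\<close>.\<close>

type_synonym vec4 = "real \<times> real \<times> real \<times> real"

definition projective_space :: "'a::real_vector set set" where
  "projective_space = {span {v} | v. v \<noteq> 0}"

definition blowup :: "(vec4 \<times> vec4 set) set" where
  "blowup = {(\<zeta>, L). L \<in> projective_space \<and> \<zeta> \<in> L}"

definition collision_manifold :: "((vec4 \<times> vec4 set) \<times> mpoint) set" where
  "collision_manifold = {((\<zeta>, L), \<mu>). (\<zeta>, L) \<in> blowup \<and> \<mu> \<in> Mset \<and> \<zeta> = 0}"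

datatype axis = Alpha | Beta | Gamma | Delta

type_synonym chart = "real \<times> (real \<times> real \<times> real) \<times> mpoint"

text \<open>\<open>hom \<eta> \<xi>\<close> inserts \<open>\<eta>\<^sub>\<eta> = 1\<close> among the three coordinates \<open>\<xi>\<close>.\<close>

fun hom :: "axis \<Rightarrow> real \<times> real \<times> real \<Rightarrow> vec4" where
  "hom Alpha (b, c, d) = (1, b, c, d)"
| "hom Beta (a, c, d) = (a, 1, c, d)"
| "hom Gamma (a, b, d) = (a, b, 1, d)"
| "hom Delta (a, b, c) = (a, b, c, 1)"

definition chart_param :: "axis \<Rightarrow> chart \<Rightarrow> (vec4 \<times> vec4 set) \<times> mpoint" where
  "chart_param \<eta> = (\<lambda>(r, \<xi>, \<mu>). ((r *\<^sub>R hom \<eta> \<xi>, span {hom \<eta> \<xi>}), \<mu>))"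

definition blowdown :: "axis \<Rightarrow> chart \<Rightarrow> coords" where
  "blowdown \<eta> p = (case chart_param \<eta> p of (((a, b, c, d), L), \<mu>) \<Rightarrow>
     (Complex a b, Complex c d, \<mu>))"

definition chart_C :: "axis \<Rightarrow> chart set" where
  "chart_C \<eta> = {p. chart_param \<eta> p \<in> collision_manifold}"

definition chart_regular :: "(nat \<Rightarrow> real) \<Rightarrow> axis \<Rightarrow> chart set" where
  "chart_regular m \<eta> = {p. fst p \<noteq> 0 \<and> blowdown \<eta> p \<in> to_coords m ` regular_points m}"

definition desing_vf :: "(nat \<Rightarrow> real) \<Rightarrow> axis \<Rightarrow> chart \<Rightarrow> chart" where
  "desing_vf m \<eta> p =
     (let Y = (\<lambda>q. inverse (fst q) *\<^sub>R pullback_vf (blowdown \<eta>) (X_field m) q)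
      in if p \<in> chart_regular m \<eta> then Y p else Lim (at p within chart_regular m \<eta>) Y)"


section \<open>The integrals\<close>

text \<open>The formulas in \<open>kappa_hat1, kappa_hat2\<close> are homogeneous of odd degree, so the image of a line
  is a line, or \<open>{0}\<close> exactly where the formula gives \<open>[0, 0]\<close>.\<close>

definition kappa_hat1 :: "vec4 set \<Rightarrow> (real \<times> real) set" where
  "kappa_hat1 L = (\<lambda>(\<alpha>, \<beta>, \<gamma>, \<delta>). (\<beta>, \<delta>)) ` L"

definition kappa_hat2 :: "vec4 set \<Rightarrow> (real \<times> real) set" where
  "kappa_hat2 L = (\<lambda>(\<alpha>, \<beta>, \<gamma>, \<delta>).
     (\<beta> ^ 3, (\<alpha> ^ 3 + 3 * \<beta>\<^sup>2 * \<alpha>) - (\<gamma> ^ 3 + 3 * \<delta>\<^sup>2 * \<gamma>))) ` L"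

text \<open>\<open>[a, b] \<mapsto> b / a\<close>; \<open>None\<close> is the point \<open>\<infinity>\<close> of \<open>\<real> \<union> {\<infinity>}\<close>, as in
  \<open>Alexandroff_compactification\<close>.\<close>

definition iota :: "(real \<times> real) set \<Rightarrow> real option" where
  "iota l = (if \<exists>t. (1, t) \<in> l then Some (THE t. (1, t) \<in> l) else None)"

definition kappa_in_chart :: "(vec4 set \<Rightarrow> (real \<times> real) set) \<Rightarrow> axis \<Rightarrow> chart \<Rightarrow> real option" where
  "kappa_in_chart \<kappa> \<eta> p = (case chart_param \<eta> p of ((\<zeta>, L), \<mu>) \<Rightarrow> iota (\<kappa> L))"

definition kappa_domain :: "(vec4 set \<Rightarrow> (real \<times> real) set) \<Rightarrow> axis \<Rightarrow> chart set" where
  "kappa_domain \<kappa> \<eta> = {p \<in> chart_C \<eta>.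
     case chart_param \<eta> p of ((\<zeta>, L), \<mu>) \<Rightarrow> \<kappa> L \<in> projective_space}"


section \<open>Integrability on an embedded manifold\<close>

definition tangent_space :: "'a::real_normed_vector set \<Rightarrow> 'a \<Rightarrow> 'a set" where
  "tangent_space S p = {v. \<exists>c :: real \<Rightarrow> 'a.
     range c \<subseteq> S \<and> c 0 = p \<and> (c has_vector_derivative v) (at 0)}"

definition vector_field_on :: "'a::real_normed_vector set \<Rightarrow> ('a \<Rightarrow> 'a) \<Rightarrow> bool" where
  "vector_field_on S V \<longleftrightarrow> (\<forall>p\<in>S. V p \<in> tangent_space S p)"

definition open_dense_in :: "'a::topological_space set \<Rightarrow> 'a set \<Rightarrow> bool" where
  "open_dense_in S D \<longleftrightarrow> openin (top_of_set S) D \<and> S \<subseteq> closure D"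

definition integral_curve ::
  "'a::real_normed_vector set \<Rightarrow> ('a \<Rightarrow> 'a) \<Rightarrow> real set \<Rightarrow> (real \<Rightarrow> 'a) \<Rightarrow> bool" where
  "integral_curve D V T c \<longleftrightarrow> is_interval T \<and>
     (\<forall>t\<in>T. c t \<in> D \<and> (c has_vector_derivative V (c t)) (at t within T))"

text \<open>A first integral of \<open>V\<close> on \<open>S\<close> may be undefined off an open dense set \<open>D\<close>, and takes
  values in a topological space \<open>Y\<close>.\<close>

definition first_integral :: "'a::real_normed_vector set \<Rightarrow> ('a \<Rightarrow> 'a) \<Rightarrow>
    'a set \<Rightarrow> 'b topology \<Rightarrow> ('a \<Rightarrow> 'b) \<Rightarrow> bool" where
  "first_integral S V D Y f \<longleftrightarrow> open_dense_in S D \<and> continuous_map (top_of_set D) Y f \<and>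
     (\<forall>T c. integral_curve D V T c \<longrightarrow> (\<forall>s\<in>T. \<forall>t\<in>T. f (c s) = f (c t)))"

text \<open>The components of \<open>F\<close> amount to \<open>n\<close> real functions, possibly with values constrained to a
  submanifold of the target (such as a circle); independence means that the differential of
  \<open>F\<close> on the tangent space has rank \<open>n\<close>. \<open>E\<close> is the set where \<open>F\<close> is meaningful.\<close>

definition generically_independent :: "'a::euclidean_space set \<Rightarrow> 'a set \<Rightarrow> nat \<Rightarrow>
    ('a \<Rightarrow> 'b::euclidean_space) \<Rightarrow> bool" where
  "generically_independent S E n F \<longleftrightarrow> (\<exists>G. open_dense_in S G \<and> G \<subseteq> E \<and>
     (\<forall>p\<in>G. \<exists>F'. (F has_derivative F') (at p within S) \<and> dim (F' ` tangent_space S p) = n))"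


section \<open>Consistency of the conventions\<close>

lemma position_differences:
  assumes "\<And>i. i \<in> {1..4} \<Longrightarrow> m i > 0"
  shows "position m (Q1, Q2, x) 1 - position m (Q1, Q2, x) 2 = Q1"
    and "position m (Q1, Q2, x) 3 - position m (Q1, Q2, x) 4 = Q2"
proof -
  have *: "m 1 > 0" "m 2 > 0" "m 3 > 0" "m 4 > 0"
    using assms by auto
  have "m 2 / bmass m 1 + m 1 / bmass m 1 = 1" "m 4 / bmass m 2 + m 3 / bmass m 2 = 1"
    using * by (auto simp: bmass_def simp flip: add_divide_distrib)
  then show "position m (Q1, Q2, x) 1 - position m (Q1, Q2, x) 2 = Q1"
    and "position m (Q1, Q2, x) 3 - position m (Q1, Q2, x) 4 = Q2"
    by (simp_all add: Let_def flip: scaleR_add_left)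
qed

lemma conjugate_momenta:
  assumes "\<And>i. i \<in> {1..4} \<Longrightarrow> m i > 0"
  shows "(\<Sum>i\<in>{1..4}. momentum m (P1, P2, y) i \<bullet> position m (Q1, Q2, x) i)
    = P1 \<bullet> Q1 + P2 \<bullet> Q2 + y \<bullet> x"
proof -
  have *: "m 1 > 0" "m 2 > 0" "m 3 > 0" "m 4 > 0"
    using assms by auto
  have set: "{1..4::nat} = {1, 2, 3, 4}"
    by auto
  define a b c where "a = m 2 / bmass m 1" and "b = m 4 / bmass m 2"
    and "c = bmass m 1 / (bmass m 1 + bmass m 2)"
  have bm: "bmass m 1 = m 1 + m 2" "bmass m 2 = m 3 + m 4"
    by (simp_all add: bmass_def eval_nat_numeral)
  have ne: "m 1 + m 2 \<noteq> 0" "m 3 + m 4 \<noteq> 0" "m 3 + m 4 + (m 1 + m 2) \<noteq> 0"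
    using * by linarith+
  have "m 1 / bmass m 1 = 1 - a" "m 3 / bmass m 2 = 1 - b"
    "bmass m 2 / (bmass m 1 + bmass m 2) = 1 - c"
    using ne
    by (simp_all add: a_def b_def c_def diff_divide_distrib eq_diff_eq bm
        flip: add_divide_distrib del: One_nat_def)
  then show ?thesis
    unfolding set
    by (simp add: Let_def del: One_nat_def flip: a_def b_def c_def)
       (simp add: inner_simps algebra_simps)
qed

end

theory Submission
  imports Defs
begin

text \<open>
  On the collision manifold only the leading order of the vector field survives. This is
  \<open>\<zeta>1' = \<bar>\<zeta>2\<bar>\<^sup>2\<close>, \<open>\<zeta>2' = \<bar>\<zeta>1\<bar>\<^sup>2\<close>, that is, the homogeneous field
  \<open>Z = (\<gamma>\<^sup>2 + \<delta>\<^sup>2, 0, \<alpha>\<^sup>2 + \<beta>\<^sup>2, 0)\<close> on \<open>\<real>\<^sup>4\<close> (\<open>hom_field\<close>). A chart represents the line through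
  \<open>v = hom \<eta> \<xi>\<close>, and the desingularised flow moves it by \<open>v' = Z v - g v\<close>, where the scalar \<open>g\<close> keeps
  the coordinate \<open>\<eta>\<close> of \<open>v\<close> equal to \<open>1\<close>; the point of \<open>\<M>\<close> is at rest. This is
  \<open>desing_vf_collision\<close>.

  To get there, the Hamiltonian field is transported through all coordinate changes explicitly.
  In the variables \<open>z, u\<close> the Kepler force of each binary is combined with the kinetic terms into a
  multiple of \<open>\<bar>u\<bar>\<^sup>2 - 1\<close>, which the coordinate \<open>h\<close> controls (\<open>kepler_z\<close>, \<open>kepler_u\<close>). After
  multiplication by \<open>\<bar>\<zeta>\<bar>\<^sup>2\<close>, the derivatives of \<open>\<zeta>\<close>, \<open>h\<close> and \<open>\<Gamma>\<close> are continuous up to \<open>\<zeta> = 0\<close>, with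
  the values \<open>1\<close>, \<open>0\<close> and \<open>0\<close> there (\<open>slow_zeta\<close>, \<open>slow_h\<close>, \<open>slow_u\<close>, \<open>rates_tendsto\<close>). The factor
  belonging to the other binary supplies \<open>r\<^sup>2\<close>, which makes the division by \<open>r\<close> harmless
  (\<open>desing_eq_rescaled_field\<close>).

  The field \<open>Z\<close> has the integrals \<open>\<beta>\<close>, \<open>\<delta>\<close> and \<open>(\<alpha>\<^sup>3 + 3 \<beta>\<^sup>2 \<alpha>) - (\<gamma>\<^sup>3 + 3 \<delta>\<^sup>2 \<gamma>)\<close>. A pair \<open>w\<close> of integrals of
  \<open>Z\<close> that are homogeneous of the same degree \<open>n\<close> satisfies \<open>(w v)' = - n g (w v)\<close> along the
  flow, by Euler's relation. Hence the line through \<open>w v\<close> is constant, although \<open>w v\<close> is not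
  (\<open>kappa_first_integral\<close>). For \<open>(\<beta>, \<delta>)\<close> this gives \<open>\<kappa>1\<close>, and for \<open>\<beta>\<^sup>3\<close> together with the
  cubic it gives \<open>\<kappa>2\<close>.

  Independence holds wherever \<open>\<beta> \<noteq> 0\<close>: there \<open>\<kappa>1 = \<delta> / \<beta>\<close> changes with \<open>\<delta>\<close>, while \<open>\<kappa>2\<close> changes
  with \<open>\<alpha>\<close> at rate \<open>3 (\<alpha>\<^sup>2 + \<beta>\<^sup>2) / \<beta>\<^sup>3\<close> when \<open>\<kappa>1\<close> is kept fixed
  (\<open>kappa_deriv_surj\<close>), and the remaining functions are the coordinates of \<open>\<M>\<close>, of dimension \<open>8\<close>.
\<close>

section \<open>Gradients and pull-backs\<close>

lemma grad_eqI:
  assumes "GDERIV H p :> D"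
  shows "grad H p = D"
  unfolding grad_def
proof (rule the_equality)
  show "GDERIV H p :> D" by (fact assms)
next
  fix E assume "GDERIV H p :> E"
  then have "(\<lambda>v. v \<bullet> E) = (\<lambda>v. v \<bullet> D)"
    using assms by (metis gderiv_def has_derivative_unique)
  then have "v \<bullet> E = v \<bullet> D" for v
    by meson
  then have "v \<bullet> (E - D) = 0" for v
    by (simp add: inner_diff_right)
  then show "E = D"
    by (metis eq_iff_diff_eq_0 inner_eq_zero_iff)
qed

text \<open>A pull-back is determined as soon as the derivative is injective, so it can be found by guessing
  \<open>v\<close> and checking that \<open>f'\<close> maps it to the right vector.\<close>

lemma pullback_vf_eqI:
  assumes D: "(f has_derivative f') (at p)"
    and v: "f' v = Y (f p)" and inj: "\<And>w. f' w = 0 \<Longrightarrow> w = 0"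
  shows "pullback_vf f Y p = v"
proof -
  have fd: "frechet_derivative f (at p) = f'"
    using frechet_derivative_at[OF D] by simp
  have lin: "linear f'"
    using D has_derivative_linear by blast
  show ?thesis
    unfolding pullback_vf_def fd
  proof (rule the_equality)
    fix w assume "f' w = Y (f p)"
    then have "f' (w - v) = 0"
      using v lin by (simp add: linear_diff)
    then show "w = v"
      using inj by force
  qed (fact v)
qed


section \<open>The Hamiltonian vector field\<close>

text \<open>All six mutual distances are norms of real linear combinations of \<open>(Q1, Q2, x)\<close>. Treating them
  uniformly reduces the gradient of the potential to one computation.\<close>

fun separation :: "real \<times> real \<times> real \<Rightarrow> config \<Rightarrow> complex" where
  "separation (a, b, c) (Q1, Q2, x) = a *\<^sub>R Q1 + b *\<^sub>R Q2 + c *\<^sub>R x"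

fun along :: "real \<times> real \<times> real \<Rightarrow> complex \<Rightarrow> config" where
  "along (a, b, c) d = (a *\<^sub>R d, b *\<^sub>R d, c *\<^sub>R d)"

text \<open>The gradient of \<open>k / norm (separation l q)\<close> in \<open>q\<close>, see \<open>GDERIV_coulomb\<close> below.\<close>

definition attraction :: "real \<Rightarrow> real \<times> real \<times> real \<Rightarrow> config \<Rightarrow> config" where
  "attraction k l q = (- k / norm (separation l q) ^ 3) *\<^sub>R along l (separation l q)"

text \<open>This turns a force between two bodies into a gradient on the configuration space.\<close>

lemma separation_adjoint: "separation l v \<bullet> d = v \<bullet> along l d"
  by (cases l; cases v) (simp add: inner_simps)

lemma bounded_linear_separation: "bounded_linear (separation l)"
proof -
  obtain a b c where l: "l = (a, b, c)" by (cases l)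
  have "separation l = (\<lambda>q. a *\<^sub>R fst q + b *\<^sub>R fst (snd q) + c *\<^sub>R snd (snd q))"
    by (auto simp: l)
  then show ?thesis
    by (auto intro!: bounded_linear_intros)
qed

lemma GDERIV_coulomb:
  assumes "separation l q \<noteq> 0"
  shows "GDERIV (\<lambda>q. k / norm (separation l q)) q :> attraction k l q"
proof -
  have "((\<lambda>q. norm (separation l q)) has_derivative (\<lambda>v. separation l v \<bullet> sgn (separation l q))) (at q)"
    using has_derivative_compose[OF bounded_linear_imp_has_derivative[OF bounded_linear_separation]
        has_derivative_norm[OF assms]] .
  from has_derivative_divide'[OF has_derivative_const this, of k]
  have "((\<lambda>q. k / norm (separation l q)) has_derivative
      (\<lambda>v. (0 * norm (separation l q) - k * (separation l v \<bullet> sgn (separation l q))) / (norm (separation l q) * norm (separation l q)))) (at q)"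
    using assms by simp
  moreover have "(0 * norm (separation l q) - k * (separation l v \<bullet> sgn (separation l q))) / (norm (separation l q) * norm (separation l q))
      = v \<bullet> attraction k l q" for v
    using assms
    by (simp add: attraction_def sgn_div_norm divide_simps power3_eq_cube flip: separation_adjoint)
  ultimately show ?thesis
    by (simp add: gderiv_def)
qed

text \<open>Seen from the centres of mass, the bodies of a binary have coordinates proportional to \<open>Q1\<close> or
  \<open>Q2\<close>, with weights given by the mass of the partner. So the separation of two bodies from different
  binaries is \<open>x\<close> plus multiples of \<open>Q1\<close> and \<open>Q2\<close>; the coefficient \<open>1\<close> of \<open>x\<close> keeps it away from
  \<open>0\<close> at the simultaneous collision.\<close>

fun cross_coef :: "(nat \<Rightarrow> real) \<Rightarrow> nat \<Rightarrow> nat \<Rightarrow> real \<times> real \<times> real" where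
  "cross_coef m i j = (if i = 1 then m 2 / bmass m 1 else - m 1 / bmass m 1,
     if j = 3 then - m 4 / bmass m 2 else m 3 / bmass m 2, 1)"

text \<open>The force between the two binaries, that is, between the four pairs of bodies that do not belong
  to the same binary. It is the only part of the force that the regularisation of the binaries does not
  remove, and all that is needed of it is that it stays continuous when the binaries collapse.\<close>

definition tidal :: "(nat \<Rightarrow> real) \<Rightarrow> config \<Rightarrow> config" where
  "tidal m q = (\<Sum>i\<in>{1,2}. \<Sum>j\<in>{3,4}. attraction (m i * m j) (cross_coef m i j) q)"

definition kinetic :: "(nat \<Rightarrow> real) \<Rightarrow> config \<Rightarrow> real" where
  "kinetic m p = (\<Sum>i\<in>{1..4}. (norm (momentum m p i))\<^sup>2 / (2 * m i))"

definition velocity :: "(nat \<Rightarrow> real) \<Rightarrow> config \<Rightarrow> config" where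
  "velocity m p = (case p of (P1, P2, y) \<Rightarrow>
     ((1 / redmass m 1) *\<^sub>R P1, (1 / redmass m 2) *\<^sub>R P2, (1 / bmass m 1 + 1 / bmass m 2) *\<^sub>R y))"

lemma set_1_4: "{1..4::nat} = {1, 2, 3, 4}"
  by auto

text \<open>The mixed terms of internal momentum and \<open>y\<close> cancel within each binary because the bodies carry
  opposite internal momenta and shares of \<open>y\<close> proportional to their masses.\<close>

lemma kinetic_eq:
  assumes "\<And>i. i \<in> {1..4} \<Longrightarrow> m i > 0"
  shows "kinetic m p = (p \<bullet> velocity m p) / 2"
proof -
  obtain P1 P2 y where p: "p = (P1, P2, y)" by (cases p)
  have pos: "m 1 > 0" "m 2 > 0" "m 3 > 0" "m 4 > 0"
    using assms by auto
  have bm: "bmass m 1 = m 1 + m 2" "bmass m 2 = m 3 + m 4"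
    by (simp_all add: bmass_def eval_nat_numeral)
  have rm: "redmass m 1 = m 1 * m 2 / (m 1 + m 2)" "redmass m 2 = m 3 * m 4 / (m 3 + m 4)"
    by (simp_all add: redmass_def bmass_def eval_nat_numeral)
  have binary: "(norm (P + (a / (a + b)) *\<^sub>R w))\<^sup>2 / (2 * a) + (norm (- P + (b / (a + b)) *\<^sub>R w))\<^sup>2 / (2 * b)
      = (P \<bullet> P) * (a + b) / (a * b) / 2 + (w \<bullet> w) / (a + b) / 2"
    if "a > 0" "b > 0" for a b :: real and P w :: complex
  proof -
    have n: "a + b \<noteq> 0" using that by simp
    define c where "c = inverse (a + b)"
    have c: "c * (a + b) = 1" using n by (simp add: c_def)
    have "(norm (P + (a * c) *\<^sub>R w))\<^sup>2 / (2 * a) + (norm (- P + (b * c) *\<^sub>R w))\<^sup>2 / (2 * b)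
      = (P \<bullet> P) / (2 * a) + (P \<bullet> P) / (2 * b) + (w \<bullet> w) * c * (c * (a + b)) / 2"
      using that
      by (simp add: power2_norm_eq_inner inner_simps inner_commute field_simps)
    also have "\<dots> = (P \<bullet> P) * (a + b) / (a * b) / 2 + (w \<bullet> w) * c / 2"
      unfolding c using that by (simp add: field_simps)
    finally show ?thesis
      by (simp only: c_def divide_inverse[of a "a + b"] divide_inverse[of b "a + b"]
          divide_inverse[of "w \<bullet> w" "a + b"])
  qed
  have "kinetic m p = ((norm (P1 + (m 1 / (m 1 + m 2)) *\<^sub>R y))\<^sup>2 / (2 * m 1)
        + (norm (- P1 + (m 2 / (m 1 + m 2)) *\<^sub>R y))\<^sup>2 / (2 * m 2))
      + ((norm (P2 + (m 3 / (m 3 + m 4)) *\<^sub>R - y))\<^sup>2 / (2 * m 3)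
        + (norm (- P2 + (m 4 / (m 3 + m 4)) *\<^sub>R - y))\<^sup>2 / (2 * m 4))"
    unfolding kinetic_def set_1_4 p by (simp add: bm del: One_nat_def)
  also have "\<dots> = (p \<bullet> velocity m p) / 2"
    unfolding binary[OF pos(1,2)] binary[OF pos(3,4)]
    using pos by (simp add: p velocity_def bm rm inner_simps add_divide_distrib distrib_left distrib_right
        del: One_nat_def)
  finally show ?thesis .
qed

lemma bounded_linear_velocity: "bounded_linear (velocity m)"
  unfolding velocity_def case_prod_unfold
  by (auto intro!: bounded_linear_intros bounded_linear_Pair)

lemma GDERIV_kinetic:
  assumes "\<And>i. i \<in> {1..4} \<Longrightarrow> m i > 0"
  shows "GDERIV (kinetic m) p :> velocity m p"
proof -
  have sym: "velocity m v \<bullet> w = v \<bullet> velocity m w" for v w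
    by (simp add: velocity_def inner_simps split: prod.split)
  have "((\<lambda>p. (p \<bullet> velocity m p) / 2) has_derivative (\<lambda>v. v \<bullet> velocity m p)) (at p)"
    by (rule derivative_eq_intros bounded_linear_imp_has_derivative[OF bounded_linear_velocity] refl | simp)+
      (use sym in \<open>simp add: fun_eq_iff inner_commute[of p]\<close>)
  moreover have "kinetic m = (\<lambda>p. (p \<bullet> velocity m p) / 2)"
    using kinetic_eq[of m, OF assms] by blast
  ultimately show ?thesis
    by (simp add: gderiv_def)
qed

lemma position_separation:
  assumes "\<And>i. i \<in> {1..4} \<Longrightarrow> m i > 0"
  shows "position m q 1 - position m q 2 = separation (1, 0, 0) q"
    "position m q 3 - position m q 4 = separation (0, 1, 0) q"
    "\<And>i j. i \<in> {1,2} \<Longrightarrow> j \<in> {3,4} \<Longrightarrow> position m q i - position m q j = separation (cross_coef m i j) q"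
proof -
  obtain Q1 Q2 x where q: "q = (Q1, Q2, x)" by (cases q)
  have pos: "m 1 > 0" "m 2 > 0" "m 3 > 0" "m 4 > 0"
    using assms by auto
  show "position m q 1 - position m q 2 = separation (1, 0, 0) q"
    "position m q 3 - position m q 4 = separation (0, 1, 0) q"
    using position_differences[of m, OF assms] by (simp_all add: q)
  define c where "c = bmass m 1 / (bmass m 1 + bmass m 2)"
  have "bmass m 1 + bmass m 2 \<noteq> 0"
    using pos by (simp add: bmass_def eval_nat_numeral)
  then have c: "bmass m 2 / (bmass m 1 + bmass m 2) = 1 - c"
    by (simp add: c_def field_simps)
  show "position m q i - position m q j = separation (cross_coef m i j) q"
    if "i \<in> {1,2}" "j \<in> {3,4}" for i j
    using that by (auto simp: q Let_def c algebra_simps simp del: One_nat_def simp flip: c_def)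
qed

lemma inj_on_position_iff:
  assumes "\<And>i. i \<in> {1..4} \<Longrightarrow> m i > 0"
  shows "inj_on (position m (Q1, Q2, x)) {1..4::nat} \<longleftrightarrow>
    Q1 \<noteq> 0 \<and> Q2 \<noteq> 0 \<and> (\<forall>i\<in>{1,2}. \<forall>j\<in>{3,4}. separation (cross_coef m i j) (Q1, Q2, x) \<noteq> 0)"
proof -
  let ?q = "(Q1, Q2, x)" and ?p = "position m (Q1, Q2, x)"
  have ps: "?p 1 - ?p 2 = Q1" "?p 3 - ?p 4 = Q2"
    by (rule position_differences; use assms in simp)+
  have cr: "?p i - ?p j = separation (cross_coef m i j) ?q" if "i \<in> {1,2}" "j \<in> {3,4}" for i j
    by (rule position_separation(3)) (use assms that in auto)
  have "inj_on ?p {1..4} \<longleftrightarrow> ?p 1 - ?p 2 \<noteq> 0 \<and> ?p 3 - ?p 4 \<noteq> 0 \<and>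
      (\<forall>i\<in>{1,2}. \<forall>j\<in>{3,4}. ?p i - ?p j \<noteq> 0)"
    unfolding set_1_4 by (simp del: position.simps One_nat_def) (auto simp del: position.simps)
  also have "\<dots> \<longleftrightarrow> Q1 \<noteq> 0 \<and> Q2 \<noteq> 0 \<and> (\<forall>i\<in>{1,2}. \<forall>j\<in>{3,4}. separation (cross_coef m i j) ?q \<noteq> 0)"
    unfolding ps by (simp add: cr del: position.simps cross_coef.simps One_nat_def)
  finally show ?thesis .
qed

lemma hamiltonian_eq:
  assumes "\<And>i. i \<in> {1..4} \<Longrightarrow> m i > 0"
  shows "hamiltonian m (q, p) = kinetic m p - (kc m 1 / norm (separation (1, 0, 0) q) + kc m 2 / norm (separation (0, 1, 0) q)
    + (\<Sum>i\<in>{1,2}. \<Sum>j\<in>{3,4}. m i * m j / norm (separation (cross_coef m i j) q)))"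
proof -
  have ps: "position m q 1 - position m q 2 = separation (1, 0, 0) q"
    "position m q 3 - position m q 4 = separation (0, 1, 0) q"
    "position m q 1 - position m q 3 = separation (cross_coef m 1 3) q"
    "position m q 1 - position m q 4 = separation (cross_coef m 1 4) q"
    "position m q 2 - position m q 3 = separation (cross_coef m 2 3) q"
    "position m q 2 - position m q 4 = separation (cross_coef m 2 4) q"
    by (rule position_separation; use assms in simp)+
  have sets: "{1<..4::nat} = {2,3,4}" "{2<..4::nat} = {3,4}" "{3<..4::nat} = {4}" "{4<..4::nat} = {}"
    by auto
  have kc: "kc m 1 = m 1 * m 2" "kc m 2 = m 3 * m 4"
    by (simp_all add: kc_def)
  show ?thesis
    unfolding hamiltonian_def prod.case kinetic_def set_1_4
    by (simp add: sets ps kc del: position.simps cross_coef.simps One_nat_def separation.simps momentum.simps)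
qed

lemma GDERIV_hamiltonian:
  assumes m: "\<And>i. i \<in> {1..4} \<Longrightarrow> m i > 0" and inj: "inj_on (position m q) {1..4}"
  shows "GDERIV (hamiltonian m) (q, p) :>
    (- (attraction (kc m 1) (1, 0, 0) q + attraction (kc m 2) (0, 1, 0) q + tidal m q), velocity m p)"
proof -
  have ne: "separation (1, 0, 0) q \<noteq> 0" "separation (0, 1, 0) q \<noteq> 0"
    "\<And>i j. i \<in> {1,2} \<Longrightarrow> j \<in> {3,4} \<Longrightarrow> separation (cross_coef m i j) q \<noteq> 0"
    using inj inj_on_position_iff[of m, OF m] by (cases q; force)+
  let ?U = "\<lambda>q. kc m 1 / norm (separation (1, 0, 0) q) + kc m 2 / norm (separation (0, 1, 0) q)
    + (\<Sum>i\<in>{1,2}. \<Sum>j\<in>{3,4}. m i * m j / norm (separation (cross_coef m i j) q))"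
  let ?A = "attraction (kc m 1) (1, 0, 0) q + attraction (kc m 2) (0, 1, 0) q + tidal m q"
  have cross: "((\<lambda>q. \<Sum>i\<in>{1,2}. \<Sum>j\<in>{3,4}. m i * m j / norm (separation (cross_coef m i j) q)) has_derivative
     (\<lambda>v. \<Sum>i\<in>{1,2}. \<Sum>j\<in>{3,4}. v \<bullet> attraction (m i * m j) (cross_coef m i j) q)) (at q)"
    using GDERIV_coulomb[unfolded gderiv_def, OF ne(3)] by (intro has_derivative_sum) auto
  have U: "(?U has_derivative (\<lambda>v. v \<bullet> ?A)) (at q)"
    using has_derivative_add[OF has_derivative_add[OF GDERIV_coulomb[OF ne(1), of "kc m 1", unfolded gderiv_def]
        GDERIV_coulomb[OF ne(2), of "kc m 2", unfolded gderiv_def]] cross]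
    by (simp add: tidal_def inner_add_right inner_sum_right del: cross_coef.simps separation.simps)
  have K: "(kinetic m has_derivative (\<lambda>v. v \<bullet> velocity m p)) (at p)"
    using GDERIV_kinetic[of m, OF m] by (simp add: gderiv_def)
  have "((\<lambda>w. kinetic m (snd w) - ?U (fst w)) has_derivative
      (\<lambda>w. snd w \<bullet> velocity m p - fst w \<bullet> ?A)) (at (q, p))"
    by (intro has_derivative_diff has_derivative_compose[OF has_derivative_snd]
        has_derivative_compose[OF has_derivative_fst] has_derivative_ident) (use U K in simp_all)
  moreover have "hamiltonian m = (\<lambda>w. kinetic m (snd w) - ?U (fst w))"
    using hamiltonian_eq[of m, OF m] by (metis (no_types) prod.collapse)
  moreover have "(\<lambda>w. snd w \<bullet> velocity m p - fst w \<bullet> ?A) = (\<lambda>w. w \<bullet> (- ?A, velocity m p))"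
    by (simp add: fun_eq_iff inner_prod_def algebra_simps del: One_nat_def)
  ultimately show ?thesis
    unfolding gderiv_def by metis
qed

lemma hamiltonian_vf_eq:
  assumes "\<And>i. i \<in> {1..4} \<Longrightarrow> m i > 0" and "inj_on (position m q) {1..4}"
  shows "hamiltonian_vf (hamiltonian m) (q, p) =
    (velocity m p, attraction (kc m 1) (1, 0, 0) q + attraction (kc m 2) (0, 1, 0) q + tidal m q)"
proof -
  have "grad (hamiltonian m) (q, p) =
      (- (attraction (kc m 1) (1, 0, 0) q + attraction (kc m 2) (0, 1, 0) q + tidal m q), velocity m p)"
    by (intro grad_eqI GDERIV_hamiltonian assms)
  then show ?thesis
    by (simp add: hamiltonian_vf_def del: One_nat_def)
qed


section \<open>The lift to the regularising variables\<close>

text \<open>The time derivatives of \<open>u\<close> and \<open>z\<close> along the Hamiltonian flow, for one binary with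
  \<open>a = 16 k\<^sup>2 M\<close>, \<open>c = 4 k M\<close>, subject to an external force \<open>F\<close>. The first summand of \<open>u_rate\<close> is
  what remains of the Kepler force; it carries the factor \<open>\<bar>u\<bar>\<^sup>2 - 1\<close>, which vanishes at collisions.\<close>

definition u_rate :: "real \<Rightarrow> real \<Rightarrow> complex \<Rightarrow> complex \<Rightarrow> complex \<Rightarrow> complex" where
  "u_rate a c z u F = of_real (a * ((norm u)\<^sup>2 - 1)) / (of_real ((norm z)\<^sup>2) * cnj z) + cnj z * F / of_real c"

definition z_rate :: "real \<Rightarrow> complex \<Rightarrow> complex \<Rightarrow> complex" where
  "z_rate a z u = of_real a * u / of_real ((norm z)\<^sup>2)"

lemma of_real_norm_sq: "(complex_of_real (norm z))\<^sup>2 = z * cnj z"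
  by (metis complex_norm_square of_real_power)

lemma has_derivative_regularised_position:
  fixes f :: "'a::real_normed_vector \<Rightarrow> complex"
  assumes f: "(f has_derivative f') (at w)" and c: "c \<noteq> 0"
  shows "((\<lambda>w. (f w)\<^sup>2 / of_real (2 * c)) has_derivative (\<lambda>v. f w * f' v / of_real c)) (at w)"
  using has_derivative_mult_left[OF has_derivative_mult[OF f f], of "1 / of_real (2 * c)"] c
  by (simp add: power2_eq_square mult_ac)

lemma has_derivative_regularised_momentum:
  fixes f g :: "'a::real_normed_vector \<Rightarrow> complex"
  assumes f: "(f has_derivative f') (at w)" and g: "(g has_derivative g') (at w)" and "f w \<noteq> 0"
  shows "((\<lambda>w. of_real c * (g w / cnj (f w))) has_derivative
    (\<lambda>v. of_real c * (g' v / cnj (f w) - g w * cnj (f' v) / (cnj (f w))\<^sup>2))) (at w)"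
proof -
  have "cnj (f w) \<noteq> 0" using assms by simp
  from has_derivative_mult_right[OF has_derivative_divide'[OF g has_derivative_cnj[OF f] this], of "of_real c"]
  show ?thesis
    using assms by (simp add: power2_eq_square diff_divide_distrib)
qed

text \<open>The equation \<open>Q' = P / M\<close> in the variables \<open>z, u\<close>. It works because \<open>c\<^sup>2 / M = a\<close>.\<close>

lemma kepler_z:
  assumes "z \<noteq> 0" "c \<noteq> 0" "M > 0" "c\<^sup>2 = a * M"
  shows "z * z_rate a z u / of_real c = (1 / M) *\<^sub>R (of_real c * (u / cnj z))"
proof -
  have "(of_real (c\<^sup>2)::complex) = of_real (a * M)" using assms by simp
  then have c: "of_real c * of_real c = (of_real a * of_real M :: complex)"
    by (simp add: power2_eq_square)
  have "z * z_rate a z u / of_real c = of_real a * u / (of_real c * cnj z)"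
    using assms by (simp add: z_rate_def of_real_norm_sq divide_simps) 
  also have "\<dots> = (1 / M) *\<^sub>R (of_real c * (u / cnj z))"
    using assms c by (simp add: scaleR_conv_of_real divide_simps)
  finally show ?thesis .
qed

text \<open>The equation \<open>P' = - k Q / \<bar>Q\<bar>\<^sup>3 + F\<close> in the variables \<open>z, u\<close>. In the factor
  \<open>\<bar>u\<bar>\<^sup>2 - 1\<close> of \<open>u_rate\<close>, the term \<open>\<bar>u\<bar>\<^sup>2\<close> compensates the derivative of the denominator of
  \<open>P = c u / cnj z\<close>, and the term \<open>1\<close> is the Kepler force, because \<open>a = 4 k c\<close>.\<close>

lemma kepler_u:
  assumes "z \<noteq> 0" "c > 0" "a = 4 * k * c"
  shows "of_real c * (u_rate a c z u F / cnj z - u * cnj (z_rate a z u) / (cnj z)\<^sup>2) =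
    (- k / norm (z\<^sup>2 / of_real (2 * c)) ^ 3) *\<^sub>R (z\<^sup>2 / of_real (2 * c)) + F"
proof -
  have nz: "cnj z \<noteq> 0" "norm z \<noteq> 0" "(of_real c::complex) \<noteq> 0" using assms by auto
  define N where "N = (of_real ((norm z)\<^sup>2) :: complex)"
  define C where "C = (of_real c :: complex)"
  have N: "N = z * cnj z" by (simp add: N_def of_real_norm_sq)
  have u: "of_real (a * ((norm u)\<^sup>2 - 1)) = of_real a * (u * cnj u - 1)" by (simp add: of_real_norm_sq)
  have "C * (u_rate a c z u F / cnj z - u * cnj (z_rate a z u) / (cnj z)\<^sup>2)
     = C * (of_real a * (u * cnj u - 1) / (N * (cnj z)\<^sup>2) + F / C - u * cnj u * of_real a / (N * (cnj z)\<^sup>2))"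
    using nz unfolding u_rate_def z_rate_def u N_def[symmetric] C_def[symmetric]
    by (simp add: add_divide_distrib power2_eq_square mult_ac N_def)
  also have "\<dots> = F - C * of_real a / (N * (cnj z)\<^sup>2)"
    using nz by (simp add: C_def N field_simps)
  also have "C * of_real a / (N * (cnj z)\<^sup>2) = of_real (4 * k * c ^ 2) * z\<^sup>2 / N ^ 3"
    using nz by (simp add: C_def assms N field_simps power2_eq_square power3_eq_cube)
  also have "N ^ 3 = of_real (norm z ^ 6)"
    by (simp add: N_def flip: of_real_power power_mult)
  also have "of_real (4 * k * c ^ 2) * z\<^sup>2 / of_real (norm z ^ 6)
     = (k / norm (z\<^sup>2 / of_real (2 * c)) ^ 3) *\<^sub>R (z\<^sup>2 / of_real (2 * c))"
    using assms nz
    by (simp add: norm_divide norm_power scaleR_conv_of_real power_divide field_simps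
        flip: power_mult power_Suc)
  finally show ?thesis by (simp add: C_def)
qed

text \<open>All fractional powers of \<open>a\<close> are rational in its cube root, which reduces the identities below to
  field arithmetic.\<close>

lemma powr_thirds:
  assumes "(a::real) > 0"
  shows "a powr - (1 / 3) = 1 / a powr (1 / 3)" "a powr (2 / 3) = (a powr (1 / 3))\<^sup>2" "(a powr (1 / 3)) ^ 3 = a"
proof -
  show "a powr - (1 / 3) = 1 / a powr (1 / 3)"
    by (rule powr_minus_divide)
  have "(a powr (1 / 3)) ^ n = a powr (n / 3)" for n :: nat
    using assms by (simp add: powr_powr flip: powr_realpow)
  from this[of 2] this[of 3] show "a powr (2 / 3) = (a powr (1 / 3))\<^sup>2" "(a powr (1 / 3)) ^ 3 = a"
    using assms by simp_all
qed

lemma mass_constants: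
  assumes "\<And>i. i \<in> {1..4} \<Longrightarrow> m i > 0" "j \<in> {1, 2}"
  shows "redmass m j > 0" "kc m j > 0" "ac m j = 4 * kc m j * (4 * kc m j * redmass m j)"
    "(4 * kc m j * redmass m j)\<^sup>2 = ac m j * redmass m j" "ac m j > 0"
proof -
  have "m (2 * j - 1) > 0" "m (2 * j) > 0"
    using assms(2) by (auto intro!: assms(1))
  then show *: "redmass m j > 0" "kc m j > 0"
    by (simp_all add: redmass_def kc_def bmass_def)
  then show "ac m j > 0"
    by (simp add: ac_def)
  show "ac m j = 4 * kc m j * (4 * kc m j * redmass m j)"
    "(4 * kc m j * redmass m j)\<^sup>2 = ac m j * redmass m j"
    by (simp_all add: ac_def power2_eq_square)
qed

abbreviation scale_const :: "(nat \<Rightarrow> real) \<Rightarrow> nat \<Rightarrow> real" where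
  "scale_const m j \<equiv> 4 * kc m j * redmass m j"

definition lifted_vf :: "(nat \<Rightarrow> real) \<Rightarrow> phase \<Rightarrow> phase" where
  "lifted_vf m = (\<lambda>((z1, z2, x), (u1, u2, y)).
     case tidal m (fst (to_phase m ((z1, z2, x), (u1, u2, y)))) of (F1, F2, Fx) \<Rightarrow>
       ((z_rate (ac m 1) z1 u1, z_rate (ac m 2) z2 u2, (1 / bmass m 1 + 1 / bmass m 2) *\<^sub>R y),
        (u_rate (ac m 1) (scale_const m 1) z1 u1 F1, u_rate (ac m 2) (scale_const m 2) z2 u2 F2, Fx)))"

text \<open>Squaring \<open>z\<close> is two-to-one but a local diffeomorphism off \<open>z = 0\<close>, so the Hamiltonian vector
  field lifts to \<open>(z, u)\<close>; the two binaries are handled by \<open>kepler_z\<close> and \<open>kepler_u\<close>.\<close>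

lemma pullback_to_phase:
  assumes m: "\<And>i. i \<in> {1..4} \<Longrightarrow> m i > 0" and w: "w \<in> regular_points m"
  shows "pullback_vf (to_phase m) (hamiltonian_vf (hamiltonian m)) w = lifted_vf m w"
proof -
  obtain z1 z2 x u1 u2 y where w_eq: "w = ((z1, z2, x), (u1, u2, y))"
    by (metis prod.exhaust)
  define c1 c2 where c12: "c1 = scale_const m 1" "c2 = scale_const m 2"
  have mc1: "redmass m 1 > 0" "kc m 1 > 0" "ac m 1 = 4 * kc m 1 * c1" "c1\<^sup>2 = ac m 1 * redmass m 1" "c1 > 0"
    unfolding c12 using mass_constants[of m 1, OF m] by (simp_all del: One_nat_def)
  have mc2: "redmass m 2 > 0" "kc m 2 > 0" "ac m 2 = 4 * kc m 2 * c2" "c2\<^sup>2 = ac m 2 * redmass m 2" "c2 > 0"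
    unfolding c12 using mass_constants[of m 2, OF m] by simp_all
  have ne: "z1 \<noteq> 0" "z2 \<noteq> 0" and inj: "inj_on (position m (fst (to_phase m w))) {1..4}"
    using w by (auto simp: regular_points_def w_eq)
  define Q1 Q2 where Q: "Q1 = z1\<^sup>2 / of_real (2 * c1)" "Q2 = z2\<^sup>2 / of_real (2 * c2)"
  define P1 P2 where P: "P1 = of_real c1 * (u1 / cnj z1)" "P2 = of_real c2 * (u2 / cnj z2)"
  have ph: "to_phase m w = ((Q1, Q2, x), (P1, P2, y))"
    by (simp add: to_phase_def w_eq Q P c12)
  obtain F1 F2 Fx where F: "tidal m (Q1, Q2, x) = (F1, F2, Fx)"
    by (metis prod.exhaust)
  have H: "hamiltonian_vf (hamiltonian m) (to_phase m w) =
      (((1 / redmass m 1) *\<^sub>R P1, (1 / redmass m 2) *\<^sub>R P2, (1 / bmass m 1 + 1 / bmass m 2) *\<^sub>R y),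
       ((- kc m 1 / norm Q1 ^ 3) *\<^sub>R Q1 + F1, (- kc m 2 / norm Q2 ^ 3) *\<^sub>R Q2 + F2, Fx))"
  proof -
    have i: "inj_on (position m (Q1, Q2, x)) {1..4}"
      using inj by (simp add: ph)
    show ?thesis
      unfolding ph
      by (subst hamiltonian_vf_eq) (use m i in \<open>auto simp: velocity_def attraction_def F simp del: One_nat_def\<close>)
  qed
  let ?D = "\<lambda>v. case v of ((v1, v2, vx), (p1, p2, vy)) \<Rightarrow>
     ((z1 * v1 / of_real c1, z2 * v2 / of_real c2, vx),
      (of_real c1 * (p1 / cnj z1 - u1 * cnj v1 / (cnj z1)\<^sup>2),
       of_real c2 * (p2 / cnj z2 - u2 * cnj v2 / (cnj z2)\<^sup>2), vy))"
  have fst: "(fst has_derivative fst) F" "(snd has_derivative snd) F" for F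
    by (auto intro!: derivative_intros)
  show ?thesis
  proof (rule pullback_vf_eqI[where f' = ?D])
    let ?f = "\<lambda>w. (((fst (fst w))\<^sup>2 / of_real (2 * c1), (fst (snd (fst w)))\<^sup>2 / of_real (2 * c2), snd (snd (fst w))),
        (of_real c1 * (fst (snd w) / cnj (fst (fst w))), of_real c2 * (fst (snd (snd w)) / cnj (fst (snd (fst w)))), snd (snd (snd w))))"
    have "to_phase m = ?f"
      by (auto simp: to_phase_def c12)
    moreover have "(?f has_derivative (\<lambda>v. ((fst (fst w) * fst (fst v) / of_real c1,
          fst (snd (fst w)) * fst (snd (fst v)) / of_real c2, snd (snd (fst v))),
       (of_real c1 * (fst (snd v) / cnj (fst (fst w)) - fst (snd w) * cnj (fst (fst v)) / (cnj (fst (fst w)))\<^sup>2),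
       of_real c2 * (fst (snd (snd v)) / cnj (fst (snd (fst w))) - fst (snd (snd w)) * cnj (fst (snd (fst v))) / (cnj (fst (snd (fst w))))\<^sup>2),
       snd (snd (snd v)))))) (at w)"
      by (intro has_derivative_Pair has_derivative_regularised_position has_derivative_regularised_momentum
          has_derivative_fst has_derivative_snd has_derivative_ident)
        (use ne mc1 mc2 in \<open>auto simp: w_eq\<close>)
    ultimately show "(to_phase m has_derivative ?D) (at w)"
      by (simp add: w_eq case_prod_unfold)
  next
    show "?D (lifted_vf m w) = hamiltonian_vf (hamiltonian m) (to_phase m w)"
      unfolding H using F ph[unfolded w_eq]
      unfolding w_eq lifted_vf_def
      using kepler_z[of z1 c1 "redmass m 1" "ac m 1" u1] kepler_z[of z2 c2 "redmass m 2" "ac m 2" u2]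
         kepler_u[of z1 c1 "ac m 1" "kc m 1" u1 F1] kepler_u[of z2 c2 "ac m 2" "kc m 2" u2 F2] mc1 mc2 ne
      by (simp add: P Q c12[symmetric] del: One_nat_def)
  next
    fix v assume "?D v = 0"
    then show "v = 0"
      using ne mc1 mc2 by (cases v) (auto simp: zero_prod_def split: prod.splits)
  qed
qed


section \<open>The rescaled vector field in the new coordinates\<close>

definition zeta_of :: "real \<Rightarrow> complex \<Rightarrow> complex \<Rightarrow> complex" where
  "zeta_of a z u = of_real (a powr (- 1 / 3)) * (cnj u * z)"

definition h_of :: "real \<Rightarrow> complex \<Rightarrow> complex \<Rightarrow> real" where
  "h_of a z u = a powr (2 / 3) * ((norm u)\<^sup>2 - 1) / (norm z)\<^sup>2"

lemma has_derivative_norm_sq: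
  fixes f :: "'a::real_normed_vector \<Rightarrow> complex"
  assumes "(f has_derivative f') (at w)"
  shows "((\<lambda>w. (norm (f w))\<^sup>2) has_derivative (\<lambda>v. 2 * (f w \<bullet> f' v))) (at w)"
  using has_derivative_inner[OF assms assms]
  by (simp add: power2_norm_eq_inner inner_commute)

lemma has_derivative_zeta_of:
  fixes f g :: "'a::real_normed_vector \<Rightarrow> complex"
  assumes f: "(f has_derivative f') (at w)" and g: "(g has_derivative g') (at w)"
  shows "((\<lambda>w. zeta_of a (f w) (g w)) has_derivative
    (\<lambda>v. of_real (a powr (- 1 / 3)) * (cnj (g' v) * f w + cnj (g w) * f' v))) (at w)"
  unfolding zeta_of_def
  using has_derivative_mult_right[OF has_derivative_mult[OF has_derivative_cnj[OF g] f], of "of_real (a powr (- 1 / 3))"]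
  by (simp add: add.commute)

lemma has_derivative_h_of:
  fixes f g :: "'a::real_normed_vector \<Rightarrow> complex"
  assumes f: "(f has_derivative f') (at w)" and g: "(g has_derivative g') (at w)" and nz: "f w \<noteq> 0"
  shows "((\<lambda>w. h_of a (f w) (g w)) has_derivative
    (\<lambda>v. a powr (2 / 3) * (2 * (g w \<bullet> g' v) / (norm (f w))\<^sup>2
       - 2 * ((norm (g w))\<^sup>2 - 1) * (f w \<bullet> f' v) / (norm (f w)) ^ 4))) (at w)"
proof -
  have n: "(norm (f w))\<^sup>2 \<noteq> 0" using nz by simp
  have "((\<lambda>w. a powr (2 / 3) * (((norm (g w))\<^sup>2 - 1) / (norm (f w))\<^sup>2)) has_derivative
    (\<lambda>v. a powr (2 / 3) * (((2 * (g w \<bullet> g' v) - 0) * (norm (f w))\<^sup>2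
       - ((norm (g w))\<^sup>2 - 1) * (2 * (f w \<bullet> f' v))) / ((norm (f w))\<^sup>2 * (norm (f w))\<^sup>2)))) (at w)"
    by (intro has_derivative_mult_right has_derivative_divide' has_derivative_diff has_derivative_const
        has_derivative_norm_sq f g n)
  moreover have "((2 * (g w \<bullet> g' v) - 0) * (norm (f w))\<^sup>2
       - ((norm (g w))\<^sup>2 - 1) * (2 * (f w \<bullet> f' v))) / ((norm (f w))\<^sup>2 * (norm (f w))\<^sup>2)
     = 2 * (g w \<bullet> g' v) / (norm (f w))\<^sup>2 - 2 * ((norm (g w))\<^sup>2 - 1) * (f w \<bullet> f' v) / (norm (f w)) ^ 4" for v
    using nz by (simp add: field_simps eval_nat_numeral)
  ultimately have "((\<lambda>w. a powr (2 / 3) * (((norm (g w))\<^sup>2 - 1) / (norm (f w))\<^sup>2)) has_derivative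
    (\<lambda>v. a powr (2 / 3) * (2 * (g w \<bullet> g' v) / (norm (f w))\<^sup>2
       - 2 * ((norm (g w))\<^sup>2 - 1) * (f w \<bullet> f' v) / (norm (f w)) ^ 4))) (at w)"
    by (simp only:)
  then show ?thesis
    by (simp add: h_of_def)
qed

text \<open>The derivative of the unit vector \<open>u / \<bar>u\<bar>\<close> when \<open>u\<close> moves with velocity \<open>v\<close>.\<close>

definition turn_rate :: "complex \<Rightarrow> complex \<Rightarrow> complex" where
  "turn_rate u v = v / of_real (norm u) - ((u \<bullet> v) / norm u ^ 3) *\<^sub>R u"

lemma has_derivative_direction:
  fixes g :: "'a::real_normed_vector \<Rightarrow> complex"
  assumes g: "(g has_derivative g') (at w)" and nz: "g w \<noteq> 0"
  shows "((\<lambda>w. g w / of_real (norm (g w))) has_derivative (\<lambda>v. turn_rate (g w) (g' v))) (at w)"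
proof -
  have d: "((\<lambda>w. norm (g w)) has_derivative (\<lambda>v. g' v \<bullet> sgn (g w))) (at w)"
    using has_derivative_compose[OF g has_derivative_norm[OF nz]] .
  have "((\<lambda>w. inverse (norm (g w)) *\<^sub>R g w) has_derivative
     (\<lambda>v. inverse (norm (g w)) *\<^sub>R g' v
        + (- (inverse (norm (g w)) * (g' v \<bullet> sgn (g w)) * inverse (norm (g w)))) *\<^sub>R g w)) (at w)"
    using has_derivative_scaleR[OF Deriv.has_derivative_inverse[OF _ d] g] nz by simp
  moreover have "inverse (norm (g w)) *\<^sub>R g' v
        + (- (inverse (norm (g w)) * (g' v \<bullet> sgn (g w)) * inverse (norm (g w)))) *\<^sub>R g w
     = turn_rate (g w) (g' v)" for v
    by (simp add: turn_rate_def sgn_div_norm power3_eq_cube inner_commute divide_inverse)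
      (simp add: scaleR_conv_of_real mult_ac)
  ultimately show ?thesis
    by (simp add: scaleR_conv_of_real divide_inverse mult.commute)
qed

text \<open>\<open>zeta_rate\<close>, \<open>h_rate\<close> and \<open>slow_u_rate\<close> are \<open>\<bar>\<zeta>\<bar>\<^sup>2\<close> times the derivatives of \<open>\<zeta>\<close>, \<open>h\<close> and
  \<open>u\<close> along the flow. The point is that no negative power of \<open>z\<close> is left. At a collision, where
  \<open>z = 0\<close> and \<open>\<bar>u\<bar> = 1\<close>, the first equals \<open>1\<close> and the other two vanish.\<close>

definition zeta_rate :: "real \<Rightarrow> real \<Rightarrow> complex \<Rightarrow> complex \<Rightarrow> complex \<Rightarrow> complex" where
  "zeta_rate a c z u F = of_real ((norm u)\<^sup>2 * (2 * (norm u)\<^sup>2 - 1))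
     + of_real ((norm u)\<^sup>2 * (norm z)\<^sup>2 / (a * c)) * z\<^sup>2 * cnj F"

definition h_rate :: "real \<Rightarrow> complex \<Rightarrow> complex \<Rightarrow> complex \<Rightarrow> real" where
  "h_rate c z u F = 2 * (norm u)\<^sup>2 / c * (u \<bullet> (cnj z * F))"

definition slow_u_rate :: "real \<Rightarrow> real \<Rightarrow> real \<Rightarrow> complex \<Rightarrow> complex \<Rightarrow> complex \<Rightarrow> complex" where
  "slow_u_rate a c h z u F = of_real (a powr (- 1 / 3) * (norm u)\<^sup>2 * h) * z
     + of_real ((norm u)\<^sup>2 * (norm z)\<^sup>2 / (c * a powr (2 / 3))) * (cnj z * F)"

lemma norm_zeta_of:
  assumes "a > 0"
  shows "(norm (zeta_of a z u))\<^sup>2 = (norm u)\<^sup>2 * (norm z)\<^sup>2 / a powr (2 / 3)"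
  using powr_thirds[OF assms] by (simp add: zeta_of_def norm_mult norm_divide power_mult_distrib power_divide)

text \<open>Both \<open>u'\<close> and \<open>z'\<close> contribute a multiple of \<open>a / \<bar>z\<bar>\<^sup>2\<close> to \<open>\<zeta>'\<close>; together they give
  \<open>a (2 \<bar>u\<bar>\<^sup>2 - 1) / \<bar>z\<bar>\<^sup>2\<close>, and \<open>\<bar>\<zeta>\<bar>\<^sup>2\<close> is \<open>\<bar>u\<bar>\<^sup>2 \<bar>z\<bar>\<^sup>2\<close> up to a constant.\<close>

lemma slow_zeta:
  assumes "a > 0" "c > 0" "z \<noteq> 0"
  shows "(norm (zeta_of a z u))\<^sup>2 *\<^sub>R
      (of_real (a powr (- 1 / 3)) * (cnj (u_rate a c z u F) * z + cnj u * z_rate a z u))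
    = zeta_rate a c z u F"
proof -
  define A where "A = a powr (1 / 3)"
  have A: "A > 0" "a powr - (1 / 3) = 1 / A" "a powr (2 / 3) = A\<^sup>2" "a = A ^ 3"
    using powr_thirds[OF assms(1)] assms by (auto simp: A_def)
  define N S where "N = (complex_of_real (norm z))\<^sup>2" and "S = (complex_of_real (norm u))\<^sup>2"
  have N: "N \<noteq> 0" "z * cnj z = N" "z * N = z * (z * cnj z)" and S: "S = u * cnj u"
    using assms by (auto simp: N_def S_def of_real_norm_sq)
  have "cnj (u_rate a c z u F) = of_real a * (S - 1) / (N * z) + z * cnj F / of_real c"
    by (simp add: u_rate_def N_def S_def)
  moreover have "cnj u * z_rate a z u = of_real a * (cnj u * u) / N"
    by (simp add: z_rate_def N_def)
  ultimately have "cnj (u_rate a c z u F) * z + cnj u * z_rate a z u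
      = (of_real a * (S - 1) + of_real a * (cnj u * u)) / N + z\<^sup>2 * cnj F / of_real c"
    using assms by (simp add: distrib_right add_divide_distrib power2_eq_square)
  also have "\<dots> = of_real a * (2 * S - 1) / N + z\<^sup>2 * cnj F / of_real c"
    by (simp add: S algebra_simps)
  finally have *: "cnj (u_rate a c z u F) * z + cnj u * z_rate a z u
    = of_real a * (2 * S - 1) / N + z\<^sup>2 * cnj F / of_real c" .
  have "(norm (zeta_of a z u))\<^sup>2 *\<^sub>R (of_real (a powr (- 1 / 3)) * (of_real a * (2 * S - 1) / N + z\<^sup>2 * cnj F / of_real c))
     = (S * N / of_real A ^ 2) * (1 / of_real A * (of_real A ^ 3 * (2 * S - 1) / N + z\<^sup>2 * cnj F / of_real c))"
    unfolding norm_zeta_of[OF assms(1)] by (simp add: scaleR_conv_of_real A(2,3) S_def N_def) (simp add: A(4))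
  also have "\<dots> = S * (2 * S - 1) + S * N / (of_real A ^ 3 * of_real c) * z\<^sup>2 * cnj F"
    using A(1) N(1) assms by (simp add: field_simps eval_nat_numeral)
  also have "\<dots> = zeta_rate a c z u F"
    by (simp add: zeta_rate_def S_def N_def A(4))
  finally show ?thesis by (simp add: *)
qed

text \<open>In the singular term of \<open>u_rate\<close> the quotient \<open>(\<bar>u\<bar>\<^sup>2 - 1) / \<bar>z\<bar>\<^sup>2\<close> is the coordinate \<open>h\<close> up to a
  constant, and the remaining singularity is absorbed by \<open>\<bar>\<zeta>\<bar>\<^sup>2\<close>.\<close>

lemma slow_u:
  assumes "a > 0" "c > 0" "z \<noteq> 0"
  shows "(norm (zeta_of a z u))\<^sup>2 *\<^sub>R u_rate a c z u F = slow_u_rate a c (h_of a z u) z u F"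
proof -
  define A where "A = a powr (1 / 3)"
  have A: "A > 0" "a powr - (1 / 3) = 1 / A" "a powr (2 / 3) = A\<^sup>2" "a = A ^ 3"
    using powr_thirds[OF assms(1)] assms by (auto simp: A_def)
  define N S where "N = (complex_of_real (norm z))\<^sup>2" and "S = (complex_of_real (norm u))\<^sup>2"
  have N: "N = z * cnj z" "cnj z \<noteq> 0"
    using assms by (auto simp: N_def S_def of_real_norm_sq)
  have "(norm (zeta_of a z u))\<^sup>2 *\<^sub>R u_rate a c z u F
     = (S * N / of_real A ^ 2) * (of_real A ^ 3 * (S - 1) / (N * cnj z) + cnj z * F / of_real c)"
    unfolding norm_zeta_of[OF assms(1)] u_rate_def
    by (simp add: scaleR_conv_of_real A(2,3) S_def N_def) (simp add: A(4))
  also have "\<dots> = 1 / of_real A * S * (of_real A ^ 2 * (S - 1) / N) * z + S * N / (of_real c * of_real A ^ 2) * (cnj z * F)"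
    using A(1) N assms by (simp add: field_simps eval_nat_numeral)
  also have "\<dots> = slow_u_rate a c (h_of a z u) z u F"
    by (simp add: slow_u_rate_def h_of_def S_def N_def A(2,3))
  finally show ?thesis .
qed

text \<open>The energy of an isolated binary is conserved: the two Kepler contributions cancel, and only the
  work of the external force \<open>F\<close> remains.\<close>

lemma slow_h:
  assumes "a > 0" "c > 0" "z \<noteq> 0"
  shows "(norm (zeta_of a z u))\<^sup>2 *
      (a powr (2 / 3) * (2 * (u \<bullet> u_rate a c z u F) / (norm z)\<^sup>2
       - 2 * ((norm u)\<^sup>2 - 1) * (z \<bullet> z_rate a z u) / (norm z) ^ 4)) = h_rate c z u F"
proof -
  define A where "A = a powr (1 / 3)"
  have A: "A > 0" "a powr (2 / 3) = A\<^sup>2"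
    using powr_thirds[OF assms(1)] assms by (auto simp: A_def)
  define n s where "n = (norm z)\<^sup>2" and "s = (norm u)\<^sup>2"
  have n: "n > 0" "norm z ^ 4 = n * n" using assms by (simp_all add: n_def flip: power_add)
  have zr: "z_rate a z u = (a / n) *\<^sub>R u"
    by (simp add: z_rate_def n_def scaleR_conv_of_real)
  have nc: "complex_of_real n = z * cnj z"
    using of_real_norm_sq by (simp add: n_def)
  have ur: "u_rate a c z u F = (a * (s - 1) / n\<^sup>2) *\<^sub>R z + (1 / c) *\<^sub>R (cnj z * F)"
    using assms by (simp add: u_rate_def n_def[symmetric] s_def[symmetric] scaleR_conv_of_real nc)
      (simp add: power2_eq_square field_simps)
  have "(norm (zeta_of a z u))\<^sup>2 *
      (a powr (2 / 3) * (2 * (u \<bullet> u_rate a c z u F) / (norm z)\<^sup>2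
       - 2 * ((norm u)\<^sup>2 - 1) * (z \<bullet> z_rate a z u) / (norm z) ^ 4))
    = (s * n / A\<^sup>2) * (A\<^sup>2 * (2 * (a * (s - 1) / n\<^sup>2 * (u \<bullet> z) + u \<bullet> (cnj z * F) / c) / n
       - 2 * (s - 1) * (a / n * (u \<bullet> z)) / (n * n)))"
    unfolding norm_zeta_of[OF assms(1)] A(2) ur zr n(2) n_def[symmetric] s_def[symmetric]
    by (simp add: inner_add_right inner_commute)
  also have "\<dots> = 2 * s / c * (u \<bullet> (cnj z * F))"
    using A(1) n(1) assms by (simp add: field_simps power2_eq_square)
  finally show ?thesis
    by (simp add: h_rate_def s_def)
qed

lemma turn_rate_scaleR: "r *\<^sub>R turn_rate u v = turn_rate u (r *\<^sub>R v)"
  by (simp add: turn_rate_def scaleR_diff_right) (simp add: scaleR_conv_of_real)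

text \<open>The root \<open>s > 1 / 2\<close> of \<open>s (s - 1) = h \<bar>\<zeta>\<bar>\<^sup>2\<close>, which is \<open>\<bar>u\<bar>\<^sup>2\<close> in terms of the new
  coordinates.\<close>

definition speed_sq :: "real \<Rightarrow> complex \<Rightarrow> real" where
  "speed_sq h \<zeta> = (1 + sqrt (1 + 4 * h * (norm \<zeta>)\<^sup>2)) / 2"

definition u_of :: "real \<Rightarrow> complex \<Rightarrow> complex \<Rightarrow> complex" where
  "u_of h \<Gamma> \<zeta> = of_real (sqrt (speed_sq h \<zeta>)) * \<Gamma>"

definition z_of :: "real \<Rightarrow> real \<Rightarrow> complex \<Rightarrow> complex \<Rightarrow> complex" where
  "z_of a h \<Gamma> \<zeta> = of_real (a powr (1 / 3)) * \<zeta> / cnj (u_of h \<Gamma> \<zeta>)"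

lemma binary_coords_inverse_left:
  assumes "a > 0" "z \<noteq> 0" "(norm u)\<^sup>2 > 1 / 2"
  shows "u_of (h_of a z u) (u / of_real (norm u)) (zeta_of a z u) = u"
    "z_of a (h_of a z u) (u / of_real (norm u)) (zeta_of a z u) = z"
proof -
  have u: "u \<noteq> 0" using assms by auto
  have "h_of a z u * (norm (zeta_of a z u))\<^sup>2 = (norm u)\<^sup>2 * ((norm u)\<^sup>2 - 1)"
    unfolding norm_zeta_of[OF assms(1)] h_of_def using assms by simp
  \<comment> \<open>With \<open>s = \<bar>u\<bar>\<^sup>2\<close>, the discriminant of \<open>s (s - 1) = h \<bar>\<zeta>\<bar>\<^sup>2\<close> is \<open>(2 s - 1)\<^sup>2\<close>, and \<open>2 s - 1 > 0\<close>.\<close>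
  then have "1 + 4 * h_of a z u * (norm (zeta_of a z u))\<^sup>2 = (2 * (norm u)\<^sup>2 - 1)\<^sup>2"
    by (simp add: power2_eq_square algebra_simps)
  then have "speed_sq (h_of a z u) (zeta_of a z u) = (norm u)\<^sup>2"
    using assms(3) by (simp add: speed_sq_def)
  then show *: "u_of (h_of a z u) (u / of_real (norm u)) (zeta_of a z u) = u"
    using u by (simp add: u_of_def)
  have "z_of a (h_of a z u) (u / of_real (norm u)) (zeta_of a z u)
    = of_real (a powr (1 / 3)) * zeta_of a z u / cnj u"
    by (simp add: z_of_def *)
  then show "z_of a (h_of a z u) (u / of_real (norm u)) (zeta_of a z u) = z"
    using u assms(1) powr_thirds[OF assms(1)] by (simp add: zeta_of_def)
qed

lemma binary_coords_inverse_right: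
  assumes "a > 0" "\<zeta> \<noteq> 0" "norm \<Gamma> = 1" "1 + 4 * h * (norm \<zeta>)\<^sup>2 > 0"
  defines "u \<equiv> u_of h \<Gamma> \<zeta>" and "z \<equiv> z_of a h \<Gamma> \<zeta>"
  shows "z \<noteq> 0" "(norm u)\<^sup>2 > 1 / 2" "zeta_of a z u = \<zeta>" "h_of a z u = h" "u / of_real (norm u) = \<Gamma>"
proof -
  define s where "s = speed_sq h \<zeta>"
  have s: "s > 1 / 2" "s * (s - 1) = h * (norm \<zeta>)\<^sup>2"
    using assms(4) by (simp_all add: s_def speed_sq_def field_simps)
  have nu: "norm u = sqrt s"
    using s(1) by (simp add: u_def u_of_def norm_mult assms(3) flip: s_def)
  then show u2: "(norm u)\<^sup>2 > 1 / 2"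
    using s(1) by simp
  have u: "u \<noteq> 0" using nu s(1) by auto
  show z: "z \<noteq> 0"
    using assms u by (simp add: z_def z_of_def)
  show "u / of_real (norm u) = \<Gamma>"
    using s(1) unfolding nu by (simp add: u_def u_of_def flip: s_def)
  show \<zeta>: "zeta_of a z u = \<zeta>"
    using u assms(1) powr_thirds[OF assms(1)] by (simp add: zeta_of_def z_def z_of_def u_def)
  have "s * (s - 1) = s * (h * (norm z)\<^sup>2 / a powr (2 / 3))"
    using s(2) norm_zeta_of[OF assms(1), of z u] s(1) by (simp add: \<zeta> nu)
  then have "s - 1 = h * (norm z)\<^sup>2 / a powr (2 / 3)"
    using s(1) by (simp only: mult_cancel_left) auto
  then show "h_of a z u = h"
    using s(1) assms(1) z by (simp add: h_of_def nu)
qed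

definition from_coords :: "(nat \<Rightarrow> real) \<Rightarrow> coords \<Rightarrow> phase" where
  "from_coords m = (\<lambda>(\<zeta>1, \<zeta>2, h1, h2, \<Gamma>1, \<Gamma>2, x, y).
     ((z_of (ac m 1) h1 \<Gamma>1 \<zeta>1, z_of (ac m 2) h2 \<Gamma>2 \<zeta>2, x), (u_of h1 \<Gamma>1 \<zeta>1, u_of h2 \<Gamma>2 \<zeta>2, y)))"

lemma to_coords_eq:
  "to_coords m ((z1, z2, x), (u1, u2, y)) = (zeta_of (ac m 1) z1 u1, zeta_of (ac m 2) z2 u2,
     h_of (ac m 1) z1 u1, h_of (ac m 2) z2 u2, u1 / of_real (norm u1), u2 / of_real (norm u2), x, y)"
  by (simp add: to_coords_def zeta_of_def h_of_def)

lemma from_to_coords: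
  assumes "\<And>i. i \<in> {1..4} \<Longrightarrow> m i > 0" "w \<in> regular_points m"
  shows "from_coords m (to_coords m w) = w"
proof -
  have "ac m 1 > 0" "ac m 2 > 0"
    by (rule mass_constants(5); use assms(1) in simp)+
  then show ?thesis
    using assms(2) by (auto simp: regular_points_def to_coords_eq from_coords_def binary_coords_inverse_left
        simp del: One_nat_def)
qed

lemma inj_on_to_coords:
  assumes "\<And>i. i \<in> {1..4} \<Longrightarrow> m i > 0"
  shows "inj_on (to_coords m) (regular_points m)"
  by (rule inj_on_inverseI[where g = "from_coords m"]) (use from_to_coords assms in blast)

text \<open>The vector field \<open>X\<close> written without reference to inverse functions and derivatives. Each \<open>\<zeta>\<close>,
  \<open>h\<close>, \<open>\<Gamma>\<close> component has spent the factor \<open>\<bar>\<zeta>\<bar>\<^sup>2\<close> of its own binary and keeps that of the other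
  one.\<close>

definition slow_field :: "(nat \<Rightarrow> real) \<Rightarrow> coords \<Rightarrow> coords" where
  "slow_field m p = (case p of (\<zeta>1, \<zeta>2, h1, h2, \<Gamma>1, \<Gamma>2, x, y) \<Rightarrow>
     case from_coords m p of ((z1, z2, _), (u1, u2, _)) \<Rightarrow>
     case tidal m (fst (to_phase m (from_coords m p))) of (F1, F2, Fx) \<Rightarrow>
     let n1 = (norm \<zeta>1)\<^sup>2; n2 = (norm \<zeta>2)\<^sup>2 in
       (n2 *\<^sub>R zeta_rate (ac m 1) (scale_const m 1) z1 u1 F1,
        n1 *\<^sub>R zeta_rate (ac m 2) (scale_const m 2) z2 u2 F2,
        n2 * h_rate (scale_const m 1) z1 u1 F1,
        n1 * h_rate (scale_const m 2) z2 u2 F2,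
        n2 *\<^sub>R turn_rate u1 (slow_u_rate (ac m 1) (scale_const m 1) h1 z1 u1 F1),
        n1 *\<^sub>R turn_rate u2 (slow_u_rate (ac m 2) (scale_const m 2) h2 z2 u2 F2),
        (n1 * n2 * (1 / bmass m 1 + 1 / bmass m 2)) *\<^sub>R y,
        (n1 * n2) *\<^sub>R Fx))"

lemma distribute_time_rescaling:
  fixes v1 v2 g1 g2 y f :: complex
  shows "(n1 * n2) *\<^sub>R (v1, v2, k1 :: real, k2 :: real, g1, g2, c *\<^sub>R y, f) =
    (n2 *\<^sub>R (n1 *\<^sub>R v1), n1 *\<^sub>R (n2 *\<^sub>R v2), n2 * (n1 * k1), n1 * (n2 * k2),
     n2 *\<^sub>R (n1 *\<^sub>R g1), n1 *\<^sub>R (n2 *\<^sub>R g2), (n1 * n2 * c) *\<^sub>R y, (n1 * n2) *\<^sub>R f)"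
  by (simp add: mult_ac)

text \<open>The definition of \<open>X\<close> evaluates an inverse of \<open>to_coords\<close>, which the injectivity on regular points
  identifies with the given preimage \<open>w\<close>. The rest is the chain rule, and the common factor
  \<open>\<bar>\<zeta>1\<bar>\<^sup>2 \<bar>\<zeta>2\<bar>\<^sup>2\<close> is split so that each binary takes its own part.\<close>

lemma X_field_eq_slow_field:
  assumes m: "\<And>i. i \<in> {1..4} \<Longrightarrow> m i > 0" and w: "w \<in> regular_points m"
  shows "X_field m (to_coords m w) = slow_field m (to_coords m w)"
proof -
  obtain z1 z2 x u1 u2 y where w_eq: "w = ((z1, z2, x), (u1, u2, y))"
    by (metis prod.exhaust)
  obtain F1 F2 Fx where F: "tidal m (fst (to_phase m w)) = (F1, F2, Fx)"
    by (metis prod.exhaust)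
  define a1 a2 c1 c2 where ac: "a1 = ac m 1" "a2 = ac m 2" "c1 = scale_const m 1" "c2 = scale_const m 2"
  have "redmass m j > 0 \<and> kc m j > 0 \<and> ac m j > 0" if "j \<in> {1, 2}" for j
    using mass_constants[of m j] m that by blast
  from this[of 1] this[of 2] have pos: "a1 > 0" "a2 > 0" "c1 > 0" "c2 > 0"
    unfolding ac by simp_all
  have ne: "z1 \<noteq> 0" "z2 \<noteq> 0" "u1 \<noteq> 0" "u2 \<noteq> 0"
    using w by (auto simp: regular_points_def w_eq)
  let ?z1 = "zeta_of a1 z1 u1" and ?z2 = "zeta_of a2 z2 u2"
  have push: "pushforward_vf (regular_points m) (to_coords m) Y (to_coords m w)
      = frechet_derivative (to_coords m) (at w) (Y w)" for Y
    using the_inv_into_f_f[OF inj_on_to_coords[of m] w] m by (simp add: pushforward_vf_def)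
  have lift: "lifted_vf m w = ((z_rate a1 z1 u1, z_rate a2 z2 u2, (1 / bmass m 1 + 1 / bmass m 2) *\<^sub>R y),
        (u_rate a1 c1 z1 u1 F1, u_rate a2 c2 z2 u2 F2, Fx))"
    using F by (simp add: lifted_vf_def w_eq ac del: One_nat_def)
  let ?f = "\<lambda>w. (zeta_of a1 (fst (fst w)) (fst (snd w)),
      zeta_of a2 (fst (snd (fst w))) (fst (snd (snd w))),
      h_of a1 (fst (fst w)) (fst (snd w)),
      h_of a2 (fst (snd (fst w))) (fst (snd (snd w))),
      fst (snd w) / of_real (norm (fst (snd w))),
      fst (snd (snd w)) / of_real (norm (fst (snd (snd w)))),
      snd (snd (fst w)), snd (snd (snd w)))"
  have f: "to_coords m = ?f"
    by (auto simp: to_coords_eq ac)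
  have D: "(to_coords m has_derivative (\<lambda>v.
      (of_real (a1 powr (- 1 / 3)) * (cnj (fst (snd v)) * fst (fst w) + cnj (fst (snd w)) * fst (fst v)),
       of_real (a2 powr (- 1 / 3)) * (cnj (fst (snd (snd v))) * fst (snd (fst w)) + cnj (fst (snd (snd w))) * fst (snd (fst v))),
       a1 powr (2 / 3) * (2 * (fst (snd w) \<bullet> fst (snd v)) / (norm (fst (fst w)))\<^sup>2
         - 2 * ((norm (fst (snd w)))\<^sup>2 - 1) * (fst (fst w) \<bullet> fst (fst v)) / (norm (fst (fst w))) ^ 4),
       a2 powr (2 / 3) * (2 * (fst (snd (snd w)) \<bullet> fst (snd (snd v))) / (norm (fst (snd (fst w))))\<^sup>2
         - 2 * ((norm (fst (snd (snd w))))\<^sup>2 - 1) * (fst (snd (fst w)) \<bullet> fst (snd (fst v))) / (norm (fst (snd (fst w)))) ^ 4),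
       turn_rate (fst (snd w)) (fst (snd v)), turn_rate (fst (snd (snd w))) (fst (snd (snd v))),
       snd (snd (fst v)), snd (snd (snd v))))) (at w)"
    unfolding f
    by (intro has_derivative_Pair has_derivative_zeta_of has_derivative_h_of has_derivative_direction
          has_derivative_fst has_derivative_snd has_derivative_ident)
      (use ne in \<open>auto simp: w_eq\<close>)
  have tc: "to_coords m w = (?z1, ?z2, h_of a1 z1 u1, h_of a2 z2 u2, u1 / of_real (norm u1), u2 / of_real (norm u2), x, y)"
    by (simp add: w_eq to_coords_eq ac)
  have "X_field m (to_coords m w) = ((norm ?z1)\<^sup>2 * (norm ?z2)\<^sup>2) *\<^sub>R
      frechet_derivative (to_coords m) (at w) (lifted_vf m w)"
    unfolding X_field_def push pullback_to_phase[of m, OF m w, simplified] by (simp add: tc)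
  also have "frechet_derivative (to_coords m) (at w) (lifted_vf m w) =
     (of_real (a1 powr (- 1 / 3)) * (cnj (u_rate a1 c1 z1 u1 F1) * z1 + cnj u1 * z_rate a1 z1 u1),
      of_real (a2 powr (- 1 / 3)) * (cnj (u_rate a2 c2 z2 u2 F2) * z2 + cnj u2 * z_rate a2 z2 u2),
      a1 powr (2 / 3) * (2 * (u1 \<bullet> u_rate a1 c1 z1 u1 F1) / (norm z1)\<^sup>2
       - 2 * ((norm u1)\<^sup>2 - 1) * (z1 \<bullet> z_rate a1 z1 u1) / (norm z1) ^ 4),
      a2 powr (2 / 3) * (2 * (u2 \<bullet> u_rate a2 c2 z2 u2 F2) / (norm z2)\<^sup>2
       - 2 * ((norm u2)\<^sup>2 - 1) * (z2 \<bullet> z_rate a2 z2 u2) / (norm z2) ^ 4),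
      turn_rate u1 (u_rate a1 c1 z1 u1 F1), turn_rate u2 (u_rate a2 c2 z2 u2 F2),
      (1 / bmass m 1 + 1 / bmass m 2) *\<^sub>R y, Fx)"
    unfolding frechet_derivative_at[OF D, symmetric] lift by (simp only: w_eq fst_conv snd_conv)
  also have "((norm ?z1)\<^sup>2 * (norm ?z2)\<^sup>2) *\<^sub>R \<dots> =
      ((norm ?z2)\<^sup>2 *\<^sub>R zeta_rate a1 c1 z1 u1 F1, (norm ?z1)\<^sup>2 *\<^sub>R zeta_rate a2 c2 z2 u2 F2,
       (norm ?z2)\<^sup>2 * h_rate c1 z1 u1 F1, (norm ?z1)\<^sup>2 * h_rate c2 z2 u2 F2,
       (norm ?z2)\<^sup>2 *\<^sub>R turn_rate u1 (slow_u_rate a1 c1 (h_of a1 z1 u1) z1 u1 F1),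
       (norm ?z1)\<^sup>2 *\<^sub>R turn_rate u2 (slow_u_rate a2 c2 (h_of a2 z2 u2) z2 u2 F2),
       ((norm ?z1)\<^sup>2 * (norm ?z2)\<^sup>2 * (1 / bmass m 1 + 1 / bmass m 2)) *\<^sub>R y,
       ((norm ?z1)\<^sup>2 * (norm ?z2)\<^sup>2) *\<^sub>R Fx)"
    unfolding distribute_time_rescaling slow_zeta[OF pos(1,3) ne(1)] slow_zeta[OF pos(2,4) ne(2)]
      slow_h[OF pos(1,3) ne(1)] slow_h[OF pos(2,4) ne(2)]
      turn_rate_scaleR slow_u[OF pos(1,3) ne(1)] slow_u[OF pos(2,4) ne(2)] ..
  also have "\<dots> = slow_field m (to_coords m w)"
    using from_to_coords[of m, OF m w, simplified] F
    by (simp add: slow_field_def tc[unfolded w_eq] w_eq Let_def ac del: One_nat_def)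
  finally show ?thesis .
qed


section \<open>Charts of the blow-up\<close>

text \<open>A chart identifies \<open>\<real>\<^sup>4\<close> with \<open>\<real> \<times> \<real>\<^sup>3\<close> by \<open>coord\<close> and \<open>others\<close>. With \<open>slope\<close>, the linear part of
  the affine map \<open>hom\<close>, the four charts are treated by the same formulas, without case distinctions.\<close>

fun coord :: "axis \<Rightarrow> vec4 \<Rightarrow> real" where
  "coord Alpha (a, b, c, d) = a"
| "coord Beta (a, b, c, d) = b"
| "coord Gamma (a, b, c, d) = c"
| "coord Delta (a, b, c, d) = d"

fun others :: "axis \<Rightarrow> vec4 \<Rightarrow> real \<times> real \<times> real" where
  "others Alpha (a, b, c, d) = (b, c, d)"
| "others Beta (a, b, c, d) = (a, c, d)"
| "others Gamma (a, b, c, d) = (a, b, d)"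
| "others Delta (a, b, c, d) = (a, b, c)"

definition slope :: "axis \<Rightarrow> real \<times> real \<times> real \<Rightarrow> vec4" where
  "slope \<eta> \<xi> = hom \<eta> \<xi> - hom \<eta> 0"

lemma hom_add: "hom \<eta> (\<xi> + \<xi>') = hom \<eta> \<xi> + slope \<eta> \<xi>'"
  by (cases \<eta>; cases \<xi>; cases \<xi>') (simp_all add: slope_def zero_prod_def)

lemma chart_maps_simps [simp]: "coord \<eta> (hom \<eta> \<xi>) = 1" "others \<eta> (hom \<eta> \<xi>) = \<xi>"
  "coord \<eta> (slope \<eta> \<xi>) = 0" "others \<eta> (slope \<eta> \<xi>) = \<xi>"
  by (cases \<eta>; cases \<xi>; simp add: slope_def zero_prod_def)+

lemma slope_others: "slope \<eta> (others \<eta> v) = v - coord \<eta> v *\<^sub>R hom \<eta> 0"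
  by (cases \<eta>; cases v) (simp_all add: slope_def zero_prod_def)

lemma hom_eq_slope: "hom \<eta> \<xi> = hom \<eta> 0 + slope \<eta> \<xi>"
  by (simp add: slope_def)

lemma bounded_linear_coord: "bounded_linear (coord \<eta>)"
proof -
  have "coord \<eta> = (case \<eta> of Alpha \<Rightarrow> fst | Beta \<Rightarrow> (\<lambda>v. fst (snd v)) | Gamma \<Rightarrow> (\<lambda>v. fst (snd (snd v)))
     | Delta \<Rightarrow> (\<lambda>v. snd (snd (snd v))))"
    by (cases \<eta>) auto
  then show ?thesis
    by (cases \<eta>) (auto intro!: bounded_linear_intros)
qed

lemma bounded_linear_others: "bounded_linear (others \<eta>)"
proof -
  have "others \<eta> = (case \<eta> of Alpha \<Rightarrow> snd | Beta \<Rightarrow> (\<lambda>v. (fst v, snd (snd v)))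
     | Gamma \<Rightarrow> (\<lambda>v. (fst v, fst (snd v), snd (snd (snd v))))
     | Delta \<Rightarrow> (\<lambda>v. (fst v, fst (snd v), fst (snd (snd v)))))"
    by (cases \<eta>) auto
  then show ?thesis
    by (cases \<eta>) (auto intro!: bounded_linear_intros bounded_linear_Pair)
qed

lemma bounded_linear_slope: "bounded_linear (slope \<eta>)"
proof -
  have "slope \<eta> = (case \<eta> of Alpha \<Rightarrow> (\<lambda>\<xi>. (0, \<xi>)) | Beta \<Rightarrow> (\<lambda>\<xi>. (fst \<xi>, 0, snd \<xi>))
     | Gamma \<Rightarrow> (\<lambda>\<xi>. (fst \<xi>, fst (snd \<xi>), 0, snd (snd \<xi>)))
     | Delta \<Rightarrow> (\<lambda>\<xi>. (fst \<xi>, fst (snd \<xi>), snd (snd \<xi>), 0)))"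
    by (cases \<eta>) (auto simp: slope_def zero_prod_def)
  then show ?thesis
    by (cases \<eta>) (auto intro!: bounded_linear_intros bounded_linear_Pair)
qed

lemmas linear_chart_maps = bounded_linear_coord[THEN bounded_linear.linear]
  bounded_linear_others[THEN bounded_linear.linear] bounded_linear_slope[THEN bounded_linear.linear]

lemmas chart_maps_linear [simp] =
  linear_add[OF linear_chart_maps(1)] linear_add[OF linear_chart_maps(2)] linear_add[OF linear_chart_maps(3)]
  linear_diff[OF linear_chart_maps(1)] linear_diff[OF linear_chart_maps(2)] linear_diff[OF linear_chart_maps(3)]
  linear_scale[OF linear_chart_maps(1)] linear_scale[OF linear_chart_maps(2)] linear_scale[OF linear_chart_maps(3)]
  linear_0[OF linear_chart_maps(1)] linear_0[OF linear_chart_maps(2)] linear_0[OF linear_chart_maps(3)]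

definition zeta1 :: "vec4 \<Rightarrow> complex" where
  "zeta1 v = Complex (fst v) (fst (snd v))"

definition zeta2 :: "vec4 \<Rightarrow> complex" where
  "zeta2 v = Complex (fst (snd (snd v))) (snd (snd (snd v)))"

definition join :: "complex \<Rightarrow> complex \<Rightarrow> vec4" where
  "join a b = (Re a, Im a, Re b, Im b)"

lemma zeta_join [simp]: "zeta1 (join a b) = a" "zeta2 (join a b) = b" "join (zeta1 v) (zeta2 v) = v"
  by (simp_all add: zeta1_def zeta2_def join_def)

lemma bounded_linear_zeta: "bounded_linear zeta1" "bounded_linear zeta2"
proof -
  have *: "zeta1 = (\<lambda>v. fst v *\<^sub>R 1 + fst (snd v) *\<^sub>R \<i>)"
    "zeta2 = (\<lambda>v. fst (snd (snd v)) *\<^sub>R 1 + snd (snd (snd v)) *\<^sub>R \<i>)"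
    by (auto simp: zeta1_def zeta2_def complex_eq_iff)
  show "bounded_linear zeta1" "bounded_linear zeta2"
    unfolding * by (intro bounded_linear_add bounded_linear_scaleR_const bounded_linear_fst bounded_linear_snd
        bounded_linear_compose[OF bounded_linear_fst] bounded_linear_compose[OF bounded_linear_snd])+
qed

lemmas zeta_linear =
  bounded_linear_zeta(1)[THEN bounded_linear.linear] bounded_linear_zeta(2)[THEN bounded_linear.linear]

lemma blowdown_eq: "blowdown \<eta> (r, \<xi>, \<mu>) = (zeta1 (r *\<^sub>R hom \<eta> \<xi>), zeta2 (r *\<^sub>R hom \<eta> \<xi>), \<mu>)"
  unfolding blowdown_def chart_param_def
  by (cases "r *\<^sub>R hom \<eta> \<xi>") (simp add: zeta1_def zeta2_def)

text \<open>If \<open>v = r *\<^sub>R hom \<eta> \<xi>\<close> then \<open>v' = r' *\<^sub>R hom \<eta> \<xi> + r *\<^sub>R slope \<eta> \<xi>'\<close>. The coordinate \<open>\<eta>\<close> of this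
  equation gives \<open>r'\<close>, and the others then give \<open>\<xi>'\<close>.\<close>

lemma pullback_blowdown:
  assumes r: "r \<noteq> 0" and X: "X (blowdown \<eta> (r, \<xi>, \<mu>)) = (a, b, \<nu>)"
  shows "pullback_vf (blowdown \<eta>) X (r, \<xi>, \<mu>) = (coord \<eta> (join a b),
     (1 / r) *\<^sub>R (others \<eta> (join a b) - coord \<eta> (join a b) *\<^sub>R \<xi>), \<nu>)"
proof (rule pullback_vf_eqI)
  let ?v = "\<lambda>q. fst q *\<^sub>R (hom \<eta> 0 + slope \<eta> (fst (snd q)))"
  let ?v' = "\<lambda>d. r *\<^sub>R slope \<eta> (fst (snd d)) + fst d *\<^sub>R hom \<eta> \<xi>"
  have "(?v has_derivative ?v') (at (r, \<xi>, \<mu>))"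
    by (rule derivative_eq_intros bounded_linear.has_derivative[OF bounded_linear_slope] refl
       | simp add: fun_eq_iff hom_eq_slope[of \<eta> \<xi>])+
  then have "((\<lambda>q. (zeta1 (?v q), zeta2 (?v q), snd (snd q))) has_derivative
     (\<lambda>d. (zeta1 (?v' d), zeta2 (?v' d), snd (snd d)))) (at (r, \<xi>, \<mu>))"
    by (intro has_derivative_Pair bounded_linear.has_derivative[OF bounded_linear_zeta(1)]
        bounded_linear.has_derivative[OF bounded_linear_zeta(2)] has_derivative_snd has_derivative_ident)
  moreover have "blowdown \<eta> = (\<lambda>q. (zeta1 (?v q), zeta2 (?v q), snd (snd q)))"
    by (auto simp: blowdown_eq hom_eq_slope[of \<eta>, symmetric])
  ultimately show "(blowdown \<eta> has_derivative (\<lambda>d. (zeta1 (?v' d), zeta2 (?v' d), snd (snd d)))) (at (r, \<xi>, \<mu>))"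
    by simp
  have "coord \<eta> v *\<^sub>R hom \<eta> \<xi> + slope \<eta> (others \<eta> v - coord \<eta> v *\<^sub>R \<xi>) = v" for v
    by (simp add: slope_others hom_eq_slope[of \<eta> \<xi>] algebra_simps)
  then show "(\<lambda>d. (zeta1 (?v' d), zeta2 (?v' d), snd (snd d)))
      (coord \<eta> (join a b), (1 / r) *\<^sub>R (others \<eta> (join a b) - coord \<eta> (join a b) *\<^sub>R \<xi>), \<nu>)
     = X (blowdown \<eta> (r, \<xi>, \<mu>))"
    using r by (simp add: X add.commute)
  fix d assume d: "(zeta1 (?v' d), zeta2 (?v' d), snd (snd d)) = 0"
  then have "?v' d = join 0 0"
    by (metis zero_prod_def prod.inject zeta_join(3))
  then have "?v' d = 0" "snd (snd d) = 0"
    using d by (auto simp: join_def zero_prod_def)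
  then have "coord \<eta> (?v' d) = 0" "others \<eta> (?v' d) = 0" "snd (snd d) = 0"
    by simp_all
  then show "d = 0"
    using r by (simp add: prod_eq_iff)
qed

text \<open>The desingularised field off the collision manifold. As \<open>X\<close> is divisible by \<open>r\<^sup>2\<close>, dividing
  its \<open>\<zeta>\<close> part by \<open>r\<close> twice (once for \<open>\<xi>'\<close>, once for the rescaling of time) leaves a continuous
  expression, and the \<open>r\<close> and \<open>\<M>\<close> components keep a factor \<open>r\<close>.\<close>

definition rescaled_field :: "(nat \<Rightarrow> real) \<Rightarrow> axis \<Rightarrow> chart \<Rightarrow> chart" where
  "rescaled_field m \<eta> q = (case q of (r, \<xi>, h1, h2, \<Gamma>1, \<Gamma>2, x, y) \<Rightarrow>
     case from_coords m (blowdown \<eta> q) of ((z1, z2, _), (u1, u2, _)) \<Rightarrow>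
     case tidal m (fst (to_phase m (from_coords m (blowdown \<eta> q)))) of (F1, F2, Fx) \<Rightarrow>
     let n1 = (norm (zeta1 (hom \<eta> \<xi>)))\<^sup>2; n2 = (norm (zeta2 (hom \<eta> \<xi>)))\<^sup>2;
       v = join (n2 *\<^sub>R zeta_rate (ac m 1) (scale_const m 1) z1 u1 F1) (n1 *\<^sub>R zeta_rate (ac m 2) (scale_const m 2) z2 u2 F2)
     in (r * coord \<eta> v, others \<eta> v - coord \<eta> v *\<^sub>R \<xi>, r *\<^sub>R
       (n2 * h_rate (scale_const m 1) z1 u1 F1,
        n1 * h_rate (scale_const m 2) z2 u2 F2,
        n2 *\<^sub>R turn_rate u1 (slow_u_rate (ac m 1) (scale_const m 1) h1 z1 u1 F1),
        n1 *\<^sub>R turn_rate u2 (slow_u_rate (ac m 2) (scale_const m 2) h2 z2 u2 F2),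
        (r\<^sup>2 * n1 * n2 * (1 / bmass m 1 + 1 / bmass m 2)) *\<^sub>R y,
        (r\<^sup>2 * n1 * n2) *\<^sub>R Fx)))"

lemma join_scaleR: "join (k *\<^sub>R a) (k *\<^sub>R b) = k *\<^sub>R join a b"
  by (simp add: join_def)

lemma desing_eq_rescaled_field:
  assumes m: "\<And>i. i \<in> {1..4} \<Longrightarrow> m i > 0" and q: "q \<in> chart_regular m \<eta>"
  shows "inverse (fst q) *\<^sub>R pullback_vf (blowdown \<eta>) (X_field m) q = rescaled_field m \<eta> q"
proof -
  obtain r \<xi> h1 h2 \<Gamma>1 \<Gamma>2 x y where q_eq: "q = (r, \<xi>, h1, h2, \<Gamma>1, \<Gamma>2, x, y)"
    by (metis prod.exhaust)
  have r: "r \<noteq> 0" using q by (simp add: chart_regular_def q_eq)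
  have X: "X_field m (blowdown \<eta> q) = slow_field m (blowdown \<eta> q)"
    using q X_field_eq_slow_field[of m] m by (auto simp: chart_regular_def)
  obtain z1 z2 x' u1 u2 y' where w: "from_coords m (blowdown \<eta> q) = ((z1, z2, x'), (u1, u2, y'))"
    by (metis prod.exhaust)
  obtain F1 F2 Fx where F: "tidal m (fst (to_phase m ((z1, z2, x'), (u1, u2, y')))) = (F1, F2, Fx)"
    by (metis prod.exhaust)
  define n1 n2 where n: "n1 = (norm (zeta1 (hom \<eta> \<xi>)))\<^sup>2" "n2 = (norm (zeta2 (hom \<eta> \<xi>)))\<^sup>2"
  have N: "(norm (zeta1 (r *\<^sub>R hom \<eta> \<xi>)))\<^sup>2 = r\<^sup>2 * n1" "(norm (zeta2 (r *\<^sub>R hom \<eta> \<xi>)))\<^sup>2 = r\<^sup>2 * n2"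
    by (simp_all add: linear_scale[OF zeta_linear(1)] linear_scale[OF zeta_linear(2)] power_mult_distrib n)
  define A1 A2 where A: "A1 = zeta_rate (ac m 1) (scale_const m 1) z1 u1 F1" "A2 = zeta_rate (ac m 2) (scale_const m 2) z2 u2 F2"
  define B1 B2 where B: "B1 = h_rate (scale_const m 1) z1 u1 F1" "B2 = h_rate (scale_const m 2) z2 u2 F2"
  define G1 G2 where G: "G1 = turn_rate u1 (slow_u_rate (ac m 1) (scale_const m 1) h1 z1 u1 F1)"
     "G2 = turn_rate u2 (slow_u_rate (ac m 2) (scale_const m 2) h2 z2 u2 F2)"
  define k where "k = 1 / bmass m 1 + 1 / bmass m 2"
  define v where "v = join (n2 *\<^sub>R A1) (n1 *\<^sub>R A2)"
  have j: "join ((r\<^sup>2 * n2) *\<^sub>R A1) ((r\<^sup>2 * n1) *\<^sub>R A2) = r\<^sup>2 *\<^sub>R v"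
    unfolding v_def join_scaleR[symmetric] by simp
  have "X_field m (blowdown \<eta> q) = ((r\<^sup>2 * n2) *\<^sub>R A1, (r\<^sup>2 * n1) *\<^sub>R A2,
       (r\<^sup>2 * n2) * B1, (r\<^sup>2 * n1) * B2, (r\<^sup>2 * n2) *\<^sub>R G1, (r\<^sup>2 * n1) *\<^sub>R G2,
       ((r\<^sup>2 * n1) * (r\<^sup>2 * n2) * k) *\<^sub>R y, ((r\<^sup>2 * n1) * (r\<^sup>2 * n2)) *\<^sub>R Fx)"
    unfolding X slow_field_def w prod.case F
    by (simp add: q_eq blowdown_eq F N A B G k_def Let_def del: One_nat_def)
  from pullback_blowdown[of r "X_field m" \<eta> \<xi> "(h1, h2, \<Gamma>1, \<Gamma>2, x, y)", folded q_eq, OF r this, unfolded j]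
  have "pullback_vf (blowdown \<eta>) (X_field m) q = (r\<^sup>2 * coord \<eta> v, (1 / r) *\<^sub>R (r\<^sup>2 *\<^sub>R (others \<eta> v - coord \<eta> v *\<^sub>R \<xi>)),
      (r\<^sup>2 * n2) * B1, (r\<^sup>2 * n1) * B2, (r\<^sup>2 * n2) *\<^sub>R G1, (r\<^sup>2 * n1) *\<^sub>R G2,
       ((r\<^sup>2 * n1) * (r\<^sup>2 * n2) * k) *\<^sub>R y, ((r\<^sup>2 * n1) * (r\<^sup>2 * n2)) *\<^sub>R Fx)"
    by (simp add: scaleR_diff_right)
  also have "inverse r *\<^sub>R \<dots> = (r * coord \<eta> v, others \<eta> v - coord \<eta> v *\<^sub>R \<xi>, r *\<^sub>R
      (n2 * B1, n1 * B2, n2 *\<^sub>R G1, n1 *\<^sub>R G2, (r\<^sup>2 * n1 * n2 * k) *\<^sub>R y, (r\<^sup>2 * n1 * n2) *\<^sub>R Fx))"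
    using r by (simp add: power2_eq_square mult_ac)
  also have "\<dots> = rescaled_field m \<eta> q"
    unfolding rescaled_field_def w
    by (simp add: q_eq F Let_def n[symmetric] A B G k_def v_def del: One_nat_def)
  finally show ?thesis
    by (simp add: q_eq)
qed


section \<open>The limit at the collision manifold\<close>

lemma binary_variables_tendsto:
  assumes h: "(h \<longlongrightarrow> h0) net" and z: "(\<zeta> \<longlongrightarrow> 0) net"
    and G: "(\<Gamma> \<longlongrightarrow> \<Gamma>0) net" and nG: "norm \<Gamma>0 = 1"
  shows "((\<lambda>q. u_of (h q) (\<Gamma> q) (\<zeta> q)) \<longlongrightarrow> \<Gamma>0) net"
    "((\<lambda>q. z_of a (h q) (\<Gamma> q) (\<zeta> q)) \<longlongrightarrow> 0) net"
proof -
  have "((\<lambda>q. speed_sq (h q) (\<zeta> q)) \<longlongrightarrow> (1 + sqrt (1 + 4 * h0 * (norm (0::complex))\<^sup>2)) / 2) net"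
    unfolding speed_sq_def by (intro tendsto_intros h z) simp
  then have "((\<lambda>q. speed_sq (h q) (\<zeta> q)) \<longlongrightarrow> 1) net"
    by simp
  then have "((\<lambda>q. u_of (h q) (\<Gamma> q) (\<zeta> q)) \<longlongrightarrow> of_real (sqrt 1) * \<Gamma>0) net"
    unfolding u_of_def by (intro tendsto_intros G)
  then show u: "((\<lambda>q. u_of (h q) (\<Gamma> q) (\<zeta> q)) \<longlongrightarrow> \<Gamma>0) net"
    by simp
  have "((\<lambda>q. z_of a (h q) (\<Gamma> q) (\<zeta> q)) \<longlongrightarrow> of_real (a powr (1 / 3)) * 0 / cnj \<Gamma>0) net"
    unfolding z_of_def by (intro tendsto_intros u z) (use nG in auto)
  then show "((\<lambda>q. z_of a (h q) (\<Gamma> q) (\<zeta> q)) \<longlongrightarrow> 0) net"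
    by simp
qed

lemma rates_tendsto:
  assumes c: "a > 0" "c > 0" and h: "(h \<longlongrightarrow> h0) net" and z: "(z \<longlongrightarrow> 0) net"
    and u: "(u \<longlongrightarrow> \<Gamma>0) net" and nG: "norm \<Gamma>0 = 1" and F: "(F \<longlongrightarrow> F0) net"
  shows "((\<lambda>q. zeta_rate a c (z q) (u q) (F q)) \<longlongrightarrow> 1) net"
    "((\<lambda>q. h_rate c (z q) (u q) (F q)) \<longlongrightarrow> 0) net"
    "((\<lambda>q. turn_rate (u q) (slow_u_rate a c (h q) (z q) (u q) (F q))) \<longlongrightarrow> 0) net"
proof -
  have "((\<lambda>q. zeta_rate a c (z q) (u q) (F q)) \<longlongrightarrow>
      of_real ((norm \<Gamma>0)\<^sup>2 * (2 * (norm \<Gamma>0)\<^sup>2 - 1)) + of_real ((norm \<Gamma>0)\<^sup>2 * (norm (0::complex))\<^sup>2 / (a * c)) * 0\<^sup>2 * cnj F0) net"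
    unfolding zeta_rate_def by (intro tendsto_intros z u F) (use c in auto)
  then show "((\<lambda>q. zeta_rate a c (z q) (u q) (F q)) \<longlongrightarrow> 1) net"
    by (simp add: nG)
  have "((\<lambda>q. h_rate c (z q) (u q) (F q)) \<longlongrightarrow> 2 * (norm \<Gamma>0)\<^sup>2 / c * (\<Gamma>0 \<bullet> (cnj 0 * F0))) net"
    unfolding h_rate_def by (intro tendsto_intros z u F) (use c in auto)
  then show "((\<lambda>q. h_rate c (z q) (u q) (F q)) \<longlongrightarrow> 0) net"
    by simp
  have "((\<lambda>q. slow_u_rate a c (h q) (z q) (u q) (F q)) \<longlongrightarrow>
     of_real (a powr (- 1 / 3) * (norm \<Gamma>0)\<^sup>2 * h0) * 0
     + of_real ((norm \<Gamma>0)\<^sup>2 * (norm (0::complex))\<^sup>2 / (c * a powr (2 / 3))) * (cnj 0 * F0)) net"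
    unfolding slow_u_rate_def by (intro tendsto_intros h z u F) (use c in auto)
  then have s: "((\<lambda>q. slow_u_rate a c (h q) (z q) (u q) (F q)) \<longlongrightarrow> 0) net"
    by simp
  have "((\<lambda>q. turn_rate (u q) (slow_u_rate a c (h q) (z q) (u q) (F q))) \<longlongrightarrow>
      0 / of_real (norm \<Gamma>0) - ((\<Gamma>0 \<bullet> 0) / norm \<Gamma>0 ^ 3) *\<^sub>R \<Gamma>0) net"
    unfolding turn_rate_def by (intro tendsto_intros s u) (use nG in auto)
  then show "((\<lambda>q. turn_rate (u q) (slow_u_rate a c (h q) (z q) (u q) (F q))) \<longlongrightarrow> 0) net"
    by simp
qed

lemma isCont_tidal:
  assumes "x \<noteq> 0"
  shows "isCont (tidal m) (0, 0, x)"
proof -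
  have s: "separation (cross_coef m i j) (0, 0, x) = x" for i j
    by simp
  have "isCont (attraction k (cross_coef m i j)) (0, 0, x)" for k i j
  proof -
    obtain a b c where l: "cross_coef m i j = (a, b, c)"
      by (metis prod.exhaust)
    have "isCont (separation (a, b, c)) (0, 0, x)"
      by (rule linear_continuous_at[OF bounded_linear_separation])
    moreover have "separation (a, b, c) (0, 0, x) \<noteq> 0"
      using s[of i j] assms unfolding l by metis
    ultimately have "isCont (\<lambda>q. (- k / norm (separation (a, b, c) q) ^ 3) *\<^sub>R
        (a *\<^sub>R separation (a, b, c) q, b *\<^sub>R separation (a, b, c) q, c *\<^sub>R separation (a, b, c) q)) (0, 0, x)"
      by (intro continuous_intros) (auto simp del: separation.simps)
    then show ?thesis
      unfolding l attraction_def along.simps .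
  qed
  then show ?thesis
    unfolding tidal_def[abs_def] by (intro continuous_intros)
qed

text \<open>Sufficient conditions, in the coordinates \<open>\<zeta>, h, \<Gamma>\<close>, for a point to be regular. The one on
  \<open>1 + 4 h \<bar>\<zeta>\<bar>\<^sup>2\<close> makes the root \<open>speed_sq\<close> real and greater than \<open>1 / 2\<close>.\<close>

lemma in_regular_image:
  fixes y :: complex
  assumes m: "\<And>i. i \<in> {1..4} \<Longrightarrow> m i > 0"
    and "\<zeta>1 \<noteq> 0" "\<zeta>2 \<noteq> 0" "norm \<Gamma>1 = 1" "norm \<Gamma>2 = 1" "x \<noteq> 0"
    and "1 + 4 * h1 * (norm \<zeta>1)\<^sup>2 > 0" "1 + 4 * h2 * (norm \<zeta>2)\<^sup>2 > 0"
  defines "c \<equiv> (\<zeta>1, \<zeta>2, h1, h2, \<Gamma>1, \<Gamma>2, x, y)"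
  assumes separation: "\<And>i j. i \<in> {1,2} \<Longrightarrow> j \<in> {3,4} \<Longrightarrow> separation (cross_coef m i j) (fst (to_phase m (from_coords m c))) \<noteq> 0"
  shows "c \<in> to_coords m ` regular_points m"
proof
  have a: "ac m 1 > 0" "ac m 2 > 0"
    by (rule mass_constants(5); use m in simp)+
  have nz: "kc m 1 \<noteq> 0" "kc m 2 \<noteq> 0" "redmass m 1 \<noteq> 0" "redmass m 2 \<noteq> 0"
    using mass_constants(1,2)[of m 1] mass_constants(1,2)[of m 2] m by (force simp del: One_nat_def)+
  note b1 = binary_coords_inverse_right[OF a(1) assms(2,4,7)]
  note b2 = binary_coords_inverse_right[OF a(2) assms(3,5,8)]
  show "c = to_coords m (from_coords m c)"
    using b1 b2 by (simp add: c_def from_coords_def to_coords_eq del: One_nat_def)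
  obtain Q1 Q2 where Q: "fst (to_phase m (from_coords m c)) = (Q1, Q2, x)" "Q1 \<noteq> 0" "Q2 \<noteq> 0"
    using b1(1) b2(1) nz by (simp add: c_def from_coords_def to_phase_def Let_def del: One_nat_def)
  have "inj_on (position m (fst (to_phase m (from_coords m c)))) {1..4}"
    using separation Q m unfolding Q(1) by (subst inj_on_position_iff) auto
  then show "from_coords m c \<in> regular_points m"
    using b1(1,2) b2(1,2) assms(6) by (simp add: regular_points_def c_def from_coords_def del: One_nat_def)
qed

text \<open>The leading order \<open>\<zeta>1' = \<bar>\<zeta>2\<bar>\<^sup>2\<close>, \<open>\<zeta>2' = \<bar>\<zeta>1\<bar>\<^sup>2\<close> of \<open>X\<close>, a homogeneous quadratic vector field on
  \<open>\<real>\<^sup>4\<close>. The field \<open>chart_field\<close> is what it induces on lines in the chart \<open>\<eta>\<close>.\<close>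

definition hom_field :: "vec4 \<Rightarrow> vec4" where
  "hom_field v = join (of_real ((norm (zeta2 v))\<^sup>2)) (of_real ((norm (zeta1 v))\<^sup>2))"

definition chart_field :: "axis \<Rightarrow> real \<times> real \<times> real \<Rightarrow> real \<times> real \<times> real" where
  "chart_field \<eta> \<xi> = others \<eta> (hom_field (hom \<eta> \<xi>)) - coord \<eta> (hom_field (hom \<eta> \<xi>)) *\<^sub>R \<xi>"

lemma chart_C_eq: "chart_C \<eta> = {0} \<times> UNIV \<times> Mset"
proof -
  have ne: "hom \<eta> \<xi> \<noteq> 0" for \<xi>
    by (metis chart_maps_simps(1) linear_0[OF linear_chart_maps(1)] zero_neq_one)
  then have "span {hom \<eta> \<xi>} \<in> projective_space" for \<xi>
    unfolding projective_space_def by blast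
  with ne show ?thesis
    by (auto simp: chart_C_def chart_param_def collision_manifold_def blowup_def intro: span_0)
qed

lemma tendsto_join [tendsto_intros]:
  "(f \<longlongrightarrow> a) F \<Longrightarrow> (g \<longlongrightarrow> b) F \<Longrightarrow> ((\<lambda>x. join (f x) (g x)) \<longlongrightarrow> join a b) F"
  unfolding join_def by (intro tendsto_intros)

text \<open>All ingredients of \<open>rescaled_field\<close> are continuous in the chart, and so the limit exists. The
  \<open>zeta_rate\<close> of either binary tends to \<open>1\<close>, which leaves the homogeneous field; the explicit factor \<open>r\<close> kills the
  components in the directions of \<open>r\<close> and \<open>\<M>\<close>.\<close>

lemma rescaled_field_tendsto:
  assumes m: "\<And>i. i \<in> {1..4} \<Longrightarrow> m i > 0" and p: "(0, \<xi>, \<mu>) \<in> chart_C \<eta>"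
  shows "((rescaled_field m \<eta>) \<longlongrightarrow> (0, chart_field \<eta> \<xi>, 0)) (at (0, \<xi>, \<mu>) within T)"
    (is "(_ \<longlongrightarrow> _) ?net")
proof -
  obtain h1 h2 \<Gamma>1 \<Gamma>2 x y where \<mu>: "\<mu> = (h1, h2, \<Gamma>1, \<Gamma>2, x, y)"
    by (metis prod.exhaust)
  have M: "norm \<Gamma>1 = 1" "norm \<Gamma>2 = 1" "x \<noteq> 0"
    using p by (auto simp: chart_C_eq Mset_def \<mu>)
  have pos: "ac m 1 > 0" "ac m 2 > 0" "scale_const m 1 > 0" "scale_const m 2 > 0"
    using mass_constants(1,2,5)[of m 1] mass_constants(1,2,5)[of m 2] m by (force simp del: One_nat_def)+
  let ?r = "\<lambda>q::chart. fst q" and ?xi = "\<lambda>q::chart. fst (snd q)" and ?mu = "\<lambda>q::chart. snd (snd q)"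
  let ?h1 = "\<lambda>q. fst (?mu q)" and ?h2 = "\<lambda>q. fst (snd (?mu q))"
    and ?G1 = "\<lambda>q. fst (snd (snd (?mu q)))" and ?G2 = "\<lambda>q. fst (snd (snd (snd (?mu q))))"
    and ?x = "\<lambda>q. fst (snd (snd (snd (snd (?mu q)))))" and ?y = "\<lambda>q. snd (snd (snd (snd (snd (?mu q)))))"
  define P where "P = (0::real, \<xi>, \<mu>)"
  have "(?r \<longlongrightarrow> ?r P) ?net" "(?xi \<longlongrightarrow> ?xi P) ?net" "(?h1 \<longlongrightarrow> ?h1 P) ?net" "(?h2 \<longlongrightarrow> ?h2 P) ?net"
    "(?G1 \<longlongrightarrow> ?G1 P) ?net" "(?G2 \<longlongrightarrow> ?G2 P) ?net" "(?x \<longlongrightarrow> ?x P) ?net" "(?y \<longlongrightarrow> ?y P) ?net"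
    unfolding P_def[symmetric] by (intro tendsto_fst tendsto_snd tendsto_ident_at)+
  then have r: "(?r \<longlongrightarrow> 0) ?net" and xi: "(?xi \<longlongrightarrow> \<xi>) ?net"
    and h: "(?h1 \<longlongrightarrow> h1) ?net" "(?h2 \<longlongrightarrow> h2) ?net"
    and G: "(?G1 \<longlongrightarrow> \<Gamma>1) ?net" "(?G2 \<longlongrightarrow> \<Gamma>2) ?net"
    and x: "(?x \<longlongrightarrow> x) ?net" and y: "(?y \<longlongrightarrow> y) ?net"
    unfolding P_def \<mu> fst_conv snd_conv .
  have v: "((\<lambda>q. hom \<eta> (?xi q)) \<longlongrightarrow> hom \<eta> \<xi>) ?net"
    using tendsto_add[OF tendsto_const bounded_linear.tendsto[OF bounded_linear_slope xi], of "hom \<eta> 0" \<eta>]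
    unfolding hom_eq_slope[symmetric] .
  let ?z1 = "\<lambda>q. zeta1 (?r q *\<^sub>R hom \<eta> (?xi q))" and ?z2 = "\<lambda>q. zeta2 (?r q *\<^sub>R hom \<eta> (?xi q))"
  have z1: "(?z1 \<longlongrightarrow> 0) ?net"
    using bounded_linear.tendsto[OF bounded_linear_zeta(1) tendsto_scaleR[OF r v]]
    by (simp add: linear_0[OF zeta_linear(1)])
  have z2: "(?z2 \<longlongrightarrow> 0) ?net"
    using bounded_linear.tendsto[OF bounded_linear_zeta(2) tendsto_scaleR[OF r v]]
    by (simp add: linear_0[OF zeta_linear(2)])
  let ?U1 = "\<lambda>q. u_of (?h1 q) (?G1 q) (?z1 q)" and ?Z1 = "\<lambda>q. z_of (ac m 1) (?h1 q) (?G1 q) (?z1 q)"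
  let ?U2 = "\<lambda>q. u_of (?h2 q) (?G2 q) (?z2 q)" and ?Z2 = "\<lambda>q. z_of (ac m 2) (?h2 q) (?G2 q) (?z2 q)"
  note b1 = binary_variables_tendsto[OF h(1) z1 G(1) M(1)]
  note b2 = binary_variables_tendsto[OF h(2) z2 G(2) M(2)]
  let ?F = "\<lambda>q. tidal m ((?Z1 q)\<^sup>2 / of_real (2 * scale_const m 1), (?Z2 q)\<^sup>2 / of_real (2 * scale_const m 2), ?x q)"
  have "((\<lambda>q. ((?Z1 q)\<^sup>2 / of_real (2 * scale_const m 1), (?Z2 q)\<^sup>2 / of_real (2 * scale_const m 2), ?x q)) \<longlongrightarrow>
     (0\<^sup>2 / of_real (2 * scale_const m 1), 0\<^sup>2 / of_real (2 * scale_const m 2), x)) ?net"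
    by (intro tendsto_intros b1 b2 x) (use pos in auto)
  then have "((\<lambda>q. ((?Z1 q)\<^sup>2 / of_real (2 * scale_const m 1), (?Z2 q)\<^sup>2 / of_real (2 * scale_const m 2), ?x q)) \<longlongrightarrow> (0, 0, x)) ?net"
    by simp
  from isCont_tendsto_compose[OF isCont_tidal[OF M(3)] this]
  have F: "(?F \<longlongrightarrow> tidal m (0, 0, x)) ?net" .
  note F1 = tendsto_fst[OF F] and F2 = tendsto_fst[OF tendsto_snd[OF F]] and Fx = tendsto_snd[OF tendsto_snd[OF F]]
  note r1 = rates_tendsto[OF pos(1,3) h(1) b1(2,1) M(1) F1]
  note r2 = rates_tendsto[OF pos(2,4) h(2) b2(2,1) M(2) F2]
  let ?n1 = "\<lambda>q. (norm (zeta1 (hom \<eta> (?xi q))))\<^sup>2" and ?n2 = "\<lambda>q. (norm (zeta2 (hom \<eta> (?xi q))))\<^sup>2"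
  have n1: "(?n1 \<longlongrightarrow> (norm (zeta1 (hom \<eta> \<xi>)))\<^sup>2) ?net"
    by (intro tendsto_intros bounded_linear.tendsto[OF bounded_linear_zeta(1)] v)
  have n2: "(?n2 \<longlongrightarrow> (norm (zeta2 (hom \<eta> \<xi>)))\<^sup>2) ?net"
    by (intro tendsto_intros bounded_linear.tendsto[OF bounded_linear_zeta(2)] v)
  let ?V = "\<lambda>q. join (?n2 q *\<^sub>R zeta_rate (ac m 1) (scale_const m 1) (?Z1 q) (?U1 q) (fst (?F q)))
      (?n1 q *\<^sub>R zeta_rate (ac m 2) (scale_const m 2) (?Z2 q) (?U2 q) (fst (snd (?F q))))"
  have "(?V \<longlongrightarrow> join ((norm (zeta2 (hom \<eta> \<xi>)))\<^sup>2 *\<^sub>R 1) ((norm (zeta1 (hom \<eta> \<xi>)))\<^sup>2 *\<^sub>R 1)) ?net"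
    by (intro tendsto_intros n1 n2 r1(1) r2(1))
  then have V: "(?V \<longlongrightarrow> hom_field (hom \<eta> \<xi>)) ?net"
    by (simp add: hom_field_def scaleR_conv_of_real)
  have S: "((\<lambda>q. (?n2 q * h_rate (scale_const m 1) (?Z1 q) (?U1 q) (fst (?F q)),
        ?n1 q * h_rate (scale_const m 2) (?Z2 q) (?U2 q) (fst (snd (?F q))),
        ?n2 q *\<^sub>R turn_rate (?U1 q) (slow_u_rate (ac m 1) (scale_const m 1) (?h1 q) (?Z1 q) (?U1 q) (fst (?F q))),
        ?n1 q *\<^sub>R turn_rate (?U2 q) (slow_u_rate (ac m 2) (scale_const m 2) (?h2 q) (?Z2 q) (?U2 q) (fst (snd (?F q)))),
        ((?r q)\<^sup>2 * ?n1 q * ?n2 q * (1 / bmass m 1 + 1 / bmass m 2)) *\<^sub>R ?y q,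
        ((?r q)\<^sup>2 * ?n1 q * ?n2 q) *\<^sub>R snd (snd (?F q)))) \<longlongrightarrow>
     ((norm (zeta2 (hom \<eta> \<xi>)))\<^sup>2 * 0, (norm (zeta1 (hom \<eta> \<xi>)))\<^sup>2 * 0,
      (norm (zeta2 (hom \<eta> \<xi>)))\<^sup>2 *\<^sub>R 0, (norm (zeta1 (hom \<eta> \<xi>)))\<^sup>2 *\<^sub>R 0,
      (0\<^sup>2 * (norm (zeta1 (hom \<eta> \<xi>)))\<^sup>2 * (norm (zeta2 (hom \<eta> \<xi>)))\<^sup>2 * (1 / bmass m 1 + 1 / bmass m 2)) *\<^sub>R y,
      (0\<^sup>2 * (norm (zeta1 (hom \<eta> \<xi>)))\<^sup>2 * (norm (zeta2 (hom \<eta> \<xi>)))\<^sup>2) *\<^sub>R snd (snd (tidal m (0, 0, x))))) ?net"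
    by (intro tendsto_Pair tendsto_mult tendsto_scaleR tendsto_power tendsto_const n1 n2 r y r1(2,3) r2(2,3) Fx)
  have "rescaled_field m \<eta> = (\<lambda>q. (?r q * coord \<eta> (?V q), others \<eta> (?V q) - coord \<eta> (?V q) *\<^sub>R ?xi q, ?r q *\<^sub>R
       (?n2 q * h_rate (scale_const m 1) (?Z1 q) (?U1 q) (fst (?F q)),
        ?n1 q * h_rate (scale_const m 2) (?Z2 q) (?U2 q) (fst (snd (?F q))),
        ?n2 q *\<^sub>R turn_rate (?U1 q) (slow_u_rate (ac m 1) (scale_const m 1) (?h1 q) (?Z1 q) (?U1 q) (fst (?F q))),
        ?n1 q *\<^sub>R turn_rate (?U2 q) (slow_u_rate (ac m 2) (scale_const m 2) (?h2 q) (?Z2 q) (?U2 q) (fst (snd (?F q)))),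
        ((?r q)\<^sup>2 * ?n1 q * ?n2 q * (1 / bmass m 1 + 1 / bmass m 2)) *\<^sub>R ?y q,
        ((?r q)\<^sup>2 * ?n1 q * ?n2 q) *\<^sub>R snd (snd (?F q)))))" (is "_ = ?R")
  proof
    fix q :: chart
    obtain r \<xi> h1 h2 \<Gamma>1 \<Gamma>2 x y where q: "q = (r, \<xi>, h1, h2, \<Gamma>1, \<Gamma>2, x, y)"
      by (metis prod.exhaust)
    show "rescaled_field m \<eta> q = ?R q"
      unfolding rescaled_field_def q blowdown_eq from_coords_def to_phase_def
      by (simp only: prod.case Let_def fst_conv snd_conv case_prod_unfold)
  qed
  moreover have "(?R \<longlongrightarrow> (0 * coord \<eta> (hom_field (hom \<eta> \<xi>)),
      others \<eta> (hom_field (hom \<eta> \<xi>)) - coord \<eta> (hom_field (hom \<eta> \<xi>)) *\<^sub>R \<xi>, 0 *\<^sub>R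
     ((norm (zeta2 (hom \<eta> \<xi>)))\<^sup>2 * 0, (norm (zeta1 (hom \<eta> \<xi>)))\<^sup>2 * 0,
      (norm (zeta2 (hom \<eta> \<xi>)))\<^sup>2 *\<^sub>R 0, (norm (zeta1 (hom \<eta> \<xi>)))\<^sup>2 *\<^sub>R 0,
      (0\<^sup>2 * (norm (zeta1 (hom \<eta> \<xi>)))\<^sup>2 * (norm (zeta2 (hom \<eta> \<xi>)))\<^sup>2 * (1 / bmass m 1 + 1 / bmass m 2)) *\<^sub>R y,
      (0\<^sup>2 * (norm (zeta1 (hom \<eta> \<xi>)))\<^sup>2 * (norm (zeta2 (hom \<eta> \<xi>)))\<^sup>2) *\<^sub>R snd (snd (tidal m (0, 0, x)))))) ?net"
    by (intro tendsto_Pair[OF tendsto_mult[OF r bounded_linear.tendsto[OF bounded_linear_coord V]]]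
        tendsto_Pair tendsto_diff[OF bounded_linear.tendsto[OF bounded_linear_others V]
          tendsto_scaleR[OF bounded_linear.tendsto[OF bounded_linear_coord V] xi]]
        tendsto_scaleR[OF r S])
  ultimately show ?thesis
    by (simp add: chart_field_def zero_prod_def)
qed

lemma eventually_affine_nonzero:
  fixes a b :: real
  assumes "a \<noteq> 0 \<or> b \<noteq> 0"
  shows "eventually (\<lambda>t. a + t * b \<noteq> 0) (at_right 0)"
proof (cases "a = 0")
  case True
  then show ?thesis
    using assms by (auto simp: eventually_at_filter)
next
  case False
  have "((\<lambda>t. a + t * b) \<longlongrightarrow> a + 0 * b) (at_right 0)"
    by (intro tendsto_intros)
  then show ?thesis
    using False by (intro tendsto_imp_eventually_ne) auto
qed

text \<open>This is what makes the limit in \<open>desing_vf\<close> meaningful on the collision manifold.\<close>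

lemma chart_C_islimpt_regular:
  assumes m: "\<And>i. i \<in> {1..4} \<Longrightarrow> m i > 0" and p: "(0, \<xi>, \<mu>) \<in> chart_C \<eta>"
  shows "(0, \<xi>, \<mu>) islimpt chart_regular m \<eta>"
proof -
  obtain h1 h2 \<Gamma>1 \<Gamma>2 x y where \<mu>: "\<mu> = (h1, h2, \<Gamma>1, \<Gamma>2, x, y)"
    by (metis prod.exhaust)
  have M: "norm \<Gamma>1 = 1" "norm \<Gamma>2 = 1" "x \<noteq> 0"
    using p by (auto simp: chart_C_eq Mset_def \<mu>)
  have pos: "ac m 1 > 0" "ac m 2 > 0" "scale_const m 1 > 0" "scale_const m 2 > 0"
    using mass_constants(1,2,5)[of m 1] mass_constants(1,2,5)[of m 2] m by (force simp del: One_nat_def)+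
  \<comment> \<open>Pushing \<open>\<beta>\<close> and \<open>\<delta>\<close> away from \<open>0\<close> makes both \<open>\<zeta>1\<close> and \<open>\<zeta>2\<close> nonzero; in the charts \<open>Beta\<close> and
    \<open>Delta\<close> the coordinate that cannot be pushed equals \<open>1\<close>.\<close>
  define e where "e = others \<eta> (0, 1, 0, 1)"
  define v where "v t = hom \<eta> (\<xi> + t *\<^sub>R e)" for t
  define net where "net = at_right (0::real)"
  have v_eq: "v t = hom \<eta> \<xi> + t *\<^sub>R slope \<eta> e" for t
    by (simp add: v_def hom_add)
  have v: "(v \<longlongrightarrow> hom \<eta> \<xi> + 0 *\<^sub>R slope \<eta> e) net"
    unfolding v_eq[abs_def] net_def by (intro tendsto_intros)
  have t: "((\<lambda>t. t) \<longlongrightarrow> 0) net"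
    by (simp add: net_def)
  have z: "((\<lambda>t. zeta1 (t *\<^sub>R v t)) \<longlongrightarrow> 0) net" "((\<lambda>t. zeta2 (t *\<^sub>R v t)) \<longlongrightarrow> 0) net"
    using bounded_linear.tendsto[OF bounded_linear_zeta(1) tendsto_scaleR[OF t v]]
      bounded_linear.tendsto[OF bounded_linear_zeta(2) tendsto_scaleR[OF t v]]
    by (simp_all add: linear_0[OF zeta_linear(1)] linear_0[OF zeta_linear(2)])
  have ne1: "eventually (\<lambda>t. fst (snd (v t)) \<noteq> 0) net"
  proof -
    have "fst (snd (hom \<eta> \<xi>)) \<noteq> 0 \<or> fst (snd (slope \<eta> e)) \<noteq> 0"
      by (cases \<eta>; cases \<xi>) (auto simp: slope_def e_def zero_prod_def)
    from eventually_affine_nonzero[OF this] show ?thesis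
      by (simp add: v_eq net_def)
  qed
  have ne2: "eventually (\<lambda>t. snd (snd (snd (v t))) \<noteq> 0) net"
  proof -
    have "snd (snd (snd (hom \<eta> \<xi>))) \<noteq> 0 \<or> snd (snd (snd (slope \<eta> e))) \<noteq> 0"
      by (cases \<eta>; cases \<xi>) (auto simp: slope_def e_def zero_prod_def)
    from eventually_affine_nonzero[OF this] show ?thesis
      by (simp add: v_eq net_def)
  qed
  have ne0: "eventually (\<lambda>t. t \<noteq> 0) net"
    by (auto simp: net_def eventually_at_filter)
  have bound: "eventually (\<lambda>t. 1 + 4 * h * (norm (f t))\<^sup>2 > 0) net" if "(f \<longlongrightarrow> 0) net" for h and f :: "real \<Rightarrow> complex"
  proof -
    have "((\<lambda>t. 1 + 4 * h * (norm (f t))\<^sup>2) \<longlongrightarrow> 1 + 4 * h * (norm (0::complex))\<^sup>2) net"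
      by (intro tendsto_intros that)
    then show ?thesis
      by (intro order_tendstoD(1)[of _ 1]) auto
  qed
  let ?c = "\<lambda>t. (zeta1 (t *\<^sub>R v t), zeta2 (t *\<^sub>R v t), h1, h2, \<Gamma>1, \<Gamma>2, x, y)"
  have Q: "((\<lambda>t. fst (to_phase m (from_coords m (?c t)))) \<longlongrightarrow> (0, 0, x)) net"
  proof -
    let ?Z1 = "\<lambda>t. z_of (ac m 1) h1 \<Gamma>1 (zeta1 (t *\<^sub>R v t))" and ?Z2 = "\<lambda>t. z_of (ac m 2) h2 \<Gamma>2 (zeta2 (t *\<^sub>R v t))"
    have Z: "(?Z1 \<longlongrightarrow> 0) net" "(?Z2 \<longlongrightarrow> 0) net"
      by (rule binary_variables_tendsto(2)[OF tendsto_const z(1) tendsto_const M(1)]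
         binary_variables_tendsto(2)[OF tendsto_const z(2) tendsto_const M(2)])+
    have "((\<lambda>t. ((?Z1 t)\<^sup>2 / of_real (2 * scale_const m 1), (?Z2 t)\<^sup>2 / of_real (2 * scale_const m 2), x)) \<longlongrightarrow>
       (0\<^sup>2 / of_real (2 * scale_const m 1), 0\<^sup>2 / of_real (2 * scale_const m 2), x)) net"
      by (intro tendsto_intros Z) (use pos in auto)
    then show ?thesis
      by (simp add: from_coords_def to_phase_def Let_def del: One_nat_def)
  qed
  have separation: "eventually (\<lambda>t. \<forall>i\<in>{1,2}. \<forall>j\<in>{3,4}.
      separation (cross_coef m i j) (fst (to_phase m (from_coords m (?c t)))) \<noteq> 0) net"
  proof -
    have "eventually (\<lambda>t. separation (cross_coef m i j) (fst (to_phase m (from_coords m (?c t)))) \<noteq> 0) net" for i j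
      using bounded_linear.tendsto[OF bounded_linear_separation[of "cross_coef m i j"] Q] M(3)
      by (intro tendsto_imp_eventually_ne[where c = x]) auto
    then show ?thesis
      by (simp add: eventually_conj_iff del: cross_coef.simps separation.simps)
  qed
  have "eventually (\<lambda>t. (t, \<xi> + t *\<^sub>R e, \<mu>) \<in> chart_regular m \<eta> - {(0, \<xi>, \<mu>)}) net"
    using ne0 ne1 ne2 bound[OF z(1), of h1] bound[OF z(2), of h2] separation
  proof eventually_elim
    case (elim t)
    have "zeta1 (t *\<^sub>R v t) \<noteq> 0" "zeta2 (t *\<^sub>R v t) \<noteq> 0"
      using elim(1-3) by (auto simp: zeta1_def zeta2_def complex_eq_iff)
    then have "?c t \<in> to_coords m ` regular_points m"
      using elim M by (intro in_regular_image m) auto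
    then show ?case
      using elim(1) by (simp add: chart_regular_def blowdown_eq v_def \<mu>)
  qed
  moreover have "((\<lambda>t. (t, \<xi> + t *\<^sub>R e, \<mu>)) \<longlongrightarrow> (0, \<xi> + 0 *\<^sub>R e, \<mu>)) net"
    unfolding net_def by (intro tendsto_intros)
  ultimately show ?thesis
    unfolding islimpt_in_closure
    by (intro Lim_in_closed_set[where F = net and f = "\<lambda>t. (t, \<xi> + t *\<^sub>R e, \<mu>)"])
       (auto simp: net_def elim!: eventually_mono intro: subsetD[OF closure_subset])
qed

text \<open>On the collision manifold the dynamics is that of the homogeneous field on lines, and the point
  of \<open>\<M>\<close> does not move.\<close>

lemma desing_vf_collision:
  assumes m: "\<And>i. i \<in> {1..4} \<Longrightarrow> m i > 0" and p: "(0, \<xi>, \<mu>) \<in> chart_C \<eta>"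
  shows "desing_vf m \<eta> (0, \<xi>, \<mu>) = (0, chart_field \<eta> \<xi>, 0)"
proof -
  let ?net = "at (0, \<xi>, \<mu>) within chart_regular m \<eta>"
  let ?Y = "\<lambda>q. inverse (fst q) *\<^sub>R pullback_vf (blowdown \<eta>) (X_field m) q"
  have "eventually (\<lambda>q. q \<in> chart_regular m \<eta>) ?net"
    by (simp add: eventually_at_filter)
  then have "eventually (\<lambda>q. rescaled_field m \<eta> q = ?Y q) ?net"
    by eventually_elim (rule desing_eq_rescaled_field[OF m, symmetric])
  with rescaled_field_tendsto[OF m p]
  have "(?Y \<longlongrightarrow> (0, chart_field \<eta> \<xi>, 0)) ?net"
    by (rule Lim_transform_eventually)
  moreover have "\<not> trivial_limit ?net"
    using chart_C_islimpt_regular[OF m p] by (simp add: trivial_limit_within)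
  ultimately have "Lim ?net ?Y = (0, chart_field \<eta> \<xi>, 0)"
    by (intro tendsto_Lim)
  moreover have "(0, \<xi>, \<mu>) \<notin> chart_regular m \<eta>"
    by (simp add: chart_regular_def)
  ultimately show ?thesis
    by (simp add: desing_vf_def)
qed


section \<open>Tangent spaces of the collision manifold\<close>

text \<open>A linear parametrisation of the tangent spaces by \<open>\<real>\<^sup>11\<close>; the circle factors are tangent to
  \<open>\<i> * \<Gamma>\<close>.\<close>

definition tangent_param :: "mpoint \<Rightarrow> (real \<times> real \<times> real) \<times> real \<times> real \<times> real \<times> real \<times> complex \<times> complex \<Rightarrow> chart" where
  "tangent_param \<mu> = (\<lambda>(v, k1, k2, t1, t2, x', y'). case \<mu> of (h1, h2, \<Gamma>1, \<Gamma>2, x, y) \<Rightarrow>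
     (0, v, k1, k2, t1 *\<^sub>R (\<i> * \<Gamma>1), t2 *\<^sub>R (\<i> * \<Gamma>2), x', y'))"

lemma unit_circle_tangent:
  assumes "norm \<Gamma> = 1" "g \<bullet> \<Gamma> = 0"
  shows "g = (Im (cnj \<Gamma> * g)) *\<^sub>R (\<i> * \<Gamma>)"
proof -
  have "cnj \<Gamma> * g = \<i> * Im (cnj \<Gamma> * g)"
    using assms(2) by (simp add: complex_eq_iff inner_complex_def mult.commute)
  then have "\<Gamma> * cnj \<Gamma> * g = \<i> * Im (cnj \<Gamma> * g) * \<Gamma>"
    by (metis mult.commute mult.left_commute)
  moreover have "\<Gamma> * cnj \<Gamma> = 1"
    using assms(1) of_real_norm_sq[of \<Gamma>] by simp
  ultimately show ?thesis
    by (simp add: scaleR_conv_of_real mult_ac)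
qed

lemma has_vector_derivative_fst_snd:
  "(c has_vector_derivative v) F \<Longrightarrow> ((\<lambda>t. fst (c t)) has_vector_derivative fst v) F"
  "(c has_vector_derivative v) F \<Longrightarrow> ((\<lambda>t. snd (c t)) has_vector_derivative snd v) F"
  by (rule bounded_linear.has_vector_derivative[OF bounded_linear_fst], assumption)
     (rule bounded_linear.has_vector_derivative[OF bounded_linear_snd], assumption)

lemma tangent_space_collision:
  assumes p: "(0, \<xi>, \<mu>) \<in> chart_C \<eta>"
  shows "tangent_space (chart_C \<eta>) (0, \<xi>, \<mu>) = range (tangent_param \<mu>)"
proof -
  obtain h1 h2 \<Gamma>1 \<Gamma>2 x y where \<mu>: "\<mu> = (h1, h2, \<Gamma>1, \<Gamma>2, x, y)"
    by (metis prod.exhaust)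
  have M: "norm \<Gamma>1 = 1" "norm \<Gamma>2 = 1" "x \<noteq> 0"
    using p by (auto simp: chart_C_eq Mset_def \<mu>)
  show ?thesis
  proof (intro equalityI subsetI)
    fix w assume "w \<in> tangent_space (chart_C \<eta>) (0, \<xi>, \<mu>)"
    then obtain c where c: "\<And>t. c t \<in> chart_C \<eta>" "c 0 = (0, \<xi>, \<mu>)"
      and D: "(c has_vector_derivative w) (at 0)"
      unfolding tangent_space_def by blast
    obtain r v k1 k2 g1 g2 x' y' where w: "w = (r, v, k1, k2, g1, g2, x', y')"
      by (metis prod.exhaust)
    have "((\<lambda>t. 0) has_vector_derivative r) (at (0::real))"
      using has_vector_derivative_fst_snd(1)[OF D] c(1) by (simp add: chart_C_eq w mem_Times_iff)
    then have r: "r = 0"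
      using vector_derivative_unique_at has_vector_derivative_const by blast
    have circle: "g \<bullet> \<Gamma> = 0" if "(f has_vector_derivative g) (at 0)" "\<And>t. norm (f t) = 1" "f 0 = \<Gamma>"
      for f :: "real \<Rightarrow> complex" and g \<Gamma>
    proof -
      have "((\<lambda>t. (norm (f t))\<^sup>2) has_derivative (\<lambda>t. 2 * (f 0 \<bullet> (t *\<^sub>R g)))) (at 0)"
        using has_derivative_norm_sq that(1) unfolding has_vector_derivative_def by blast
      moreover have "((\<lambda>t. (norm (f t))\<^sup>2) has_derivative (\<lambda>t. 0)) (at 0)"
        by (simp add: that(2))
      ultimately have "(\<lambda>t. 2 * (f 0 \<bullet> (t *\<^sub>R g))) = (\<lambda>t. 0)"
        using has_derivative_unique by blast
      from fun_cong[OF this, of 1] show ?thesis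
        by (simp add: that(3) inner_commute)
    qed
    note sn = has_vector_derivative_fst_snd(2)[OF has_vector_derivative_fst_snd(2)[OF
        has_vector_derivative_fst_snd(2)[OF has_vector_derivative_fst_snd(2)[OF D]]]]
    have mem: "snd (snd (c t)) \<in> Mset" for t
      using c(1)[of t] by (auto simp: chart_C_eq)
    have "g1 \<bullet> \<Gamma>1 = 0"
      using has_vector_derivative_fst_snd(1)[OF sn] mem
      by (intro circle[where f = "\<lambda>t. fst (snd (snd (snd (snd (c t)))))"])
         (auto simp: w c \<mu> Mset_def case_prod_unfold)
    moreover have "g2 \<bullet> \<Gamma>2 = 0"
      using has_vector_derivative_fst_snd(1)[OF has_vector_derivative_fst_snd(2)[OF sn]] mem
      by (intro circle[where f = "\<lambda>t. fst (snd (snd (snd (snd (snd (c t))))))"])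
         (auto simp: w c \<mu> Mset_def case_prod_unfold)
    ultimately have "w = tangent_param \<mu> (v, k1, k2, Im (cnj \<Gamma>1 * g1), Im (cnj \<Gamma>2 * g2), x', y')"
      using unit_circle_tangent[OF M(1)] unit_circle_tangent[OF M(2)]
      by (simp add: tangent_param_def \<mu> w r)
    then show "w \<in> range (tangent_param \<mu>)"
      by blast
  next
    fix w assume "w \<in> range (tangent_param \<mu>)"
    then obtain v k1 k2 t1 t2 x' y' where w: "w = tangent_param \<mu> (v, k1, k2, t1, t2, x', y')"
      by auto
    \<comment> \<open>The exponentials keep \<open>\<Gamma>1\<close>, \<open>\<Gamma>2\<close> on the unit circle and \<open>x\<close> away from \<open>0\<close> for all times.\<close>
    let ?c = "\<lambda>t::real. (0::real, \<xi> + t *\<^sub>R v, h1 + t *\<^sub>R k1, h2 + t *\<^sub>R k2, exp (t *\<^sub>R (t1 *\<^sub>R \<i>)) * \<Gamma>1,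
       exp (t *\<^sub>R (t2 *\<^sub>R \<i>)) * \<Gamma>2, exp (t *\<^sub>R (x' / x)) * x, y + t *\<^sub>R y')"
    have l: "((\<lambda>t. a + t *\<^sub>R b) has_vector_derivative b) (at (0::real))" for a b :: "'z::real_normed_vector"
      by (auto intro!: derivative_eq_intros)
    have e: "((\<lambda>t. exp (t *\<^sub>R a) * b) has_vector_derivative a * b) (at (0::real))" for a b :: complex
      using has_vector_derivative_mult_left[OF exp_scaleR_has_vector_derivative_right[of a 0 UNIV], of b] by simp
    have "(?c has_vector_derivative (0, v, k1, k2, (t1 *\<^sub>R \<i>) * \<Gamma>1, (t2 *\<^sub>R \<i>) * \<Gamma>2, (x' / x) * x, y')) (at 0)"
      by (intro has_vector_derivative_Pair l e has_vector_derivative_const)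
    moreover have "(0, v, k1, k2, (t1 *\<^sub>R \<i>) * \<Gamma>1, (t2 *\<^sub>R \<i>) * \<Gamma>2, (x' / x) * x, y') = w"
      using M(3) by (simp add: w tangent_param_def \<mu>)
    moreover have "range ?c \<subseteq> chart_C \<eta>"
      using M by (auto simp: chart_C_eq Mset_def norm_mult)
    moreover have "?c 0 = (0, \<xi>, \<mu>)"
      by (simp add: \<mu>)
    ultimately show "w \<in> tangent_space (chart_C \<eta>) (0, \<xi>, \<mu>)"
      unfolding tangent_space_def by blast
  qed
qed

lemma dim_range_linear:
  fixes f :: "'a::euclidean_space \<Rightarrow> 'b::euclidean_space"
  assumes "linear f" "\<And>v. f v = 0 \<Longrightarrow> v = 0"
  shows "dim (range f) = DIM('a)"
  using assms dim_image_eq[of f UNIV] by (simp add: linear_injective_0)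

lemma dim_tangent_space:
  assumes "p \<in> chart_C \<eta>"
  shows "dim (tangent_space (chart_C \<eta>) p) = 11"
proof -
  obtain \<xi> \<mu> where p: "p = (0, \<xi>, \<mu>)" "(0, \<xi>, \<mu>) \<in> chart_C \<eta>"
    using assms by (auto simp: chart_C_eq)
  obtain h1 h2 \<Gamma>1 \<Gamma>2 x y where \<mu>: "\<mu> = (h1, h2, \<Gamma>1, \<Gamma>2, x, y)"
    by (metis prod.exhaust)
  have "\<Gamma>1 \<noteq> 0" "\<Gamma>2 \<noteq> 0"
    using p(2) by (auto simp: chart_C_eq Mset_def \<mu>)
  then have "dim (range (tangent_param \<mu>)) =
     DIM((real \<times> real \<times> real) \<times> real \<times> real \<times> real \<times> real \<times> complex \<times> complex)"
    by (intro dim_range_linear linearI)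
       (auto simp: tangent_param_def \<mu> algebra_simps zero_prod_def split: prod.splits)
  then show ?thesis
    by (simp add: p tangent_space_collision[OF p(2)])
qed

lemma vector_field_on_collision:
  assumes "\<And>i. i \<in> {1..4} \<Longrightarrow> m i > 0"
  shows "vector_field_on (chart_C \<eta>) (desing_vf m \<eta>)"
  unfolding vector_field_on_def
proof
  fix p assume "p \<in> chart_C \<eta>"
  then obtain \<xi> \<mu> where p: "p = (0, \<xi>, \<mu>)" "(0, \<xi>, \<mu>) \<in> chart_C \<eta>"
    by (auto simp: chart_C_eq)
  have "desing_vf m \<eta> p = tangent_param \<mu> (chart_field \<eta> \<xi>, 0)"
    using desing_vf_collision[of m, OF assms p(2)] by (auto simp: p(1) tangent_param_def zero_prod_def split: prod.split)
  then show "desing_vf m \<eta> p \<in> tangent_space (chart_C \<eta>) p"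
    unfolding p(1) tangent_space_collision[OF p(2)] by simp
qed


section \<open>First integrals\<close>

lemma open_dense_in_self: "open_dense_in S S"
  by (simp add: open_dense_in_def closure_subset)

lemma linear_first_integral:
  assumes m: "\<And>i. i \<in> {1..4} \<Longrightarrow> m i > 0" and f: "bounded_linear f" and z: "\<And>v. f (0, v, 0) = 0"
  shows "first_integral (chart_C \<eta>) (desing_vf m \<eta>) (chart_C \<eta>) euclidean f"
  unfolding first_integral_def
proof (intro conjI allI impI ballI)
  show "continuous_map (top_of_set (chart_C \<eta>)) euclidean f"
    using f by (simp add: linear_continuous_on)
  fix T c s t assume c: "integral_curve (chart_C \<eta>) (desing_vf m \<eta>) T c" and st: "s \<in> T" "t \<in> T"
  have "((\<lambda>t. f (c t)) has_derivative (\<lambda>h. 0)) (at t within T)" if t: "t \<in> T" for t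
  proof -
    obtain \<xi> \<mu> where p: "c t = (0, \<xi>, \<mu>)" "(0, \<xi>, \<mu>) \<in> chart_C \<eta>"
      using c t by (fastforce simp: integral_curve_def chart_C_eq)
    have "(c has_vector_derivative (0, chart_field \<eta> \<xi>, 0)) (at t within T)"
      using c t desing_vf_collision[of m, OF m p(2)] p(1) by (auto simp: integral_curve_def)
    from bounded_linear.has_vector_derivative[OF f this] show ?thesis
      by (simp add: z has_vector_derivative_def)
  qed
  moreover have "convex T"
    using c by (simp add: integral_curve_def is_interval_convex)
  ultimately show "f (c s) = f (c t)"
    using st by (intro has_derivative_zero_unique[of T "\<lambda>t. f (c t)"]) auto
qed (rule open_dense_in_self)

text \<open>Solutions of \<open>w' = g w\<close> with scalar \<open>g\<close> stay on a line through the origin: \<open>exp (- G) w\<close> is constant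
  for an antiderivative \<open>G\<close> of \<open>g\<close>.\<close>

lemma linear_ode_parallel:
  fixes w :: "real \<Rightarrow> 'b::real_normed_vector"
  assumes T: "is_interval T" "s \<in> T" "t \<in> T" and g: "continuous_on T g"
    and w: "\<And>t. t \<in> T \<Longrightarrow> (w has_vector_derivative g t *\<^sub>R w t) (at t within T)"
  shows "\<exists>k. k \<noteq> 0 \<and> w t = k *\<^sub>R w s"
proof -
  have le: "\<exists>k. k \<noteq> 0 \<and> w b = k *\<^sub>R w a" if "a \<le> b" "a \<in> T" "b \<in> T" for a b
  proof -
    have sub: "{a..b} \<subseteq> T"
      using that T(1) by (meson atLeastAtMost_iff mem_is_interval_1_I subsetI)
    obtain G where G: "\<And>x. x \<in> {a..b} \<Longrightarrow> (G has_vector_derivative g x) (at x within {a..b})"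
      using antiderivative_continuous[OF continuous_on_subset[OF g sub]] by blast
    have "((\<lambda>x. exp (- G x) *\<^sub>R w x) has_derivative (\<lambda>h. 0)) (at x within {a..b})" if x: "x \<in> {a..b}" for x
    proof -
      have "(G has_real_derivative g x) (at x within {a..b})"
        using G[OF x] by (simp add: has_real_derivative_iff_has_vector_derivative)
      then have "((\<lambda>x. exp (- G x)) has_real_derivative exp (- G x) * - g x) (at x within {a..b})"
        by (auto intro!: derivative_eq_intros)
      moreover have "(w has_vector_derivative g x *\<^sub>R w x) (at x within {a..b})"
        using w x sub has_vector_derivative_within_subset by blast
      ultimately have "((\<lambda>x. exp (- G x) *\<^sub>R w x) has_vector_derivative
          exp (- G x) *\<^sub>R (g x *\<^sub>R w x) + (exp (- G x) * - g x) *\<^sub>R w x) (at x within {a..b})"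
        by (rule has_vector_derivative_scaleR)
      then show ?thesis
        by (simp add: has_vector_derivative_def)
    qed
    then have "exp (- G b) *\<^sub>R w b = exp (- G a) *\<^sub>R w a"
      using \<open>a \<le> b\<close> by (intro has_derivative_zero_unique[of "{a..b}" "\<lambda>x. exp (- G x) *\<^sub>R w x"]) auto
    then have "exp (G b) *\<^sub>R exp (- G b) *\<^sub>R w b = exp (G b) *\<^sub>R exp (- G a) *\<^sub>R w a"
      by simp
    then have "w b = (exp (G b) * exp (- G a)) *\<^sub>R w a"
      by (simp flip: exp_add)
    then show ?thesis
      by (intro exI[of _ "exp (G b) * exp (- G a)"]) auto
  qed
  show ?thesis
  proof (cases "s \<le> t")
    case True
    then show ?thesis using le T by blast
  next
    case False
    then obtain k where k: "k \<noteq> 0" "w s = k *\<^sub>R w t"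
      using le[of t s] T by auto
    then have "w t = inverse k *\<^sub>R w s" by simp
    then show ?thesis
      using k(1) by (intro exI[of _ "inverse k"]) auto
  qed
qed

text \<open>The map \<open>iota\<close> in homogeneous coordinates, see \<open>iota_span\<close> below.\<close>

definition ratio :: "real \<times> real \<Rightarrow> real option" where
  "ratio w = (if fst w = 0 then None else Some (snd w / fst w))"

lemma iota_span: "iota (span {w}) = ratio w"
proof -
  obtain a b where w: "w = (a, b)" by (cases w)
  have mem: "(1, t) \<in> span {w} \<longleftrightarrow> a \<noteq> 0 \<and> t = b / a" for t
  proof -
    have "(1, t) \<in> span {w} \<longleftrightarrow> (\<exists>k. (1, t) = k *\<^sub>R w)"
      by (auto simp: span_singleton)
    also have "\<dots> \<longleftrightarrow> a \<noteq> 0 \<and> t = b / a"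
    proof
      assume "\<exists>k. (1, t) = k *\<^sub>R w"
      then obtain k where k: "1 = k * a" "t = k * b" by (auto simp: w)
      then have "a \<noteq> 0" by auto
      with k show "a \<noteq> 0 \<and> t = b / a" by (simp add: eq_divide_eq)
    next
      assume "a \<noteq> 0 \<and> t = b / a"
      then show "\<exists>k. (1, t) = k *\<^sub>R w" by (auto simp: w intro!: exI[of _ "1 / a"])
    qed
    finally show ?thesis .
  qed
  show ?thesis
    unfolding iota_def mem by (simp add: w ratio_def)
qed

lemma ratio_scaleR: "k \<noteq> 0 \<Longrightarrow> ratio (k *\<^sub>R w) = ratio w"
  by (simp add: ratio_def)

lemma span_singleton_projective: "span {w} \<in> projective_space \<longleftrightarrow> w \<noteq> 0"
proof -
  have "span {0} \<noteq> span {v}" if "v \<noteq> 0" for v :: 'a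
    using that span_base[of v "{v}"] by auto
  then show ?thesis
    unfolding projective_space_def by (cases "w = 0") auto
qed

text \<open>Continuity at infinity: a neighbourhood of \<open>\<infinity>\<close> omits only a bounded set of slopes, and near a
  vertical line, away from the origin, slopes are vertical or large.\<close>

lemma continuous_map_ratio:
  fixes f :: "'a::metric_space \<Rightarrow> real \<times> real"
  assumes f: "continuous_on D f" and nz: "\<And>p. p \<in> D \<Longrightarrow> f p \<noteq> 0"
  shows "continuous_map (top_of_set D) (Alexandroff_compactification euclideanreal) (\<lambda>p. ratio (f p))"
  unfolding continuous_map_def
proof (intro conjI allI impI)
  show "(\<lambda>p. ratio (f p)) \<in> topspace (top_of_set D) \<rightarrow> topspace (Alexandroff_compactification euclideanreal)"
    by (auto simp: ratio_def)
  have f': "continuous_on D (\<lambda>p. fst (f p))" "continuous_on D (\<lambda>p. snd (f p))"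
    by (intro continuous_intros f)+
  have opn: "openin (top_of_set D) {p \<in> D. f p \<in> W}" if "open W" for W
  proof -
    have "{p \<in> D. f p \<in> W} = D \<inter> f -` W" by blast
    then show ?thesis
      using continuous_openin_preimage_gen[OF f that] by simp
  qed
  have op: "open {w::real \<times> real. fst w \<noteq> 0 \<and> snd w / fst w \<in> V}" if "open V" for V
  proof -
    have "{w::real \<times> real. fst w \<noteq> 0 \<and> snd w / fst w \<in> V} = {w. fst w \<noteq> 0} \<inter> (\<lambda>w. snd w / fst w) -` V"
      by blast
    moreover have "open ({w::real \<times> real. fst w \<noteq> 0} \<inter> (\<lambda>w. snd w / fst w) -` V)"
      by (intro continuous_open_preimage continuous_intros open_Collect_neq that) simp
    ultimately show ?thesis by simp
  qed
  fix U assume "openin (Alexandroff_compactification euclideanreal) U"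
  then consider V where "open V" "U = Some ` V" | C where "compact C" "U = insert None (Some ` (- C))"
    by (auto simp: openin_Alexandroff_compactification Compl_eq_Diff_UNIV)
  then have "openin (top_of_set D) {p \<in> D. ratio (f p) \<in> U}"
  proof cases
    case 1
    from opn[OF op[OF 1(1)]] show ?thesis
      by (rule back_subst[where P = "openin (top_of_set D)"]) (auto simp: 1 ratio_def)
  next
    case 2
    \<comment> \<open>Slopes steeper than \<open>B\<close> avoid \<open>C\<close>, and so does a vertical line.\<close>
    obtain B where B: "\<And>c. c \<in> C \<Longrightarrow> \<bar>c\<bar> \<le> B" "B > 0"
      using compact_imp_bounded[OF 2(1)] by (auto simp: bounded_pos)
    have "open {w::real \<times> real. fst w \<noteq> 0 \<and> snd w / fst w \<in> - C}"
      by (rule op) (simp add: compact_imp_closed 2(1) open_Compl)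
    moreover have "open {w::real \<times> real. B * \<bar>fst w\<bar> < \<bar>snd w\<bar>}"
      by (intro open_Collect_less continuous_intros)
    ultimately have "open ({w::real \<times> real. fst w \<noteq> 0 \<and> snd w / fst w \<in> - C} \<union> {w. B * \<bar>fst w\<bar> < \<bar>snd w\<bar>})"
      by (rule open_Un)
    from opn[OF this] show ?thesis
    proof (rule back_subst[where P = "openin (top_of_set D)"], intro Collect_cong conj_cong refl)
      fix p assume "p \<in> D"
      obtain a b where ab: "f p = (a, b)" by (cases "f p")
      have "b \<noteq> 0" if "a = 0"
        using nz[OF \<open>p \<in> D\<close>] that by (simp add: ab zero_prod_def)
      moreover have "b / a \<notin> C" if "B * \<bar>a\<bar> < \<bar>b\<bar>" "a \<noteq> 0"
      proof -
        have "B < \<bar>b / a\<bar>"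
          using that by (simp add: abs_divide pos_less_divide_eq)
        then show ?thesis
          using B(1)[of "b / a"] by auto
      qed
      ultimately show "f p \<in> {w. fst w \<noteq> 0 \<and> snd w / fst w \<in> - C} \<union> {w. B * \<bar>fst w\<bar> < \<bar>snd w\<bar>} \<longleftrightarrow> ratio (f p) \<in> U"
        by (auto simp: 2 ratio_def ab)
    qed
  qed
  then show "openin (top_of_set D) {p \<in> topspace (top_of_set D). ratio (f p) \<in> U}"
    by simp
qed

text \<open>Both integrals are defined and finite where \<open>\<beta> \<noteq> 0\<close>, so all genericity statements reduce to the
  density of this set: moving in the direction of \<open>\<beta>\<close> leaves \<open>\<beta> = 0\<close>. In the chart \<open>Beta\<close> that
  direction degenerates, but there \<open>\<beta> = 1\<close> throughout.\<close>

lemma beta_nonzero_dense: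
  assumes p: "p \<in> chart_C \<eta>"
  shows "p \<in> closure {q \<in> chart_C \<eta>. fst (snd (hom \<eta> (fst (snd q)))) \<noteq> 0}"
proof -
  obtain \<xi> \<mu> where p: "p = (0, \<xi>, \<mu>)" "\<mu> \<in> Mset"
    using p by (auto simp: chart_C_eq)
  let ?e = "others \<eta> (0, 1, 0, 0)"
  let ?f = "\<lambda>t::real. (0::real, \<xi> + t *\<^sub>R ?e, \<mu>)"
  let ?G = "{q \<in> chart_C \<eta>. fst (snd (hom \<eta> (fst (snd q)))) \<noteq> 0}"
  have "fst (snd (hom \<eta> \<xi>)) \<noteq> 0 \<or> fst (snd (slope \<eta> ?e)) \<noteq> 0"
    by (cases \<eta>; cases \<xi>) (auto simp: slope_def zero_prod_def)
  from eventually_affine_nonzero[OF this]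
  have "eventually (\<lambda>t. ?f t \<in> ?G) (at_right 0)"
    by eventually_elim (simp add: chart_C_eq p(2) hom_add)
  then have "eventually (\<lambda>t. ?f t \<in> closure ?G) (at_right 0)"
    by (rule eventually_mono) (rule subsetD[OF closure_subset])
  moreover have "(?f \<longlongrightarrow> (0, \<xi> + 0 *\<^sub>R ?e, \<mu>)) (at_right 0)"
    by (intro tendsto_intros)
  ultimately show ?thesis
    by (intro Lim_in_closed_set[where F = "at_right (0::real)" and f = ?f]) (auto simp: p)
qed

lemma continuous_on_hom: "continuous_on A (\<lambda>q. hom \<eta> (fst (snd q)))"
proof -
  have "continuous_on A (\<lambda>q. hom \<eta> 0 + slope \<eta> (fst (snd q)))"
    by (intro continuous_intros bounded_linear.continuous_on[OF bounded_linear_slope])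
  then show ?thesis
    unfolding hom_eq_slope[symmetric] .
qed

lemma hom_has_vector_derivative:
  assumes "(x has_vector_derivative x') F"
  shows "((\<lambda>t. hom \<eta> (x t)) has_vector_derivative slope \<eta> x') F"
  using has_vector_derivative_add[OF has_vector_derivative_const
      bounded_linear.has_vector_derivative[OF bounded_linear_slope assms], of "hom \<eta> 0" \<eta>]
  unfolding hom_eq_slope[symmetric] by simp

lemma continuous_on_hom_field: "continuous_on UNIV hom_field"
  unfolding hom_field_def join_def
  by (simp, intro continuous_intros bounded_linear.continuous_on[OF bounded_linear_zeta(1)]
      bounded_linear.continuous_on[OF bounded_linear_zeta(2)])

lemma kappa_in_chart_eq:
  assumes "\<And>v. \<kappa> (span {v}) = span {w v}"
  shows "kappa_in_chart \<kappa> \<eta> = (\<lambda>q. ratio (w (hom \<eta> (fst (snd q)))))"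
    and "kappa_domain \<kappa> \<eta> = {q \<in> chart_C \<eta>. w (hom \<eta> (fst (snd q))) \<noteq> 0}"
  by (auto simp: kappa_in_chart_def kappa_domain_def chart_param_def assms iota_span span_singleton_projective)

text \<open>Let \<open>w\<close> be a pair of homogeneous functions of the same degree \<open>n\<close> that are constant along
  \<open>hom_field\<close>. In a chart, \<open>v = hom \<eta> \<xi>\<close> satisfies \<open>v' = hom_field v - g v\<close> with the scalar
  \<open>g = coord \<eta> (hom_field v)\<close>. Euler's relation turns this into \<open>(w v)' = - n g (w v)\<close>, so the line
  spanned by \<open>w v\<close> is conserved.\<close>

lemma kappa_first_integral:
  fixes w :: "vec4 \<Rightarrow> real \<times> real"
  assumes m: "\<And>i. i \<in> {1..4} \<Longrightarrow> m i > 0"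
    and \<kappa>: "\<And>v. \<kappa> (span {v}) = span {w v}"
    and D: "\<And>v. (w has_derivative w' v) (at v)"
    and inv: "\<And>v. w' v (hom_field v) = 0" and euler: "\<And>v. w' v v = n *\<^sub>R w v"
    and nz: "\<And>v. fst (snd v) \<noteq> 0 \<Longrightarrow> w v \<noteq> 0"
  shows "first_integral (chart_C \<eta>) (desing_vf m \<eta>) (kappa_domain \<kappa> \<eta>)
      (Alexandroff_compactification euclideanreal) (kappa_in_chart \<kappa> \<eta>)"
proof -
  let ?w = "\<lambda>q::chart. w (hom \<eta> (fst (snd q)))"
  note \<kappa>_eq = kappa_in_chart_eq(1)[of \<kappa> w, OF \<kappa>] and D_eq = kappa_in_chart_eq(2)[of \<kappa> w, OF \<kappa>]
  have cw: "continuous_on UNIV w"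
    by (intro continuous_at_imp_continuous_on ballI has_derivative_continuous[OF D])
  have cont: "continuous_on A ?w" for A
    using continuous_on_compose2[OF cw continuous_on_hom] by blast
  show "first_integral (chart_C \<eta>) (desing_vf m \<eta>) (kappa_domain \<kappa> \<eta>)
      (Alexandroff_compactification euclideanreal) (kappa_in_chart \<kappa> \<eta>)"
    unfolding first_integral_def \<kappa>_eq D_eq open_dense_in_def
  proof (intro conjI allI impI ballI)
    have "openin (top_of_set (chart_C \<eta>)) (chart_C \<eta> \<inter> ?w -` (- {0}))"
      by (rule continuous_openin_preimage_gen[OF cont]) auto
    then show "openin (top_of_set (chart_C \<eta>)) {q \<in> chart_C \<eta>. ?w q \<noteq> 0}"
      by (rule back_subst[where P = "openin (top_of_set (chart_C \<eta>))"]) auto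
    have "{q \<in> chart_C \<eta>. fst (snd (hom \<eta> (fst (snd q)))) \<noteq> 0} \<subseteq> {q \<in> chart_C \<eta>. ?w q \<noteq> 0}"
      by (intro Collect_mono impI conjI; elim conjE; (assumption | rule nz))
    then show "chart_C \<eta> \<subseteq> closure {q \<in> chart_C \<eta>. ?w q \<noteq> 0}"
      using beta_nonzero_dense closure_mono by blast
    show "continuous_map (top_of_set {q \<in> chart_C \<eta>. ?w q \<noteq> 0}) (Alexandroff_compactification euclideanreal)
        (\<lambda>q. ratio (?w q))"
      by (rule continuous_map_ratio[OF cont]) auto
  next
    fix T c s t assume c: "integral_curve {q \<in> chart_C \<eta>. ?w q \<noteq> 0} (desing_vf m \<eta>) T c" and st: "s \<in> T" "t \<in> T"
    define v where "v t = hom \<eta> (fst (snd (c t)))" for t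
    define g where "g t = - n * coord \<eta> (hom_field (v t))" for t
    have dw: "((\<lambda>t. w (v t)) has_vector_derivative g t *\<^sub>R w (v t)) (at t within T)" if t: "t \<in> T" for t
    proof -
      obtain \<xi> \<mu> where p: "c t = (0, \<xi>, \<mu>)" "(0, \<xi>, \<mu>) \<in> chart_C \<eta>"
        using c t by (fastforce simp: integral_curve_def chart_C_eq)
      have "(c has_vector_derivative (0, chart_field \<eta> \<xi>, 0)) (at t within T)"
        using c t desing_vf_collision[of m, OF m p(2)] p(1) by (auto simp: integral_curve_def)
      then have "((\<lambda>t. fst (snd (c t))) has_vector_derivative chart_field \<eta> \<xi>) (at t within T)"
        using has_vector_derivative_fst_snd(1)[OF has_vector_derivative_fst_snd(2)] by fastforce
      from hom_has_vector_derivative[OF this]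
      have v': "(v has_vector_derivative slope \<eta> (chart_field \<eta> \<xi>)) (at t within T)"
        by (simp add: v_def[abs_def])
      have "slope \<eta> (chart_field \<eta> \<xi>) = hom_field (v t) - coord \<eta> (hom_field (v t)) *\<^sub>R v t"
        by (simp add: chart_field_def v_def p(1) slope_others hom_eq_slope[of \<eta> \<xi>] scaleR_add_right)
      with v' have dv: "(v has_vector_derivative hom_field (v t) - coord \<eta> (hom_field (v t)) *\<^sub>R v t) (at t within T)"
        by simp
      have lin: "linear (w' (v t))"
        using D has_derivative_linear by blast
      have "w' (v t) (hom_field (v t) - coord \<eta> (hom_field (v t)) *\<^sub>R v t) = g t *\<^sub>R w (v t)"
        by (simp add: linear_diff[OF lin] linear_scale[OF lin] inv euler g_def)
      with vector_derivative_diff_chain_within[OF dv has_derivative_at_withinI[OF D]] show ?thesis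
        by (simp add: o_def)
    qed
    have "continuous_on T c"
      using c by (intro continuous_on_vector_derivative) (auto simp: integral_curve_def)
    then have "continuous_on T v"
      unfolding v_def by (intro continuous_on_compose2[OF continuous_on_hom[of UNIV]]) auto
    then have "continuous_on T g"
      unfolding g_def
      by (intro continuous_intros bounded_linear.continuous_on[OF bounded_linear_coord]
          continuous_on_compose2[OF continuous_on_hom_field]) auto
    from linear_ode_parallel[OF _ st this dw] obtain k where "k \<noteq> 0" "w (v t) = k *\<^sub>R w (v s)"
      using c by (auto simp: integral_curve_def)
    then show "ratio (?w (c s)) = ratio (?w (c t))"
      by (simp add: v_def ratio_scaleR)
  qed
qed


section \<open>The two projective integrals\<close>

definition kappa1_pair :: "vec4 \<Rightarrow> real \<times> real" where
  "kappa1_pair v = (fst (snd v), snd (snd (snd v)))"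

definition kappa2_num :: "vec4 \<Rightarrow> real" where
  "kappa2_num v = (fst v ^ 3 + 3 * (fst (snd v))\<^sup>2 * fst v)
     - (fst (snd (snd v)) ^ 3 + 3 * (snd (snd (snd v)))\<^sup>2 * fst (snd (snd v)))"

definition kappa2_pair :: "vec4 \<Rightarrow> real \<times> real" where
  "kappa2_pair v = (fst (snd v) ^ 3, kappa2_num v)"

definition kappa2_num_deriv :: "vec4 \<Rightarrow> vec4 \<Rightarrow> real" where
  "kappa2_num_deriv v w = 3 * ((fst v)\<^sup>2 + (fst (snd v))\<^sup>2) * fst w + 6 * fst v * fst (snd v) * fst (snd w)
     - 3 * ((fst (snd (snd v)))\<^sup>2 + (snd (snd (snd v)))\<^sup>2) * fst (snd (snd w))
     - 6 * fst (snd (snd v)) * snd (snd (snd v)) * snd (snd (snd w))"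

lemma has_derivative_kappa2_num: "(kappa2_num has_derivative kappa2_num_deriv v) (at v within S)"
  unfolding kappa2_num_def[abs_def]
  by (rule derivative_eq_intros refl)+
     (simp add: kappa2_num_deriv_def fun_eq_iff algebra_simps power2_eq_square)

lemma has_derivative_kappa1_pair: "(kappa1_pair has_derivative kappa1_pair) (at v)"
proof -
  have "bounded_linear kappa1_pair"
    unfolding kappa1_pair_def[abs_def] by (auto intro!: bounded_linear_intros bounded_linear_Pair)
  then show ?thesis
    by (rule bounded_linear_imp_has_derivative)
qed

lemma has_derivative_kappa2_pair: "(kappa2_pair has_derivative (\<lambda>w. (3 * (fst (snd v))\<^sup>2 * fst (snd w), kappa2_num_deriv v w))) (at v)"
proof -
  have "((\<lambda>v. fst (snd v) ^ 3) has_derivative (\<lambda>w. 3 * (fst (snd v))\<^sup>2 * fst (snd w))) (at v)"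
    by (rule derivative_eq_intros refl)+ (simp add: fun_eq_iff mult_ac)
  from has_derivative_Pair[OF this has_derivative_kappa2_num] show ?thesis
    unfolding kappa2_pair_def[abs_def] .
qed

lemma kappa_hat1_span: "kappa_hat1 (span {v}) = span {kappa1_pair v}"
proof -
  have "(\<lambda>(\<alpha>, \<beta>, \<gamma>, \<delta>). (\<beta>, \<delta>)) (k *\<^sub>R v) = k *\<^sub>R kappa1_pair v" for k :: real
    by (cases v) (simp add: kappa1_pair_def)
  then show ?thesis
    by (simp add: kappa_hat1_def span_singleton image_image)
qed

text \<open>The formula is homogeneous of degree \<open>3\<close>, and cubing maps \<open>\<real>\<close> onto \<open>\<real>\<close>.\<close>

lemma kappa_hat2_span: "kappa_hat2 (span {v}) = span {kappa2_pair v}"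
proof -
  have cube: "(\<lambda>(\<alpha>, \<beta>, \<gamma>, \<delta>). (\<beta> ^ 3, (\<alpha> ^ 3 + 3 * \<beta>\<^sup>2 * \<alpha>) - (\<gamma> ^ 3 + 3 * \<delta>\<^sup>2 * \<gamma>))) (k *\<^sub>R v)
     = (k ^ 3) *\<^sub>R kappa2_pair v" for k :: real
    by (cases v) (simp add: kappa2_pair_def kappa2_num_def power_mult_distrib algebra_simps power2_eq_square power3_eq_cube)
  have "range (\<lambda>k::real. (k ^ 3) *\<^sub>R kappa2_pair v) = range (\<lambda>k. k *\<^sub>R kappa2_pair v)"
  proof -
    have "k \<in> range (\<lambda>k::real. k ^ 3)" for k
      using odd_real_root_pow[of 3 k] by (intro range_eqI[of _ _ "root 3 k"]) simp
    then have "range (\<lambda>k::real. k ^ 3) = UNIV" by auto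
    moreover have "range (\<lambda>k::real. (k ^ 3) *\<^sub>R kappa2_pair v) = (\<lambda>k. k *\<^sub>R kappa2_pair v) ` range (\<lambda>k. k ^ 3)"
      by (simp add: image_image)
    ultimately show ?thesis
      by simp
  qed
  then show ?thesis
    unfolding kappa_hat2_def span_singleton image_image cube .
qed

lemmas norm_zeta_simps = zeta1_def zeta2_def cmod_power2

text \<open>The directions \<open>\<alpha>\<close> and \<open>\<gamma>\<close> contribute \<open>3 (\<alpha>\<^sup>2 + \<beta>\<^sup>2) (\<gamma>\<^sup>2 + \<delta>\<^sup>2)\<close> with opposite signs.\<close>

lemma kappa2_num_deriv_hom_field: "kappa2_num_deriv v (hom_field v) = 0"
  by (simp add: kappa2_num_deriv_def hom_field_def join_def norm_zeta_simps algebra_simps)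

lemma kappa2_num_deriv_euler: "kappa2_num_deriv v v = 3 * kappa2_num v"
  by (simp add: kappa2_num_deriv_def kappa2_num_def algebra_simps power2_eq_square power3_eq_cube)

lemma kappa1_first_integral:
  assumes "\<And>i. i \<in> {1..4} \<Longrightarrow> m i > 0"
  shows "first_integral (chart_C \<eta>) (desing_vf m \<eta>) (kappa_domain kappa_hat1 \<eta>)
      (Alexandroff_compactification euclideanreal) (kappa_in_chart kappa_hat1 \<eta>)"
proof (rule kappa_first_integral[OF _ kappa_hat1_span has_derivative_kappa1_pair])
  show "kappa1_pair (hom_field v) = 0" "kappa1_pair v = 1 *\<^sub>R kappa1_pair v" "fst (snd v) \<noteq> 0 \<Longrightarrow> kappa1_pair v \<noteq> 0" for v
    by (auto simp: kappa1_pair_def hom_field_def join_def zero_prod_def)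
qed (rule assms)

lemma kappa2_first_integral:
  assumes "\<And>i. i \<in> {1..4} \<Longrightarrow> m i > 0"
  shows "first_integral (chart_C \<eta>) (desing_vf m \<eta>) (kappa_domain kappa_hat2 \<eta>)
      (Alexandroff_compactification euclideanreal) (kappa_in_chart kappa_hat2 \<eta>)"
proof (rule kappa_first_integral[OF _ kappa_hat2_span has_derivative_kappa2_pair])
  fix v
  have "fst (snd (hom_field v)) = 0"
    by (simp add: hom_field_def join_def)
  then show "(3 * (fst (snd v))\<^sup>2 * fst (snd (hom_field v)), kappa2_num_deriv v (hom_field v)) = 0"
    by (simp add: kappa2_num_deriv_hom_field zero_prod_def)
  show "(3 * (fst (snd v))\<^sup>2 * fst (snd v), kappa2_num_deriv v v) = 3 *\<^sub>R kappa2_pair v"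
    by (simp add: kappa2_num_deriv_euler kappa2_pair_def power2_eq_square power3_eq_cube)
  show "fst (snd v) \<noteq> 0 \<Longrightarrow> kappa2_pair v \<noteq> 0"
    by (simp add: kappa2_pair_def zero_prod_def)
qed (rule assms)


section \<open>Functional independence\<close>

text \<open>The derivative of \<open>(\<kappa>1, \<kappa>2)\<close> as a map on \<open>\<real>\<^sup>4\<close> at the point \<open>v\<close> in the direction \<open>w\<close>.\<close>

definition kappa_deriv :: "vec4 \<Rightarrow> vec4 \<Rightarrow> real \<times> real" where
  "kappa_deriv v w = (snd (snd (snd w)) / fst (snd v) - snd (snd (snd v)) * fst (snd w) / (fst (snd v))\<^sup>2,
     kappa2_num_deriv v w / fst (snd v) ^ 3 - 3 * kappa2_num v * fst (snd w) / fst (snd v) ^ 4)"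

lemma has_derivative_kappa:
  assumes "fst (snd v) \<noteq> 0"
  shows "((\<lambda>v. (snd (snd (snd v)) / fst (snd v), kappa2_num v / fst (snd v) ^ 3)) has_derivative kappa_deriv v) (at v)"
proof -
  have b: "((\<lambda>v. fst (snd v)) has_derivative (\<lambda>w. fst (snd w))) (at v)"
    "((\<lambda>v. snd (snd (snd v))) has_derivative (\<lambda>w. snd (snd (snd w)))) (at v)"
    by (auto intro!: derivative_intros)
  have b3: "((\<lambda>v. fst (snd v) ^ 3) has_derivative (\<lambda>w. 3 * (fst (snd v))\<^sup>2 * fst (snd w))) (at v)"
    by (rule derivative_eq_intros refl)+ (simp add: fun_eq_iff mult_ac)
  have quot: "(x * b - n * y) / (b * b) = x / b - n * y / b\<^sup>2"
    "(x * b ^ 3 - n * (3 * b\<^sup>2 * y)) / (b ^ 3 * b ^ 3) = x / b ^ 3 - 3 * n * y / b ^ 4" if "b \<noteq> 0" for b x y n :: real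
    using that by (simp_all add: field_simps eval_nat_numeral)
  have n3: "fst (snd v) ^ 3 \<noteq> 0" using assms by simp
  from has_derivative_Pair[OF has_derivative_divide'[OF b(2,1) assms]
      has_derivative_divide'[OF has_derivative_kappa2_num[of v UNIV] b3 n3]]
  show ?thesis
    by (rule has_derivative_eq_rhs) (simp only: fun_eq_iff kappa_deriv_def quot[OF assms] simp_thms)
qed

lemma kappa_deriv_euler: "fst (snd v) \<noteq> 0 \<Longrightarrow> kappa_deriv v v = 0"
  by (simp add: kappa_deriv_def kappa2_num_deriv_euler zero_prod_def field_simps eval_nat_numeral)

text \<open>Moving \<open>\<delta>\<close> changes \<open>\<kappa>1\<close>. Moving \<open>\<alpha>\<close> changes \<open>\<kappa>2\<close>, at rate \<open>3 (\<alpha>\<^sup>2 + \<beta>\<^sup>2) / \<beta>\<^sup>3 \<noteq> 0\<close>, but not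
  \<open>\<kappa>1\<close>.\<close>

lemma kappa_deriv_surj:
  assumes b: "fst (snd v) \<noteq> 0"
  shows "\<exists>w. kappa_deriv v w = (A, B)"
proof -
  obtain \<alpha> \<beta> \<gamma> \<delta> where v: "v = (\<alpha>, \<beta>, \<gamma>, \<delta>)"
    by (metis prod.exhaust)
  define d where "d = \<beta> * A"
  define a where "a = (B * \<beta> ^ 3 + 6 * \<gamma> * \<delta> * d) / (3 * (\<alpha>\<^sup>2 + \<beta>\<^sup>2))"
  have "\<beta> \<noteq> 0" using b by (simp add: v)
  moreover from this have "3 * (\<alpha>\<^sup>2 + \<beta>\<^sup>2) \<noteq> 0"
    by (smt (verit) zero_less_power2 zero_le_power2)
  then have "3 * (\<alpha>\<^sup>2 + \<beta>\<^sup>2) * a = B * \<beta> ^ 3 + 6 * \<gamma> * \<delta> * d"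
    unfolding a_def times_divide_eq_right by (rule nonzero_mult_div_cancel_left)
  ultimately have "kappa_deriv v (a, 0, 0, d) = (A, B)"
    by (simp add: kappa_deriv_def kappa2_num_deriv_def v d_def)
  then show ?thesis ..
qed

text \<open>Along the flow on the collision manifold the point of \<open>\<M>\<close> is at rest.\<close>

lemma M_coordinates_first_integrals:
  fixes \<eta> :: axis
  assumes m: "\<And>i. i \<in> {1..4} \<Longrightarrow> m i > 0"
  defines "S \<equiv> chart_C \<eta>" and "V \<equiv> desing_vf m \<eta>"
  shows "first_integral S V S euclidean (\<lambda>(r, \<xi>, h1, h2, \<Gamma>1, \<Gamma>2, x, y). h1)"
    "first_integral S V S euclidean (\<lambda>(r, \<xi>, h1, h2, \<Gamma>1, \<Gamma>2, x, y). h2)"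
    "first_integral S V S euclidean (\<lambda>(r, \<xi>, h1, h2, \<Gamma>1, \<Gamma>2, x, y). \<Gamma>1)"
    "first_integral S V S euclidean (\<lambda>(r, \<xi>, h1, h2, \<Gamma>1, \<Gamma>2, x, y). \<Gamma>2)"
    "first_integral S V S euclidean (\<lambda>(r, \<xi>, h1, h2, \<Gamma>1, \<Gamma>2, x, y). x)"
    "first_integral S V S euclidean (\<lambda>(r, \<xi>, h1, h2, \<Gamma>1, \<Gamma>2, x, y). y)"
  unfolding S_def V_def case_prod_unfold
  by (rule linear_first_integral[OF m]; (intro bounded_linear_intros | simp))+

text \<open>The differential of \<open>(\<kappa>1, \<kappa>2)\<close> is onto \<open>\<real>\<^sup>2\<close> wherever \<open>\<beta> \<noteq> 0\<close>. It remains so after restriction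
  to a chart, because \<open>\<kappa>1\<close> and \<open>\<kappa>2\<close> are homogeneous of degree \<open>0\<close> and their differential kills the
  direction that the chart leaves out. The coordinates of \<open>\<M>\<close> add rank \<open>8\<close>.\<close>

lemma integrals_generically_independent:
  fixes \<eta> :: axis
  defines "S \<equiv> chart_C \<eta>"
    and "\<kappa>1 \<equiv> kappa_in_chart kappa_hat1 \<eta>" and "D1 \<equiv> kappa_domain kappa_hat1 \<eta>"
    and "\<kappa>2 \<equiv> kappa_in_chart kappa_hat2 \<eta>" and "D2 \<equiv> kappa_domain kappa_hat2 \<eta>"
  shows "generically_independent S {p \<in> D1 \<inter> D2. \<kappa>1 p \<noteq> None \<and> \<kappa>2 p \<noteq> None} 10
    (\<lambda>p. case p of (r, \<xi>, h1, h2, \<Gamma>1, \<Gamma>2, x, y) \<Rightarrow> (the (\<kappa>1 p), the (\<kappa>2 p), h1, h2, \<Gamma>1, \<Gamma>2, x, y))"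
    (is "generically_independent S ?E 10 ?F")
  unfolding generically_independent_def
proof (rule exI, intro conjI ballI)
  let ?\<beta> = "\<lambda>q::chart. fst (snd (hom \<eta> (fst (snd q))))"
  let ?G = "{q \<in> S. ?\<beta> q \<noteq> 0}"
  have op: "open {q. ?\<beta> q \<noteq> 0}"
    by (intro open_Collect_neq continuous_intros continuous_on_hom)
  then have "openin (top_of_set S) ?G"
    using openin_open_Int[OF op, of S] by (simp add: Int_def)
  moreover have "S \<subseteq> closure ?G"
    using beta_nonzero_dense by (auto simp: S_def)
  ultimately show "open_dense_in S ?G"
    by (simp add: open_dense_in_def)
  show "?G \<subseteq> ?E"
    by (auto simp: \<kappa>1_def \<kappa>2_def D1_def D2_def kappa_in_chart_eq[of kappa_hat1 kappa1_pair, OF kappa_hat1_span] kappa_in_chart_eq[of kappa_hat2 kappa2_pair, OF kappa_hat2_span] S_def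
        ratio_def kappa1_pair_def kappa2_pair_def zero_prod_def)
  fix p assume "p \<in> ?G"
  then obtain \<xi> \<mu> where p: "p = (0, \<xi>, \<mu>)" "(0, \<xi>, \<mu>) \<in> chart_C \<eta>" and \<beta>: "?\<beta> p \<noteq> 0"
    by (auto simp: S_def chart_C_eq)
  obtain h1 h2 \<Gamma>1 \<Gamma>2 x y where \<mu>: "\<mu> = (h1, h2, \<Gamma>1, \<Gamma>2, x, y)"
    by (metis prod.exhaust)
  have M: "\<Gamma>1 \<noteq> 0" "\<Gamma>2 \<noteq> 0"
    using p(2) by (auto simp: chart_C_eq Mset_def \<mu>)
  define v where "v = hom \<eta> \<xi>"
  have b: "fst (snd v) \<noteq> 0"
    using \<beta> by (simp add: p v_def)
  let ?s = "\<lambda>v::vec4. (snd (snd (snd v)) / fst (snd v), kappa2_num v / fst (snd v) ^ 3)"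
  let ?F1 = "\<lambda>q::chart. (fst (?s (hom \<eta> (fst (snd q)))), snd (?s (hom \<eta> (fst (snd q)))), snd (snd q))"
  let ?F' = "\<lambda>d::chart. (fst (kappa_deriv v (slope \<eta> (fst (snd d)))), snd (kappa_deriv v (slope \<eta> (fst (snd d)))), snd (snd d))"
  have hom': "((\<lambda>q::chart. hom \<eta> (fst (snd q))) has_derivative (\<lambda>d. slope \<eta> (fst (snd d)))) (at p)"
  proof -
    have "((\<lambda>q::chart. hom \<eta> 0 + slope \<eta> (fst (snd q))) has_derivative (\<lambda>d. 0 + slope \<eta> (fst (snd d)))) (at p)"
      by (intro has_derivative_add has_derivative_const bounded_linear.has_derivative[OF bounded_linear_slope]
          has_derivative_fst has_derivative_snd has_derivative_ident)
    then show ?thesis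
      unfolding hom_eq_slope[symmetric] by simp
  qed
  have sl: "(?s has_derivative kappa_deriv v) (at (hom \<eta> (fst (snd p))))"
    using has_derivative_kappa[OF b] by (simp add: p v_def)
  have s': "((\<lambda>q. ?s (hom \<eta> (fst (snd q)))) has_derivative (\<lambda>d. kappa_deriv v (slope \<eta> (fst (snd d))))) (at p)"
    by (rule has_derivative_compose[OF hom' sl])
  have "(?F1 has_derivative ?F') (at p)"
    by (intro has_derivative_Pair has_derivative_fst[OF s'] has_derivative_snd[OF s']
        has_derivative_snd has_derivative_ident)
  then have "(?F1 has_derivative ?F') (at p within S)"
    by (rule has_derivative_at_withinI)
  moreover have "?F1 q = ?F q" if "q \<in> {q. ?\<beta> q \<noteq> 0}" for q
  proof -
    obtain r \<xi> h1 h2 \<Gamma>1 \<Gamma>2 x y where q: "q = (r, \<xi>, h1, h2, \<Gamma>1, \<Gamma>2, x, y)"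
      by (metis prod.exhaust)
    show ?thesis
      using that unfolding \<kappa>1_def \<kappa>2_def kappa_in_chart_eq(1)[of kappa_hat1 kappa1_pair, OF kappa_hat1_span] kappa_in_chart_eq(1)[of kappa_hat2 kappa2_pair, OF kappa_hat2_span]
      by (simp add: q ratio_def kappa1_pair_def kappa2_pair_def)
  qed
  ultimately have F: "(?F has_derivative ?F') (at p within S)"
    using has_derivative_transform_within_open[OF _ op, of ?F1 ?F' p S ?F] \<beta> by blast
  define L where "L = (\<lambda>(A, B, k1, k2, t1, t2, x', y'). (A, B, k1, k2, t1 *\<^sub>R (\<i> * \<Gamma>1), t2 *\<^sub>R (\<i> * \<Gamma>2), x', y')
     :: real \<times> real \<times> real \<times> real \<times> complex \<times> complex \<times> complex \<times> complex)"
  have "?F' ` tangent_space S p = range L"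
  proof (intro equalityI subsetI)
    fix z assume "z \<in> ?F' ` tangent_space S p"
    then obtain v' k1 k2 t1 t2 x' y' where "z = ?F' (tangent_param \<mu> (v', k1, k2, t1, t2, x', y'))"
      unfolding p(1) S_def tangent_space_collision[OF p(2)] by auto
    then have "z = L (fst (kappa_deriv v (slope \<eta> v')), snd (kappa_deriv v (slope \<eta> v')), k1, k2, t1, t2, x', y')"
      by (simp add: L_def tangent_param_def \<mu>)
    then show "z \<in> range L" by blast
  next
    fix z assume "z \<in> range L"
    then obtain A B k1 k2 t1 t2 x' y' where z: "z = L (A, B, k1, k2, t1, t2, x', y')"
      by auto
    obtain w where w: "kappa_deriv v w = (A, B)"
      using kappa_deriv_surj[OF b] by blast
    \<comment> \<open>Subtracting a multiple of \<open>v\<close> from \<open>w\<close> makes it tangent to the chart.\<close>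
    let ?v' = "others \<eta> w - coord \<eta> w *\<^sub>R \<xi>"
    have "slope \<eta> ?v' = w - coord \<eta> w *\<^sub>R v"
      by (simp add: slope_others v_def hom_eq_slope[of \<eta> \<xi>] scaleR_add_right)
    moreover have lin: "linear (kappa_deriv v)"
      using has_derivative_kappa[OF b] has_derivative_linear by blast
    ultimately have "kappa_deriv v (slope \<eta> ?v') = (A, B)"
      by (simp add: linear_diff[OF lin] linear_scale[OF lin] kappa_deriv_euler[OF b] w)
    then have "z = ?F' (tangent_param \<mu> (?v', k1, k2, t1, t2, x', y'))"
      by (simp add: z L_def tangent_param_def \<mu>)
    then show "z \<in> ?F' ` tangent_space S p"
      unfolding p(1) S_def tangent_space_collision[OF p(2)] by blast
  qed
  also have "dim (range L) = DIM(real \<times> real \<times> real \<times> real \<times> real \<times> real \<times> complex \<times> complex)"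
    using M by (intro dim_range_linear linearI)
       (auto simp: L_def algebra_simps zero_prod_def split: prod.splits)
  finally have "dim (?F' ` tangent_space S p) = 10"
    by simp
  with F show "\<exists>F'. (?F has_derivative F') (at p within S) \<and> dim (F' ` tangent_space S p) = 10"
    by blast
qed

theorem corollary3p7:
  fixes m :: "nat \<Rightarrow> real" and \<eta> :: axis
  assumes "\<And>i. i \<in> {1..4} \<Longrightarrow> m i > 0"
  shows "let S = chart_C \<eta>; V = desing_vf m \<eta>;
             \<kappa>1 = kappa_in_chart kappa_hat1 \<eta>; D1 = kappa_domain kappa_hat1 \<eta>;
             \<kappa>2 = kappa_in_chart kappa_hat2 \<eta>; D2 = kappa_domain kappa_hat2 \<eta>
         in (\<forall>p\<in>S. dim (tangent_space S p) = 11) \<and>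
            vector_field_on S V \<and>
            first_integral S V D1 (Alexandroff_compactification euclideanreal) \<kappa>1 \<and>
            first_integral S V D2 (Alexandroff_compactification euclideanreal) \<kappa>2 \<and>
            first_integral S V S euclidean (\<lambda>(r, \<xi>, h1, h2, \<Gamma>1, \<Gamma>2, x, y). h1) \<and>
            first_integral S V S euclidean (\<lambda>(r, \<xi>, h1, h2, \<Gamma>1, \<Gamma>2, x, y). h2) \<and>
            first_integral S V S euclidean (\<lambda>(r, \<xi>, h1, h2, \<Gamma>1, \<Gamma>2, x, y). \<Gamma>1) \<and>
            first_integral S V S euclidean (\<lambda>(r, \<xi>, h1, h2, \<Gamma>1, \<Gamma>2, x, y). \<Gamma>2) \<and>
            first_integral S V S euclidean (\<lambda>(r, \<xi>, h1, h2, \<Gamma>1, \<Gamma>2, x, y). x) \<and>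
            first_integral S V S euclidean (\<lambda>(r, \<xi>, h1, h2, \<Gamma>1, \<Gamma>2, x, y). y) \<and>
            generically_independent S {p \<in> D1 \<inter> D2. \<kappa>1 p \<noteq> None \<and> \<kappa>2 p \<noteq> None} 10
              (\<lambda>p. case p of (r, \<xi>, h1, h2, \<Gamma>1, \<Gamma>2, x, y) \<Rightarrow>
                 (the (\<kappa>1 p), the (\<kappa>2 p), h1, h2, \<Gamma>1, \<Gamma>2, x, y))"
  unfolding Let_def
  by (intro conjI ballI dim_tangent_space vector_field_on_collision kappa1_first_integral kappa2_first_integral
      M_coordinates_first_integrals integrals_generically_independent assms)

end
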